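(* Let $\omega$ be an ${\rm A}_\infty$-weight on $\mathbb{R}$ such that $\alpha=\log\omega\in {\rm VMO}(\mathbb{R})$. Let $f(x)=\int_0^x\omega(y)\,dy$, and let $F:\mathbb{U}\to\mathbb{U}$ be the quasiconformal diffeomorphism of the upper half-plane $\mathbb{U}=\{(x,t)\mid x\in\mathbb{R},\ t>0\}$ given by $F(x,t)=(U(x,t),V(x,t))$ with $U(x,t)=(f*\phi_t)(x)$ and $V(x,t)=(f*\psi_t)(x)$, where $\phi(x)=\frac{1}{\sqrt{\pi}}e^{-x^2}$, $\psi(x)=\phi'(x)=-2x\phi(x)$, $\phi_t(x)=\frac1t\phi(\frac xt)$ and $\psi_t(x)=\frac1t\psi(\frac xt)$. Then the complex dilatation $\mu_F$ of $F$ satisfies that $\frac1t|\mu_F(x,t)|^2\,dx\,dt$ is a vanishing Carleson measure on $\mathbb{U}$.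
   Context: $|\cdot|$ denotes Lebesgue measure on $\mathbb{R}$. An ${\rm A}_\infty$-weight is a weight in Muckenhoupt's class ${\rm A}_\infty(\mathbb{R})$ (standard notion). Equivalently, it is a locally integrable, almost everywhere positive function $\omega$ on $\mathbb{R}$, with $\log\omega$ locally integrable, for which there is a constant $C$ with $\frac{1}{|I|}\int_I\omega(x)\,dx\le C\exp\left(\frac{1}{|I|}\int_I\log\omega(x)\,dx\right)$ for every bounded interval $I\subset\mathbb{R}$. Such a weight is doubling, and $\log\omega\in{\rm BMO}(\mathbb{R})$. For a locally integrable function $h$ on $\mathbb{R}$ and a bounded interval $I$, let $h_I=\frac{1}{|I|}\int_I h(x)\,dx$. One says $h\in{\rm BMO}(\mathbb{R})$ if $\sup_I\frac{1}{|I|}\int_I|h(x)-h_I|\,dx<\infty$, the supremum being over all bounded intervals $I\subset\mathbb{R}$. One says $h\in{\rm VMO}(\mathbb{R})$ if $h\in{\rm BMO}(\mathbb{R})$ and $\lim_{|I|\to0}\frac{1}{|I|}\int_I|h(x)-h_I|\,dx=0$ (the limit being uniform in the position of $I$). Convolution is $(g*h)(x)=\int_{\mathbb{R}}g(y)h(x-y)\,dy$. For a doubling weight $\omega$, the map $F$ is a quasiconformal diffeomorphism of $\mathbb{U}$ onto itself extending continuously to $f$ on $\mathbb{R}$. Its complex dilatation is $\mu_F=\bar\partial F/\partial F$, where $F$ is regarded as the complex-valued function $U+iV$ of $z=x+it$. A measure $\lambda(x,t)\,dx\,dt$ (with $\lambda\ge0$ measurable) on $\mathbb{U}$ is a Carleson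 measure if $\sup_I\frac{1}{|I|}\int_0^{|I|}\int_I\lambda(x,t)\,dx\,dt<\infty$, the supremum being over all bounded intervals $I\subset\mathbb{R}$. A Carleson measure is vanishing if in addition $\lim_{|I|\to0}\frac{1}{|I|}\int_0^{|I|}\int_I\lambda(x,t)\,dx\,dt=0$ (the limit being uniform in the position of $I$). *)

theory Defs
  imports "HOL-Analysis.Analysis"
begin

section \<open>Averages over bounded intervals\<close>

text \<open>
  A bounded interval \<open>I\<close> of positive length is represented by its endpoints \<open>a < b\<close>. All averages
  below are insensitive to whether the endpoints belong to \<open>I\<close>, so closed intervals are used.
\<close>

definition locally_integrable :: "(real \<Rightarrow> real) \<Rightarrow> bool" where
  "locally_integrable h \<longleftrightarrow> (\<forall>a b. set_integrable lebesgue {a..b} h)"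

definition interval_mean :: "real \<Rightarrow> real \<Rightarrow> (real \<Rightarrow> real) \<Rightarrow> real" where
  "interval_mean a b h = 1 / (b - a) * (LINT x:{a..b}|lebesgue. h x)"

definition mean_oscillation :: "real \<Rightarrow> real \<Rightarrow> (real \<Rightarrow> real) \<Rightarrow> real" where
  "mean_oscillation a b h = interval_mean a b (\<lambda>x. \<bar>h x - interval_mean a b h\<bar>)"

definition BMO :: "(real \<Rightarrow> real) \<Rightarrow> bool" where
  "BMO h \<longleftrightarrow> locally_integrable h \<and> bdd_above {mean_oscillation a b h | a b. a < b}"

definition VMO :: "(real \<Rightarrow> real) \<Rightarrow> bool" where
  "VMO h \<longleftrightarrow> BMO h \<and>
    (\<forall>\<epsilon>>0. \<exists>\<delta>>0. \<forall>a b. a < b \<and> b - a < \<delta> \<longrightarrow> mean_oscillation a b h < \<epsilon>)"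

definition A_infinity_weight :: "(real \<Rightarrow> real) \<Rightarrow> bool" where
  "A_infinity_weight \<omega> \<longleftrightarrow>
    locally_integrable \<omega> \<and> (AE x in lebesgue. 0 < \<omega> x) \<and> locally_integrable (\<lambda>x. ln (\<omega> x)) \<and>
    (\<exists>C. \<forall>a b. a < b \<longrightarrow>
      interval_mean a b \<omega> \<le> C * exp (interval_mean a b (\<lambda>x. ln (\<omega> x))))"


section \<open>The extension by convolution with the heat kernel and its derivative\<close>

definition convolution :: "(real \<Rightarrow> real) \<Rightarrow> (real \<Rightarrow> real) \<Rightarrow> real \<Rightarrow> real" where
  "convolution g h x = (LINT y|lebesgue. g y * h (x - y))"

definition dilate :: "(real \<Rightarrow> real) \<Rightarrow> real \<Rightarrow> real \<Rightarrow> real" where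
  "dilate k t x = 1 / t * k (x / t)"

definition phi :: "real \<Rightarrow> real" where
  "phi x = 1 / sqrt pi * exp (- x\<^sup>2)"

definition psi :: "real \<Rightarrow> real" where
  "psi x = - 2 * x * phi x"

lemma phi_has_derivative_psi: "(phi has_real_derivative psi x) (at x)"
  unfolding phi_def [abs_def] psi_def by (rule derivative_eq_intros refl | simp)+

text \<open>
  The point \<open>(x, t)\<close> of the upper half-plane is identified with \<open>x + \<i>t\<close>; only the values at
  \<open>t > 0\<close> are meaningful.
\<close>

definition heat_extension :: "(real \<Rightarrow> real) \<Rightarrow> complex \<Rightarrow> complex" where
  "heat_extension f z =
    Complex (convolution f (dilate phi (Im z)) (Re z)) (convolution f (dilate psi (Im z)) (Re z))"


section \<open>Complex dilatation\<close>

definition partial_x :: "(complex \<Rightarrow> complex) \<Rightarrow> complex \<Rightarrow> complex" where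
  "partial_x F z = vector_derivative (\<lambda>x. F (Complex x (Im z))) (at (Re z))"

definition partial_t :: "(complex \<Rightarrow> complex) \<Rightarrow> complex \<Rightarrow> complex" where
  "partial_t F z = vector_derivative (\<lambda>t. F (Complex (Re z) t)) (at (Im z))"

definition wirtinger_d :: "(complex \<Rightarrow> complex) \<Rightarrow> complex \<Rightarrow> complex" where
  "wirtinger_d F z = (partial_x F z - \<i> * partial_t F z) / 2"

definition wirtinger_dbar :: "(complex \<Rightarrow> complex) \<Rightarrow> complex \<Rightarrow> complex" where
  "wirtinger_dbar F z = (partial_x F z + \<i> * partial_t F z) / 2"

definition complex_dilatation :: "(complex \<Rightarrow> complex) \<Rightarrow> complex \<Rightarrow> complex" where
  "complex_dilatation F z = wirtinger_dbar F z / wirtinger_d F z"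


section \<open>Carleson measures on the upper half-plane\<close>

text \<open>
  A measure \<open>k(x,t) dx dt\<close> is represented by its density \<open>k\<close>, of which only the values at \<open>t > 0\<close>
  matter. Integrals are taken in the extended nonnegative reals, so that no integrability of \<open>k\<close>
  is presupposed.
\<close>

definition density_on_half_plane :: "(real \<Rightarrow> real \<Rightarrow> real) \<Rightarrow> bool" where
  "density_on_half_plane k \<longleftrightarrow>
    (\<forall>x t. 0 < t \<longrightarrow> 0 \<le> k x t) \<and>
    (\<lambda>(x, t). k x t) \<in> borel_measurable (lebesgue_on {(x, t). 0 < t})"

definition carleson_ratio :: "(real \<Rightarrow> real \<Rightarrow> real) \<Rightarrow> real \<Rightarrow> real \<Rightarrow> ennreal" where
  "carleson_ratio k a b =
    (\<integral>\<^sup>+t\<in>{0<..<b - a}. (\<integral>\<^sup>+x\<in>{a..b}. ennreal (k x t) \<partial>lebesgue) \<partial>lebesgue) / ennreal (b - a)"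

definition carleson_measure :: "(real \<Rightarrow> real \<Rightarrow> real) \<Rightarrow> bool" where
  "carleson_measure k \<longleftrightarrow>
    density_on_half_plane k \<and> (SUP (a, b)\<in>{(a, b). a < b}. carleson_ratio k a b) < \<infinity>"

definition vanishing_carleson_measure :: "(real \<Rightarrow> real \<Rightarrow> real) \<Rightarrow> bool" where
  "vanishing_carleson_measure k \<longleftrightarrow> carleson_measure k \<and>
    (\<forall>\<epsilon>>0. \<exists>\<delta>>0. \<forall>a b. a < b \<and> b - a < \<delta> \<longrightarrow> carleson_ratio k a b < ennreal \<epsilon>)"

end

theory Submission
  imports Defs "HOL-Probability.Sinc_Integral"
begin

text \<open>
  Write \<open>\<omega> = exp \<alpha>\<close> and let \<open>u(x,t) = (\<omega> * \<phi>\<^sub>t)(x)\<close>. In the time variable \<open>t\<^sup>2/4\<close> this is the caloric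
  extension of \<open>\<omega>\<close>, so \<open>u\<^sub>t = (t/2) u\<^sub>x\<^sub>x\<close>. Since \<open>f' = \<omega>\<close> and \<open>\<psi> = \<phi>'\<close>, one has \<open>U\<^sub>x = u\<close>, \<open>U\<^sub>t = (t/2) u\<^sub>x\<close>
  and \<open>V = t u\<close>. Hence the dilatation is an explicit quotient, and
  \<open>|\<mu>|\<^sup>2/t \<le> (1/4) t\<^sup>3 q\<^sup>2 + (9/4) t p\<^sup>2\<close> with \<open>p = u\<^sub>x/u\<close> and \<open>q = u\<^sub>x\<^sub>x/u\<close> (lemmas \<open>dilatation_formula\<close>,
  \<open>dilatation_bound\<close>).
  
  The Carleson estimate comes from integrating a nonlinear heat equation. The function \<open>ln u\<close>
  satisfies \<open>(\<partial>\<^sub>t - (t/2)\<partial>\<^sub>x\<^sup>2) ln u = (t/2) p\<^sup>2\<close>, and subtracting \<open>(t p)\<^sup>2/4\<close> from a large multiple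
  \<open>A ln u\<close> produces a function whose image under the same operator also controls \<open>t\<^sup>3 q\<^sup>2\<close>
  (\<open>caloric_defect_ge\<close>). Integrated over a box \<open>[a,b] \<times> [s,T]\<close> with \<open>T = b - a\<close>, this leaves only
  boundary terms (\<open>energy_identity\<close>): the integrals of \<open>ln u\<close> over the top and the bottom, and
  terms built from \<open>t p\<close> and \<open>t\<^sup>2 q\<close>. By Jensen's inequality \<open>ln u \<ge> \<alpha> * \<phi>\<^sub>t\<close>, so the bottom
  contribution stays bounded below as \<open>s\<close> tends to \<open>0\<close>.
  
  All boundary terms are small multiples of \<open>T\<close> as soon as \<open>\<omega>\<close> is close to the constant
  \<open>exp(\<alpha>\<^sub>I)\<close> on the intervals \<open>I\<close> of length at most \<open>2T\<close>. This closeness is measured by the predicate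
  \<open>controlled\<close>. It holds at every scale with one finite constant, by the \<open>A\<^sub>\<infinity>\<close> condition and
  \<open>\<alpha> \<in> BMO\<close>, which gives the Carleson property. It holds with an arbitrarily small constant at
  small scales, which gives the vanishing: \<open>VMO\<close> supplies small oscillation of \<open>\<alpha>\<close>, and a stopping
  time argument upgrades the \<open>A\<^sub>\<infinity>\<close> bound \<open>\<omega>\<^sub>I \<le> C exp(\<alpha>\<^sub>I)\<close> to \<open>\<omega>\<^sub>I \<le> (1 + \<epsilon>) exp(\<alpha>\<^sub>I)\<close>
  (\<open>exp_mean_le_of_small_oscillation\<close>). Because the Gaussian kernel has tails, the means over
  distant intervals enter too; they drift apart at most linearly in the distance
  (\<open>controlled_mean_drift\<close>), which the Gaussian absorbs.
\<close>


section \<open>Means over intervals\<close>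

lemma locally_integrable_integrable_on:
  assumes "locally_integrable h"
  shows "h integrable_on {a..b}"
  using assms unfolding locally_integrable_def absolutely_integrable_on_def by blast

lemma interval_mean_eq_integral:
  assumes "locally_integrable h"
  shows "interval_mean a b h = integral {a..b} h / (b - a)"
  using assms by (simp add: interval_mean_def locally_integrable_def set_lebesgue_integral_eq_integral)

lemma locally_integrable_const [simp]: "locally_integrable (\<lambda>x. c)"
  unfolding locally_integrable_def by (auto intro: absolutely_integrable_on_const)

lemma locally_integrable_diff:
  "locally_integrable g \<Longrightarrow> locally_integrable h \<Longrightarrow> locally_integrable (\<lambda>x. g x - h x)"
  unfolding locally_integrable_def by (intro allI set_integral_diff(1)) auto

lemma locally_integrable_add:
  "locally_integrable g \<Longrightarrow> locally_integrable h \<Longrightarrow> locally_integrable (\<lambda>x. g x + h x)"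
  unfolding locally_integrable_def by (intro allI set_integral_add(1)) auto

lemma locally_integrable_abs:
  "locally_integrable g \<Longrightarrow> locally_integrable (\<lambda>x. \<bar>g x\<bar> :: real)"
  unfolding locally_integrable_def by (intro allI set_integrable_abs) auto

lemma locally_integrable_cmult:
  "locally_integrable g \<Longrightarrow> locally_integrable (\<lambda>x. c * g x)"
  unfolding locally_integrable_def by (intro allI set_integrable_mult_right) auto

lemma locally_integrable_reflect:
  assumes "locally_integrable g"
  shows "locally_integrable (\<lambda>x. g (- x))"
proof -
  have "g absolutely_integrable_on {-b..-a}" for a b
    using assms by (auto simp: locally_integrable_def)
  then have "(\<lambda>x. g (- x)) absolutely_integrable_on {a..b}" for a b
    using absolutely_integrable_reflect_real[where f=g and a="-b" and b="-a"] by simp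
  then show ?thesis by (auto simp: locally_integrable_def)
qed

lemma interval_mean_mono:
  assumes "locally_integrable g" "locally_integrable h" "a < b" "\<And>x. g x \<le> h x"
  shows "interval_mean a b g \<le> interval_mean a b h"
  using assms by (simp add: interval_mean_eq_integral divide_right_mono integral_le locally_integrable_integrable_on)

lemma interval_mean_add:
  assumes "locally_integrable g" "locally_integrable h"
  shows "interval_mean a b (\<lambda>x. g x + h x) = interval_mean a b g + interval_mean a b h"
  using assms by (simp add: interval_mean_eq_integral Henstock_Kurzweil_Integration.integral_add
      locally_integrable_add locally_integrable_integrable_on add_divide_distrib)

lemma interval_mean_diff:
  assumes "locally_integrable g" "locally_integrable h"
  shows "interval_mean a b (\<lambda>x. g x - h x) = interval_mean a b g - interval_mean a b h"
  using assms by (simp add: interval_mean_eq_integral Henstock_Kurzweil_Integration.integral_diff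
      locally_integrable_diff locally_integrable_integrable_on diff_divide_distrib)

lemma interval_mean_cmult:
  "interval_mean a b (\<lambda>x. c * g x) = c * interval_mean a b g"
  by (simp add: interval_mean_def)

lemma interval_mean_const:
  assumes "a < b"
  shows "interval_mean a b (\<lambda>x. c) = c"
  using assms by (simp add: interval_mean_eq_integral)

lemma abs_interval_mean_diff_le:
  assumes "locally_integrable g" "a < b"
  shows "\<bar>interval_mean a b g - c\<bar> \<le> interval_mean a b (\<lambda>x. \<bar>g x - c\<bar>)"
proof -
  note li = locally_integrable_diff[OF assms(1) locally_integrable_const[of c]]
  have "interval_mean a b g - c = interval_mean a b (\<lambda>x. g x - c)"
    using assms by (simp add: interval_mean_diff interval_mean_const)
  moreover have "interval_mean a b (\<lambda>x. g x - c) \<le> interval_mean a b (\<lambda>x. \<bar>g x - c\<bar>)"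
    using assms li by (intro interval_mean_mono locally_integrable_abs) auto
  moreover have "interval_mean a b (\<lambda>x. - 1 * (g x - c)) \<le> interval_mean a b (\<lambda>x. \<bar>g x - c\<bar>)"
    using assms li by (intro interval_mean_mono locally_integrable_abs locally_integrable_cmult) auto
  ultimately show ?thesis unfolding interval_mean_cmult by linarith
qed

lemma interval_mean_subinterval:
  assumes "locally_integrable g" "\<And>x. 0 \<le> g x" "p \<le> a" "a < b" "b \<le> q"
  shows "interval_mean a b g \<le> (q - p) / (b - a) * interval_mean p q g"
proof -
  have "integral {a..b} g \<le> integral {p..q} g"
    using assms by (intro integral_subset_le locally_integrable_integrable_on) auto
  then show ?thesis using assms by (simp add: interval_mean_eq_integral divide_right_mono)
qed

lemma interval_mean_nonneg:
  assumes "\<And>x. 0 \<le> g x" "a < b"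
  shows "0 \<le> interval_mean a b g"
  using assms unfolding interval_mean_def set_lebesgue_integral_def by (simp add: integral_nonneg_AE)

section \<open>A stopping time argument for exponential means\<close>

text \<open>
  A form of the differentiation theorem for intervals that merely contain the point: the one-sided
  statement is applied to \<open>g\<close> and to its reflection, and the two halves are added.
\<close>

lemma Lebesgue_differentiation_intervals:
  assumes g: "locally_integrable g"
  shows "AE x in lebesgue. \<forall>e>0. \<exists>d>0. \<forall>p q. p \<le> x \<and> x \<le> q \<and> q - p < d \<longrightarrow>
           \<bar>integral {p..q} g - g x * (q - p)\<bar> \<le> e * (q - p)"
proof -
  have right: "\<exists>N. negligible N \<and> (\<forall>x e. x \<notin> N \<longrightarrow> 0 < e \<longrightarrow>
      (\<exists>d>0. \<forall>h\<ge>0. h < d \<longrightarrow> \<bar>integral {x..x+h} g - g x * h\<bar> \<le> e * h))" 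
    if g: "locally_integrable g" for g :: "real \<Rightarrow> real"
  proof -
    obtain N where N: "negligible N" "\<And>x e. \<lbrakk>x \<notin> N; 0 < e\<rbrakk> \<Longrightarrow>
               \<exists>d>0. \<forall>h. 0 < h \<and> h < d \<longrightarrow>
                         norm(integral (cbox x (x + h *\<^sub>R One)) g /\<^sub>R h ^ DIM(real) - g x) < e"
      using integrable_ccontinuous_explicit[of g] locally_integrable_integrable_on[OF g]
      by (metis cbox_interval)
    show ?thesis
    proof (intro exI[of _ N] conjI allI impI N(1))
      fix x e :: real assume "x \<notin> N" "0 < e"
      then obtain d where "d > 0" and d: "\<And>h. 0 < h \<Longrightarrow> h < d \<Longrightarrow> 
           \<bar>integral {x..x + h} g / h - g x\<bar> < e"
        using N(2)[of x e] by (auto simp: divide_inverse_commute)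
      have "\<bar>integral {x..x+h} g - g x * h\<bar> \<le> e * h" if "0 \<le> h" "h < d" for h
      proof (cases "h = 0")
        case False
        then have h: "0 < h" using that by simp
        then have "integral {x..x+h} g - g x * h = (integral {x..x + h} g / h - g x) * h"
          by (simp add: field_simps)
        then have "\<bar>integral {x..x+h} g - g x * h\<bar> = \<bar>integral {x..x + h} g / h - g x\<bar> * h"
          using h by (simp add: abs_mult)
        also have "\<dots> \<le> e * h" using d[OF h \<open>h < d\<close>] h by (intro mult_right_mono) auto
        finally show ?thesis .
      qed auto
      then show "\<exists>d>0. \<forall>h\<ge>0. h < d \<longrightarrow> \<bar>integral {x..x+h} g - g x * h\<bar> \<le> e * h"
        using \<open>d > 0\<close> by blast
    qed
  qed
  obtain N where N: "negligible N" "\<And>x e. x \<notin> N \<Longrightarrow> 0 < e \<Longrightarrow>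
      (\<exists>d>0. \<forall>h\<ge>0. h < d \<longrightarrow> \<bar>integral {x..x+h} g - g x * h\<bar> \<le> e * h)"
    using right[OF g] by blast
  obtain N' where N': "negligible N'" "\<And>x e. x \<notin> N' \<Longrightarrow> 0 < e \<Longrightarrow>
      (\<exists>d>0. \<forall>h\<ge>0. h < d \<longrightarrow> \<bar>integral {x..x+h} (\<lambda>x. g (- x)) - g (- x) * h\<bar> \<le> e * h)"
    using right[OF locally_integrable_reflect[OF g]] by blast
  have "negligible (N \<union> uminus ` N')"
    by (intro negligible_Un N negligible_differentiable_image_negligible N')
       (auto intro!: derivative_intros simp: differentiable_on_def)
  then have "AE x in lebesgue. x \<notin> N \<union> uminus ` N'"
    unfolding negligible_iff_null_sets by (rule AE_not_in)
  then show ?thesis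
  proof (rule AE_mp, intro AE_I2 impI allI)
    fix x e :: real assume x: "x \<notin> N \<union> uminus ` N'" and e: "0 < e"
    have xN: "x \<notin> N" "- x \<notin> N'" using x by (force)+
    obtain d1 where d1: "d1 > 0" "\<And>h. h\<ge>0 \<Longrightarrow> h < d1 \<Longrightarrow> \<bar>integral {x..x+h} g - g x * h\<bar> \<le> e * h"
      using N(2)[OF xN(1) e] by blast
    obtain d2 where d2: "d2 > 0" "\<And>h. h\<ge>0 \<Longrightarrow> h < d2 \<Longrightarrow> 
          \<bar>integral {-x..-x+h} (\<lambda>x. g (- x)) - g x * h\<bar> \<le> e * h"
      using N'(2)[OF xN(2) e] by auto
    have "\<bar>integral {p..q} g - g x * (q - p)\<bar> \<le> e * (q - p)" 
      if "p \<le> x" "x \<le> q" "q - p < min d1 d2" for p q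
    proof -
      have "integral {p..q} g = integral {p..x} g + integral {x..q} g"
        using Henstock_Kurzweil_Integration.integral_combine[of p x q g] that locally_integrable_integrable_on[OF g] by simp
      moreover have "integral {-x..-x+(x-p)} (\<lambda>x. g (- x)) = integral {p..x} g"
        using Henstock_Kurzweil_Integration.integral_reflect_real[of x p g] by simp
      ultimately show ?thesis using d1(2)[of "q - x"] d2(2)[of "x - p"] that
        by (simp add: algebra_simps abs_le_iff)
    qed
    then show "\<exists>d>0. \<forall>p q. p \<le> x \<and> x \<le> q \<and> q - p < d \<longrightarrow>
           \<bar>integral {p..q} g - g x * (q - p)\<bar> \<le> e * (q - p)"
      using d1(1) d2(1) by (intro exI[of _ "min d1 d2"]) auto
  qed
qed

text \<open>
  The interval \<open>[c,d]\<close> is bisected \<open>n\<close> times, and a subinterval is discarded as soon as the mean of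
  \<open>g\<close> over it exceeds \<open>lam\<close>; \<open>E\<close> is what survives. The parent of a discarded interval still has
  mean at most \<open>lam\<close>, so the discarded interval has mean at most \<open>2 lam\<close> and the a priori bound
  \<open>bad\<close> applies to it, while its length is at most the integral of \<open>g\<close> over it divided by \<open>lam\<close>.
\<close>

lemma stopping_time_sets:
  fixes g Om :: "real \<Rightarrow> real"
  assumes g: "locally_integrable g" and g0: "\<And>x. 0 \<le> g x"
    and Om: "locally_integrable Om" and Om0: "\<And>x. 0 \<le> Om x"
    and lam: "0 < lam" and "0 \<le> C"
    and bad: "\<And>c d. a \<le> c \<Longrightarrow> c < d \<Longrightarrow> d \<le> b \<Longrightarrow> integral {c..d} g \<le> 2 * lam * (d - c) \<Longrightarrow>
       (LINT x|lebesgue. indicator {c..d} x * Om x) \<le> C * (d - c)"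
  shows "\<lbrakk>a \<le> c; c < d; d \<le> b; integral {c..d} g \<le> lam * (d - c)\<rbrakk> \<Longrightarrow>
     \<exists>E\<in>sets lebesgue. E \<subseteq> {c..d} \<and>
       (\<forall>x\<in>E. \<exists>p q. p \<le> x \<and> x \<le> q \<and> p < q \<and> q - p = (d - c) / 2 ^ n \<and> integral {p..q} g \<le> lam * (q - p)) \<and>
       (LINT x|lebesgue. indicator ({c..d} - E) x * Om x) \<le> C / lam * integral {c..d} g"
proof (induction n arbitrary: c d)
  case 0
  show ?case
    using 0 assms by (intro bexI[of _ "{c..d}"]) (auto intro!: integral_nonneg locally_integrable_integrable_on mult_nonneg_nonneg divide_nonneg_pos)
next
  case (Suc n)
  define m where "m = (c + d) / 2"
  have m: "c < m" "m < d" and half: "m - c = (d - c) / 2" "d - m = (d - c) / 2"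
    using Suc.prems by (auto simp: m_def field_simps)
  have gi: "g integrable_on {p..q}" for p q by (rule locally_integrable_integrable_on[OF g])
  have Omi: "integrable lebesgue (\<lambda>x. indicator ({p..q} - E) x * Om x)" if "E \<in> sets lebesgue" for p q E
  proof -
    have "set_integrable lebesgue {p..q} Om" using Om by (auto simp: locally_integrable_def)
    then have "set_integrable lebesgue ({p..q} - E) Om"
      by (rule set_integrable_subset) (use that in auto)
    then show ?thesis by (simp add: set_integrable_def)
  qed
  have split: "integral {c..d} g = integral {c..m} g + integral {m..d} g"
    using Henstock_Kurzweil_Integration.integral_combine[of c m d g] m gi by simp
  have gpos: "0 \<le> integral {p..q} g" for p q
    using g0 by (intro integral_nonneg gi) auto
  have piece: "\<exists>E\<in>sets lebesgue. E \<subseteq> {p..q} \<and>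
       (\<forall>x\<in>E. \<exists>p q. p \<le> x \<and> x \<le> q \<and> p < q \<and> q - p = (d - c) / 2 ^ Suc n \<and> integral {p..q} g \<le> lam * (q - p)) \<and>
       (LINT x|lebesgue. indicator ({p..q} - E) x * Om x) \<le> C / lam * integral {p..q} g"
    if pq: "a \<le> p" "p < q" "q \<le> b" "integral {p..q} g \<le> integral {c..d} g" "q - p = (d - c) / 2" for p q
  proof (cases "integral {p..q} g \<le> lam * (q - p)")
    case True
    have "(q - p) / 2 ^ n = (d - c) / 2 ^ Suc n" unfolding pq(5) by simp
    with Suc.IH[OF pq(1-3) True] show ?thesis by simp
  next
    case False
    have "(LINT x|lebesgue. indicator {p..q} x * Om x) \<le> C * (q - p)"
    proof (rule bad[OF pq(1-3)])
      have "d - c = 2 * (q - p)" using pq(5) by simp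
      then have "lam * (d - c) = 2 * lam * (q - p)" by simp
      then show "integral {p..q} g \<le> 2 * lam * (q - p)"
        using order_trans[OF pq(4) Suc.prems(4)] by linarith
    qed
    also have "\<dots> \<le> C / lam * integral {p..q} g"
      using mult_left_mono[of "lam * (q - p)" "integral {p..q} g" "C / lam"] False lam \<open>0 \<le> C\<close>
      by simp
    finally show ?thesis by (intro bexI[of _ "{}"]) auto
  qed
  obtain E1 where E1: "E1 \<in> sets lebesgue" "E1 \<subseteq> {c..m}"
       "\<And>x. x \<in> E1 \<Longrightarrow> \<exists>p q. p \<le> x \<and> x \<le> q \<and> p < q \<and> q - p = (d - c) / 2 ^ Suc n \<and> integral {p..q} g \<le> lam * (q - p)"
       "(LINT x|lebesgue. indicator ({c..m} - E1) x * Om x) \<le> C / lam * integral {c..m} g"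
    using piece[of c m] m half Suc.prems split gpos[of m d] by auto
  obtain E2 where E2: "E2 \<in> sets lebesgue" "E2 \<subseteq> {m..d}"
       "\<And>x. x \<in> E2 \<Longrightarrow> \<exists>p q. p \<le> x \<and> x \<le> q \<and> p < q \<and> q - p = (d - c) / 2 ^ Suc n \<and> integral {p..q} g \<le> lam * (q - p)"
       "(LINT x|lebesgue. indicator ({m..d} - E2) x * Om x) \<le> C / lam * integral {m..d} g"
    using piece[of m d] m half Suc.prems split gpos[of c m] by auto
  have "(LINT x|lebesgue. indicator ({c..d} - (E1 \<union> E2)) x * Om x)
     \<le> (LINT x|lebesgue. indicator ({c..m} - E1) x * Om x + indicator ({m..d} - E2) x * Om x)"
    using E1(1,2) E2(1,2) m Om0
    by (intro integral_mono Bochner_Integration.integrable_add Omi) (auto simp: indicator_def)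
  also have "\<dots> = (LINT x|lebesgue. indicator ({c..m} - E1) x * Om x) + (LINT x|lebesgue. indicator ({m..d} - E2) x * Om x)"
    by (intro Bochner_Integration.integral_add Omi E1 E2)
  also have "\<dots> \<le> C / lam * integral {c..d} g"
    using E1(4) E2(4) unfolding split by (simp add: algebra_simps)
  finally have "(LINT x|lebesgue. indicator ({c..d} - (E1 \<union> E2)) x * Om x) \<le> C / lam * integral {c..d} g" .
  then show ?case
    using E1 E2 m by (intro bexI[of _ "E1 \<union> E2"] conjI) auto
qed

text \<open>
  A point that survives infinitely many bisections satisfies \<open>g x \<le> lam\<close> almost surely, by
  differentiation. There \<open>Om\<close> is at most \<open>K\<close>, so the part of \<open>Om\<close> above \<open>K\<close> disappears in the limit and
  only the discarded intervals and the trivial bound \<open>K (b - a)\<close> remain.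
\<close>

lemma stopping_time_bound:
  fixes g Om :: "real \<Rightarrow> real"
  assumes g: "locally_integrable g" and g0: "\<And>x. 0 \<le> g x"
    and Om: "locally_integrable Om" and Om0: "\<And>x. 0 \<le> Om x"
    and lam: "0 < lam" and C: "0 \<le> C"
    and bad: "\<And>c d. a \<le> c \<Longrightarrow> c < d \<Longrightarrow> d \<le> b \<Longrightarrow> integral {c..d} g \<le> 2 * lam * (d - c) \<Longrightarrow>
       (LINT x|lebesgue. indicator {c..d} x * Om x) \<le> C * (d - c)"
    and ab: "a < b" "integral {a..b} g \<le> lam * (b - a)"
    and K: "0 \<le> K" "AE x in lebesgue. g x \<le> lam \<longrightarrow> Om x \<le> K"
  shows "(LINT x|lebesgue. indicator {a..b} x * Om x) \<le> C / lam * integral {a..b} g + K * (b - a)"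
proof -
  have "\<forall>n. \<exists>E. E\<in>sets lebesgue \<and> E \<subseteq> {a..b} \<and>
       (\<forall>x\<in>E. \<exists>p q. p \<le> x \<and> x \<le> q \<and> p < q \<and> q - p = (b - a) / 2 ^ n \<and> integral {p..q} g \<le> lam * (q - p)) \<and>
       (LINT x|lebesgue. indicator ({a..b} - E) x * Om x) \<le> C / lam * integral {a..b} g"
    using stopping_time_sets[OF g g0 Om Om0 lam C bad order_refl ab(1) order_refl ab(2)]
    by blast
  then obtain E where E: "\<And>n. E n \<in> sets lebesgue" "\<And>n. E n \<subseteq> {a..b}"
       "\<And>n x. x \<in> E n \<Longrightarrow> \<exists>p q. p \<le> x \<and> x \<le> q \<and> p < q \<and> q - p = (b - a) / 2 ^ n \<and> integral {p..q} g \<le> lam * (q - p)"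
       "\<And>n. (LINT x|lebesgue. indicator ({a..b} - E n) x * Om x) \<le> C / lam * integral {a..b} g"
    by (subst (asm) choice_iff) blast
  have Omi: "integrable lebesgue (\<lambda>x. indicator A x * Om x)" if "A \<in> sets lebesgue" "A \<subseteq> {a..b}" for A
  proof -
    have "set_integrable lebesgue {a..b} Om" using Om by (auto simp: locally_integrable_def)
    then have "set_integrable lebesgue A Om"
      by (rule set_integrable_subset) (use that in auto)
    then show ?thesis by (simp add: set_integrable_def)
  qed
  \<comment> \<open>The excess over K on the surviving set; it is dominated by Om and tends to zero pointwise.\<close>
  define R where "R n = (LINT x|lebesgue. indicator (E n) x * max 0 (Om x - K))" for n
  have exc: "integrable lebesgue (\<lambda>x. indicator A x * max 0 (Om x - K))" if "A \<in> sets lebesgue" "A \<subseteq> {a..b}" for A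
  proof (rule Bochner_Integration.integrable_bound[OF Omi[OF that]])
    have "(\<lambda>x. max 0 (indicator A x * Om x - indicator A x * K)) \<in> borel_measurable lebesgue"
      using Omi[OF that] that by (intro borel_measurable_max borel_measurable_diff) auto
    then show "(\<lambda>x. indicator A x * max 0 (Om x - K)) \<in> borel_measurable lebesgue"
      by (rule measurable_cong[THEN iffD1, rotated]) (auto simp: indicator_def)
  qed (use Om0 K in \<open>auto simp: indicator_def max_def\<close>)
  have Kint: "integrable lebesgue (\<lambda>x. indicator {a..b} x * K)"
    by (intro integrable_mult_left integrable_real_indicator) (auto simp: emeasure_lborel_Icc_eq)
  have bound: "(LINT x|lebesgue. indicator {a..b} x * Om x) \<le> C / lam * integral {a..b} g + K * (b - a) + R n" for n
  proof -
    have "(LINT x|lebesgue. indicator {a..b} x * Om x) \<le>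
        (LINT x|lebesgue. indicator ({a..b} - E n) x * Om x + (indicator {a..b} x * K + indicator (E n) x * max 0 (Om x - K)))"
      using E(1,2)[of n] Om0 K(1)
      by (intro integral_mono Bochner_Integration.integrable_add Omi exc Kint) (auto simp: indicator_def)
    also have "\<dots> = (LINT x|lebesgue. indicator ({a..b} - E n) x * Om x) + (K * (b - a) + R n)"
      using E(1,2)[of n] ab(1) unfolding R_def
      by (subst Bochner_Integration.integral_add, (intro Omi exc Kint Bochner_Integration.integrable_add; force),
          (intro Omi exc Kint Bochner_Integration.integrable_add; force),
          subst Bochner_Integration.integral_add, (intro Kint; force), (intro exc; force)) simp
    finally show ?thesis using E(4)[of n] by simp
  qed
  have "R \<longlonglongrightarrow> (LINT x|(lebesgue :: real measure). 0 :: real)"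
    unfolding R_def
  proof (rule Bochner_Integration.integral_dominated_convergence[where w="\<lambda>x. indicator {a..b} x * Om x"])
    show "(\<lambda>x. indicator (E n) x * max 0 (Om x - K)) \<in> borel_measurable lebesgue" for n
      using exc[OF E(1,2)] by auto
    show "AE x in lebesgue. (\<lambda>n. indicator (E n) x * max 0 (Om x - K)) \<longlonglongrightarrow> 0"
      using K(2) Lebesgue_differentiation_intervals[OF g]
    proof eventually_elim
      case (elim x)
      show ?case
      proof (cases "g x \<le> lam")
        case True
        then show ?thesis using elim(1) by simp
      next
        case False
        define e where "e = (g x - lam) / 2"
        have e: "0 < e" using False by (simp add: e_def)
        obtain dd where dd: "0 < dd" "\<forall>p q. p \<le> x \<and> x \<le> q \<and> q - p < dd \<longrightarrow>
           \<bar>integral {p..q} g - g x * (q - p)\<bar> \<le> e * (q - p)"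
          using elim(2)[rule_format, OF e] by (elim exE conjE)
        have "(\<lambda>n. (b - a) / 2 ^ n) \<longlonglongrightarrow> 0"
          by (rule LIMSEQ_divide_realpow_zero) simp
        then have "\<forall>\<^sub>F n in sequentially. (b - a) / 2 ^ n < dd"
          using dd(1) by (rule order_tendstoD)
        then have "\<forall>\<^sub>F n in sequentially. x \<notin> E n"
        proof eventually_elim
          case (elim n)
          show ?case
          proof
            assume "x \<in> E n"
            then obtain p q where pq: "p \<le> x" "x \<le> q" "p < q" "q - p = (b - a) / 2 ^ n" "integral {p..q} g \<le> lam * (q - p)"
              using E(3) by blast
            have "\<bar>integral {p..q} g - g x * (q - p)\<bar> \<le> e * (q - p)"
              using dd(2)[rule_format, of p q] pq(1,2) elim unfolding pq(4)[symmetric] by simp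
            then have "(g x - lam - e) * (q - p) \<le> 0" using pq(5) by (simp add: algebra_simps abs_le_iff)
            moreover have "(g x - lam - e) * (q - p) > 0" 
              using pq(3) False by (intro mult_pos_pos) (auto simp: e_def field_simps)
            ultimately show False by simp
          qed
        qed
        then have "\<forall>\<^sub>F n in sequentially. indicator (E n) x * max 0 (Om x - K) = 0"
          by eventually_elim (auto simp: indicator_def)
        then show ?thesis by (rule tendsto_eventually)
      qed
    qed
    show "AE x in lebesgue. norm (indicator (E n) x * max 0 (Om x - K)) \<le> indicator {a..b} x * Om x" for n
      using E(2)[of n] Om0 K(1) by (intro AE_I2) (auto simp: indicator_def max_def)
  qed (use Omi[of "{a..b}"] in auto)
  then have "R \<longlonglongrightarrow> 0" by simp
  then have "(\<lambda>n. C / lam * integral {a..b} g + K * (b - a) + R n) \<longlonglongrightarrow> C / lam * integral {a..b} g + K * (b - a) + 0"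
    by (intro tendsto_intros)
  then show ?thesis
    using bound by (intro LIMSEQ_le_const) auto
qed

text \<open>
  With \<open>lam\<close> chosen about as small as the square root of the oscillation, the factor on the right is
  close to \<open>1\<close>. So an \<open>A\<^sub>\<infinity>\<close> bound with some finite \<open>C\<close> improves itself on every interval on which \<open>\<alpha>\<close>
  oscillates little. This replaces the John--Nirenberg inequality: the finite constant \<open>C\<close> is used once,
  on the stopping intervals, instead of an iteration.
\<close>

lemma exp_mean_le_of_small_oscillation:
  fixes \<alpha> :: "real \<Rightarrow> real"
  assumes la: "locally_integrable \<alpha>" and le: "locally_integrable (\<lambda>x. exp (\<alpha> x))"
    and C: "0 \<le> C" "\<And>a b. a < b \<Longrightarrow> interval_mean a b (\<lambda>x. exp (\<alpha> x)) \<le> C * exp (interval_mean a b \<alpha>)"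
    and ab: "a < b" and lam: "0 < lam" "mean_oscillation a b \<alpha> \<le> lam"
  shows "interval_mean a b (\<lambda>x. exp (\<alpha> x))
           \<le> (exp lam + C * exp (2 * lam) / lam * mean_oscillation a b \<alpha>) * exp (interval_mean a b \<alpha>)"
proof -
  define m where "m = interval_mean a b \<alpha>"
  define g where "g x = \<bar>\<alpha> x - m\<bar>" for x
  define Om where "Om x = exp (- m) * exp (\<alpha> x)" for x
  have lg: "locally_integrable g"
    unfolding g_def by (intro locally_integrable_abs locally_integrable_diff la locally_integrable_const)
  have lO: "locally_integrable Om"
    unfolding Om_def by (intro locally_integrable_cmult le)
  have LINT_Om: "(LINT x|lebesgue. indicator {c..d} x * Om x) = (d - c) * exp (- m) * interval_mean c d (\<lambda>x. exp (\<alpha> x))"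
    if "c < d" for c d
    using that interval_mean_cmult[of c d "exp (- m)" "\<lambda>x. exp (\<alpha> x)"]
    unfolding Om_def interval_mean_def set_lebesgue_integral_def by (simp add: mult_ac)
  have osc: "integral {a..b} g = (b - a) * mean_oscillation a b \<alpha>"
    using ab interval_mean_eq_integral[OF lg, of a b]
    by (simp add: mean_oscillation_def g_def [abs_def] m_def field_simps)
  have "(LINT x|lebesgue. indicator {a..b} x * Om x)
     \<le> (C * exp (2 * lam)) / lam * integral {a..b} g + exp lam * (b - a)"
  proof (rule stopping_time_bound[OF lg _ lO _ lam(1)])
    fix c d assume cd: "a \<le> c" "c < d" "d \<le> b" "integral {c..d} g \<le> 2 * lam * (d - c)"
    have "\<bar>interval_mean c d \<alpha> - m\<bar> \<le> interval_mean c d g"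
      unfolding g_def by (rule abs_interval_mean_diff_le[OF la cd(2)])
    also have "\<dots> \<le> 2 * lam"
      using cd by (simp add: interval_mean_eq_integral[OF lg] field_simps)
    finally have "exp (interval_mean c d \<alpha>) \<le> exp (m + 2 * lam)" by simp
    then have "interval_mean c d (\<lambda>x. exp (\<alpha> x)) \<le> C * exp (m + 2 * lam)"
      using C(2)[OF cd(2)] C(1) by (meson mult_left_mono order_trans)
    then have "(d - c) * exp (- m) * interval_mean c d (\<lambda>x. exp (\<alpha> x)) \<le> (d - c) * exp (- m) * (C * exp (m + 2 * lam))"
      using cd by (intro mult_left_mono) auto
    also have "\<dots> = C * exp (2 * lam) * (d - c)"
      by (simp add: exp_add exp_minus)
    finally show "(LINT x|lebesgue. indicator {c..d} x * Om x) \<le> C * exp (2 * lam) * (d - c)"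
      using LINT_Om[OF cd(2)] by simp
  next
    show "integral {a..b} g \<le> lam * (b - a)"
      using osc lam(2) ab by (simp add: mult.commute mult_left_mono)
    show "AE x in lebesgue. g x \<le> lam \<longrightarrow> Om x \<le> exp lam"
      by (intro AE_I2) (auto simp: g_def Om_def simp flip: exp_add)
  qed (use C ab in \<open>auto simp: g_def Om_def\<close>)
  then have "exp (- m) * interval_mean a b (\<lambda>x. exp (\<alpha> x)) \<le>
     C * exp (2 * lam) / lam * mean_oscillation a b \<alpha> + exp lam"
    unfolding LINT_Om[OF ab] osc
  proof -
    assume *: "(b - a) * exp (- m) * interval_mean a b (\<lambda>x. exp (\<alpha> x))
       \<le> C * exp (2 * lam) / lam * ((b - a) * mean_oscillation a b \<alpha>) + exp lam * (b - a)"
    have "(b - a) * (exp (- m) * interval_mean a b (\<lambda>x. exp (\<alpha> x))) \<le>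
        (b - a) * (C * exp (2 * lam) / lam * mean_oscillation a b \<alpha> + exp lam)"
      using * by (simp only: distrib_left mult_ac)
    then show ?thesis using ab by simp
  qed
  then have "exp m * (exp (- m) * interval_mean a b (\<lambda>x. exp (\<alpha> x))) \<le>
     exp m * (C * exp (2 * lam) / lam * mean_oscillation a b \<alpha> + exp lam)"
    by (intro mult_left_mono) auto
  then show ?thesis
    unfolding m_def[symmetric] mult.assoc[symmetric] exp_minus_inverse
    by (simp add: add.commute mult.commute)
qed

section \<open>Weights that are nearly constant at a given scale\<close>

text \<open>
  Intervals of length \<open>2T\<close> are included so that the means over two overlapping intervals of length
  \<open>T\<close> can be compared through a common interval that contains both.
\<close>

definition controlled :: "(real \<Rightarrow> real) \<Rightarrow> real \<Rightarrow> real \<Rightarrow> bool" where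
  "controlled \<alpha> \<epsilon> T \<longleftrightarrow> (\<forall>c. mean_oscillation c (c + T) \<alpha> \<le> \<epsilon> \<and> mean_oscillation c (c + 2 * T) \<alpha> \<le> \<epsilon> \<and>
     interval_mean c (c + T) (\<lambda>x. exp (\<alpha> x)) \<le> (1 + \<epsilon>) * exp (interval_mean c (c + T) \<alpha>))"

lemma controlled_nonneg:
  assumes "controlled \<alpha> \<epsilon> T" "0 < T"
  shows "0 \<le> \<epsilon>"
proof -
  have "0 \<le> mean_oscillation 0 (0 + T) \<alpha>"
    unfolding mean_oscillation_def by (rule interval_mean_nonneg) (use assms in auto)
  then show ?thesis using assms unfolding controlled_def by (meson order_trans)
qed

lemma controlled_globally:
  fixes \<alpha> :: "real \<Rightarrow> real"
  assumes bmo: "BMO \<alpha>"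
    and C: "\<And>a b. a < b \<Longrightarrow> interval_mean a b (\<lambda>x. exp (\<alpha> x)) \<le> C * exp (interval_mean a b \<alpha>)"
  obtains \<epsilon> where "1 \<le> \<epsilon>" "\<And>T. 0 < T \<Longrightarrow> controlled \<alpha> \<epsilon> T"
proof -
  obtain B where B: "\<And>a b. a < b \<Longrightarrow> mean_oscillation a b \<alpha> \<le> B"
    using bmo unfolding BMO_def bdd_above_def by blast
  define \<epsilon> where "\<epsilon> = max 1 (max B C)"
  have "controlled \<alpha> \<epsilon> T" if "0 < T" for T
    unfolding controlled_def
  proof (intro allI conjI)
    fix c
    show "mean_oscillation c (c + T) \<alpha> \<le> \<epsilon>" "mean_oscillation c (c + 2 * T) \<alpha> \<le> \<epsilon>"
      using B[of c "c + T"] B[of c "c + 2 * T"] that by (auto simp: \<epsilon>_def)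
    have "interval_mean c (c + T) (\<lambda>x. exp (\<alpha> x)) \<le> C * exp (interval_mean c (c + T) \<alpha>)"
      using that by (intro C) auto
    also have "\<dots> \<le> (1 + \<epsilon>) * exp (interval_mean c (c + T) \<alpha>)"
      by (intro mult_right_mono) (auto simp: \<epsilon>_def)
    finally show "interval_mean c (c + T) (\<lambda>x. exp (\<alpha> x)) \<le> (1 + \<epsilon>) * exp (interval_mean c (c + T) \<alpha>)" .
  qed
  then show ?thesis by (intro that[of \<epsilon>]) (auto simp: \<epsilon>_def)
qed

lemma controlled_at_small_scales:
  fixes \<alpha> :: "real \<Rightarrow> real"
  assumes vmo: "VMO \<alpha>" and le: "locally_integrable (\<lambda>x. exp (\<alpha> x))"
    and C: "\<And>a b. a < b \<Longrightarrow> interval_mean a b (\<lambda>x. exp (\<alpha> x)) \<le> C * exp (interval_mean a b \<alpha>)"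
    and \<epsilon>: "0 < \<epsilon>"
  obtains \<delta> where "0 < \<delta>" "\<And>T. 0 < T \<Longrightarrow> T < \<delta> \<Longrightarrow> controlled \<alpha> \<epsilon> T"
proof -
  have la: "locally_integrable \<alpha>" using vmo by (simp add: VMO_def BMO_def)
  define D where "D = max 0 C + 1"
  have D: "0 < D" "C \<le> D" by (auto simp: D_def)
  have D': "interval_mean a b (\<lambda>x. exp (\<alpha> x)) \<le> D * exp (interval_mean a b \<alpha>)" if "a < b" for a b
    using C[OF that] D by (meson exp_ge_zero mult_right_mono order_trans)
  \<comment> \<open>One half of \<open>\<epsilon>\<close> is spent on \<open>exp lam\<close>, the other half on the stopping intervals.\<close>
  define lam where "lam = ln (1 + \<epsilon> / 2)"
  have lam: "0 < lam" "exp lam = 1 + \<epsilon> / 2" using \<epsilon> by (auto simp: lam_def)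
  define \<eta> where "\<eta> = min \<epsilon> (min lam (\<epsilon> * lam / (2 * (D * exp (2 * lam)))))"
  have "0 < \<eta>" using \<epsilon> lam D by (auto simp: \<eta>_def)
  then obtain \<delta> where \<delta>: "0 < \<delta>" "\<And>a b. a < b \<Longrightarrow> b - a < \<delta> \<Longrightarrow> mean_oscillation a b \<alpha> < \<eta>"
    using vmo unfolding VMO_def by metis
  have "controlled \<alpha> \<epsilon> T" if T: "0 < T" "T < \<delta> / 2" for T
    unfolding controlled_def
  proof (intro allI conjI)
    fix c
    have o: "mean_oscillation c (c + T) \<alpha> < \<eta>" "mean_oscillation c (c + 2 * T) \<alpha> < \<eta>"
      using \<delta>(2)[of c "c + T"] \<delta>(2)[of c "c + 2 * T"] T by auto
    then show "mean_oscillation c (c + T) \<alpha> \<le> \<epsilon>" "mean_oscillation c (c + 2 * T) \<alpha> \<le> \<epsilon>"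
      by (auto simp: \<eta>_def)
    have "interval_mean c (c + T) (\<lambda>x. exp (\<alpha> x))
           \<le> (exp lam + D * exp (2 * lam) / lam * mean_oscillation c (c + T) \<alpha>) * exp (interval_mean c (c + T) \<alpha>)"
      using o T lam D by (intro exp_mean_le_of_small_oscillation[OF la le _ D']) (auto simp: \<eta>_def)
    also have "\<dots> \<le> (1 + \<epsilon>) * exp (interval_mean c (c + T) \<alpha>)"
    proof (intro mult_right_mono)
      have "D * exp (2 * lam) / lam * mean_oscillation c (c + T) \<alpha> 
         \<le> D * exp (2 * lam) / lam * (\<epsilon> * lam / (2 * (D * exp (2 * lam))))"
        using o(1) D lam by (intro mult_left_mono) (auto simp: \<eta>_def)
      also have "\<dots> = \<epsilon> / 2" using D lam(1) by simp
      finally show "exp lam + D * exp (2 * lam) / lam * mean_oscillation c (c + T) \<alpha> \<le> 1 + \<epsilon>"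
        using lam(2) by linarith
    qed simp
    finally show "interval_mean c (c + T) (\<lambda>x. exp (\<alpha> x)) \<le> (1 + \<epsilon>) * exp (interval_mean c (c + T) \<alpha>)" .
  qed
  then show ?thesis using \<delta>(1) by (intro that[of "\<delta> / 2"]) auto
qed

text \<open>
  One moves from \<open>c\<close> to \<open>d\<close> in \<open>n\<close> steps of length at most \<open>T\<close>. Two consecutive intervals lie in a common
  interval of length \<open>2T\<close>, and passing to a half of it at most doubles the mean deviation.
\<close>

lemma controlled_mean_drift_steps:
  assumes la: "locally_integrable \<alpha>" and ctr: "controlled \<alpha> \<epsilon> T" and T: "0 < T"
  shows "\<bar>c - d\<bar> \<le> real n * T \<Longrightarrow>
    \<bar>interval_mean c (c + T) \<alpha> - interval_mean d (d + T) \<alpha>\<bar> \<le> 4 * \<epsilon> * real n"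
proof (induction n arbitrary: c d)
  case (Suc n)
  define d' where "d' = (if c \<le> d then max c (d - T) else min c (d + T))"
  have d': "\<bar>c - d'\<bar> \<le> real n * T" "\<bar>d - d'\<bar> \<le> T"
    using Suc.prems T by (auto simp: d'_def algebra_simps max_def min_def)
  define p where "p = min d d'"
  have half: "\<bar>interval_mean s (s + T) \<alpha> - interval_mean p (p + 2 * T) \<alpha>\<bar> \<le> 2 * \<epsilon>"
    if s: "p \<le> s" "s \<le> p + T" for s
  proof -
    have "\<bar>interval_mean s (s + T) \<alpha> - interval_mean p (p + 2 * T) \<alpha>\<bar>
       \<le> interval_mean s (s + T) (\<lambda>x. \<bar>\<alpha> x - interval_mean p (p + 2 * T) \<alpha>\<bar>)"
      using T by (intro abs_interval_mean_diff_le la) auto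
    also have "\<dots> \<le> (p + 2 * T - p) / (s + T - s) * mean_oscillation p (p + 2 * T) \<alpha>"
      unfolding mean_oscillation_def using T s
      by (intro interval_mean_subinterval locally_integrable_abs locally_integrable_diff la locally_integrable_const) auto
    also have "\<dots> \<le> 2 * \<epsilon>"
      using ctr T by (simp add: controlled_def)
    finally show ?thesis .
  qed
  have "\<bar>interval_mean d' (d' + T) \<alpha> - interval_mean d (d + T) \<alpha>\<bar> \<le> 4 * \<epsilon>"
  proof -
    have "p \<le> d" "d \<le> p + T" "p \<le> d'" "d' \<le> p + T"
      using d'(2) T by (auto simp: p_def min_def abs_if split: if_splits)
    then show ?thesis using half[of d] half[of d'] by linarith
  qed
  then show ?case using Suc.IH[OF d'(1)] by (simp add: algebra_simps)
qed (use assms in auto)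

lemma controlled_mean_drift:
  assumes la: "locally_integrable \<alpha>" and ctr: "controlled \<alpha> \<epsilon> T" and T: "0 < T"
  shows "\<bar>interval_mean c (c + T) \<alpha> - interval_mean d (d + T) \<alpha>\<bar> \<le> 4 * \<epsilon> * (1 + \<bar>c - d\<bar> / T)"
proof -
  define n where "n = nat \<lceil>\<bar>c - d\<bar> / T\<rceil>"
  have n: "\<bar>c - d\<bar> / T \<le> real n" "real n \<le> 1 + \<bar>c - d\<bar> / T"
    using T by (auto simp: n_def) linarith+
  have "\<bar>interval_mean c (c + T) \<alpha> - interval_mean d (d + T) \<alpha>\<bar> \<le> 4 * \<epsilon> * real n"
    using n(1) T by (intro controlled_mean_drift_steps assms) (simp add: field_simps)
  also have "\<dots> \<le> 4 * \<epsilon> * (1 + \<bar>c - d\<bar> / T)"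
    using controlled_nonneg[OF ctr T] n(2) by (intro mult_left_mono) auto
  finally show ?thesis .
qed

lemma controlled_mean_abs_diff:
  assumes la: "locally_integrable \<alpha>" and ctr: "controlled \<alpha> \<epsilon> T" and T: "0 < T"
  shows "interval_mean c (c + T) (\<lambda>x. \<bar>\<alpha> x - interval_mean a (a + T) \<alpha>\<bar>) \<le> 5 * \<epsilon> * (1 + \<bar>c - a\<bar> / T)"
proof -
  let ?m = "\<lambda>c. interval_mean c (c + T) \<alpha>"
  note li = locally_integrable_abs locally_integrable_diff locally_integrable_add la locally_integrable_const
  have "interval_mean c (c + T) (\<lambda>x. \<bar>\<alpha> x - ?m a\<bar>) \<le> interval_mean c (c + T) (\<lambda>x. \<bar>\<alpha> x - ?m c\<bar> + \<bar>?m c - ?m a\<bar>)"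
    using T by (intro interval_mean_mono li) auto
  also have "\<dots> = mean_oscillation c (c + T) \<alpha> + \<bar>?m c - ?m a\<bar>"
    unfolding mean_oscillation_def using T
    by (subst interval_mean_add) (auto intro!: li interval_mean_const simp: interval_mean_const)
  also have "\<dots> \<le> \<epsilon> + 4 * \<epsilon> * (1 + \<bar>c - a\<bar> / T)"
    using ctr controlled_mean_drift[OF assms, of c a] by (intro add_mono) (auto simp: controlled_def)
  also have "\<dots> \<le> 5 * \<epsilon> * (1 + \<bar>c - a\<bar> / T)"
    using mult_nonneg_nonneg[OF controlled_nonneg[OF ctr T], of "\<bar>c - a\<bar> / T"] T
    by (simp only: distrib_left) simp
  finally show ?thesis .
qed

lemma abs_exp_minus_one_le: "\<bar>exp y - 1\<bar> \<le> exp y - 1 + 2 * \<bar>y :: real\<bar>"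
  using exp_ge_add_one_self[of y] by linarith

text \<open>
  On \<open>[c,c+T]\<close> itself, the lower bound \<open>exp y \<ge> 1 + y\<close> turns the upper bound for the mean of
  \<open>exp(\<alpha> - \<alpha>\<^sub>I)\<close> into an \<open>L\<^sup>1\<close> bound for \<open>exp(\<alpha> - \<alpha>\<^sub>I) - 1\<close>, of size \<open>3\<epsilon>\<close>; changing the reference mean to that of
  \<open>[a,a+T]\<close> costs the exponential of the drift.
\<close>

lemma controlled_mean_abs_exp_diff:
  assumes la: "locally_integrable \<alpha>" and le: "locally_integrable (\<lambda>x. exp (\<alpha> x))"
    and ctr: "controlled \<alpha> \<epsilon> T" and T: "0 < T"
  shows "interval_mean c (c + T) (\<lambda>x. \<bar>exp (\<alpha> x - interval_mean a (a + T) \<alpha>) - 1\<bar>)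
     \<le> exp (7 * \<epsilon> * (1 + \<bar>c - a\<bar> / T)) - 1"
proof -
  let ?m = "\<lambda>c. interval_mean c (c + T) \<alpha>"
  define D where "D = 1 + \<bar>c - a\<bar> / T"
  have D: "1 \<le> D" using T by (simp add: D_def)
  have e0: "0 \<le> \<epsilon>" by (rule controlled_nonneg[OF ctr T])
  have le': "locally_integrable (\<lambda>x. exp (\<alpha> x - k))" for k
    using locally_integrable_cmult[OF le, of "exp (- k)"] by (simp add: exp_diff exp_minus field_simps)
  note li = locally_integrable_abs locally_integrable_diff locally_integrable_add
    locally_integrable_cmult la le' locally_integrable_const
  have "interval_mean c (c + T) (\<lambda>x. exp (\<alpha> x - ?m c)) = exp (- ?m c) * interval_mean c (c + T) (\<lambda>x. exp (\<alpha> x))"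
    by (subst interval_mean_cmult[symmetric]) (simp add: exp_diff exp_minus field_simps)
  also have "\<dots> \<le> exp (- ?m c) * ((1 + \<epsilon>) * exp (?m c))"
    using ctr by (intro mult_left_mono) (auto simp: controlled_def)
  also have "\<dots> = 1 + \<epsilon>" by (simp add: exp_minus)
  finally have A: "interval_mean c (c + T) (\<lambda>x. exp (\<alpha> x - ?m c)) \<le> 1 + \<epsilon>" .
  have "interval_mean c (c + T) (\<lambda>x. \<bar>exp (\<alpha> x - ?m c) - 1\<bar>)
     \<le> interval_mean c (c + T) (\<lambda>x. (exp (\<alpha> x - ?m c) - 1) + 2 * \<bar>\<alpha> x - ?m c\<bar>)"
    using T by (intro interval_mean_mono li abs_exp_minus_one_le) auto
  also have "\<dots> = interval_mean c (c + T) (\<lambda>x. exp (\<alpha> x - ?m c)) - 1 + 2 * mean_oscillation c (c + T) \<alpha>"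
    unfolding mean_oscillation_def using T
    by (subst interval_mean_add, (intro li)+, subst interval_mean_diff, (intro li)+,
        simp add: interval_mean_const interval_mean_cmult)
  also have "\<dots> \<le> 3 * \<epsilon>"
    using A ctr unfolding controlled_def by (smt (verit))
  finally have B: "interval_mean c (c + T) (\<lambda>x. \<bar>exp (\<alpha> x - ?m c) - 1\<bar>) \<le> 3 * \<epsilon>" .
  define s where "s = ?m c - ?m a"
  have s: "\<bar>s\<bar> \<le> 4 * \<epsilon> * D"
    unfolding s_def D_def by (rule controlled_mean_drift[OF la ctr T])
  have e4: "\<bar>exp s - 1\<bar> \<le> exp (4 * \<epsilon> * D) - 1"
  proof (cases "0 \<le> s")
    case False
    have "2 \<le> exp s + exp (- s)"
      using exp_ge_add_one_self[of s] exp_ge_add_one_self[of "-s"] by linarith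
    moreover have "exp (- s) \<le> exp (4 * \<epsilon> * D)" using s by simp
    moreover have "exp s \<le> 1" using False by simp
    ultimately show ?thesis by linarith
  qed (use s in auto)
  have "interval_mean c (c + T) (\<lambda>x. \<bar>exp (\<alpha> x - ?m a) - 1\<bar>) 
     \<le> interval_mean c (c + T) (\<lambda>x. exp s * \<bar>exp (\<alpha> x - ?m c) - 1\<bar> + \<bar>exp s - 1\<bar>)"
  proof (intro interval_mean_mono li)
    fix x
    have "exp (\<alpha> x - ?m a) - 1 = exp s * (exp (\<alpha> x - ?m c) - 1) + (exp s - 1)"
      by (simp add: s_def algebra_simps flip: exp_add)
    also have "\<bar>\<dots>\<bar> \<le> exp s * \<bar>exp (\<alpha> x - ?m c) - 1\<bar> + \<bar>exp s - 1\<bar>"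
      by (rule order_trans[OF abs_triangle_ineq]) (simp add: abs_mult)
    finally show "\<bar>exp (\<alpha> x - ?m a) - 1\<bar> \<le> exp s * \<bar>exp (\<alpha> x - ?m c) - 1\<bar> + \<bar>exp s - 1\<bar>" .
  qed (use T in auto)
  also have "\<dots> = exp s * interval_mean c (c + T) (\<lambda>x. \<bar>exp (\<alpha> x - ?m c) - 1\<bar>) + \<bar>exp s - 1\<bar>"
    using T by (subst interval_mean_add, (intro li)+, simp add: interval_mean_const interval_mean_cmult)
  also have "\<dots> \<le> exp (4 * \<epsilon> * D) * (3 * \<epsilon>) + (exp (4 * \<epsilon> * D) - 1)"
    using B e4 s e0 T by (intro add_mono mult_mono) (auto intro!: interval_mean_nonneg)
  also have "\<dots> = exp (4 * \<epsilon> * D) * (1 + 3 * \<epsilon>) - 1" by (simp add: algebra_simps)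
  also have "\<dots> \<le> exp (4 * \<epsilon> * D) * exp (3 * \<epsilon> * D) - 1"
  proof -
    have "1 + 3 * \<epsilon> \<le> exp (3 * \<epsilon> * D)"
      using exp_ge_add_one_self[of "3 * \<epsilon> * D"] mult_left_mono[OF D, of "3 * \<epsilon>"] e0 by linarith
    then show ?thesis by simp
  qed
  also have "\<dots> = exp (7 * \<epsilon> * D) - 1" by (simp flip: exp_add add: algebra_simps)
  finally show ?thesis by (simp add: D_def)
qed

section \<open>Gaussian convolutions\<close>

text \<open>
  By the mean value theorem the difference quotients are bounded by \<open>B\<close>, and dominated convergence applies.
\<close>

lemma has_real_derivative_integral:
  fixes k k' :: "real \<Rightarrow> real \<Rightarrow> real"
  assumes S: "open S" "convex S" "x0 \<in> S"
    and deriv: "\<And>x y. x \<in> S \<Longrightarrow> ((\<lambda>x. k x y) has_real_derivative k' x y) (at x)"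
    and int: "\<And>x. x \<in> S \<Longrightarrow> integrable M (k x)"
    and meas: "k' x0 \<in> borel_measurable M"
    and bound: "\<And>x y. x \<in> S \<Longrightarrow> \<bar>k' x y\<bar> \<le> B y" and B: "integrable M B"
  shows "((\<lambda>x. \<integral>y. k x y \<partial>M) has_real_derivative (\<integral>y. k' x0 y \<partial>M)) (at x0)"
  unfolding has_field_derivative_iff tendsto_at_iff_sequentially
proof (intro allI impI)
  fix X :: "nat \<Rightarrow> real" assume X: "\<forall>i. X i \<in> UNIV - {x0}" "X \<longlonglongrightarrow> x0"
  have "\<forall>\<^sub>F i in sequentially. X i \<in> S"
    using X(2) S by (auto simp: tendsto_def)
  then obtain N where N: "\<And>i. N \<le> i \<Longrightarrow> X i \<in> S" by (auto simp: eventually_sequentially)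
  define Y where "Y i = X (i + N)" for i
  have Y: "Y i \<in> S" "Y i \<noteq> x0" for i using N X(1) by (auto simp: Y_def)
  have Ylim: "Y \<longlonglongrightarrow> x0" unfolding Y_def using X(2) by (rule LIMSEQ_ignore_initial_segment)
  have "(\<lambda>i. \<integral>y. (k (Y i) y - k x0 y) / (Y i - x0) \<partial>M) \<longlonglongrightarrow> (\<integral>y. k' x0 y \<partial>M)"
  proof (rule integral_dominated_convergence[where w=B])
    show "AE y in M. (\<lambda>i. (k (Y i) y - k x0 y) / (Y i - x0)) \<longlonglongrightarrow> k' x0 y"
    proof (intro AE_I2)
      fix y
      have "((\<lambda>x. (k x y - k x0 y) / (x - x0)) \<longlongrightarrow> k' x0 y) (at x0)"
        using deriv[OF S(3)] by (simp add: has_field_derivative_iff)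
      then show "(\<lambda>i. (k (Y i) y - k x0 y) / (Y i - x0)) \<longlonglongrightarrow> k' x0 y"
        using Ylim Y(2) unfolding tendsto_at_iff_sequentially by (auto simp: o_def)
    qed
    show "AE y in M. norm ((k (Y i) y - k x0 y) / (Y i - x0)) \<le> B y" for i
    proof (intro AE_I2)
      fix y
      have "norm (k (Y i) y - k x0 y) \<le> B y * norm (Y i - x0)"
        by (rule field_differentiable_bound[OF S(2) _ _ Y(1) S(3), where f'="\<lambda>x. k' x y"])
           (auto intro: has_field_derivative_at_within deriv bound)
      then show "norm ((k (Y i) y - k x0 y) / (Y i - x0)) \<le> B y"
        using Y(2)[of i] by (simp add: field_simps)
    qed
    show "(\<lambda>y. (k (Y i) y - k x0 y) / (Y i - x0)) \<in> borel_measurable M" for i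
      using int[OF Y(1)] int[OF S(3)] by (intro borel_measurable_divide borel_measurable_diff) auto
  qed (use meas B in auto)
  also have "(\<lambda>i. \<integral>y. (k (Y i) y - k x0 y) / (Y i - x0) \<partial>M) =
      (\<lambda>i. ((\<integral>y. k (Y i) y \<partial>M) - (\<integral>y. k x0 y \<partial>M)) / (Y i - x0))"
    using int Y(1) S(3) by (simp add: Bochner_Integration.integral_diff)
  finally have "(\<lambda>i. ((\<lambda>x. ((\<integral>y. k x y \<partial>M) - (\<integral>y. k x0 y \<partial>M)) / (x - x0)) \<circ> X) (i + N)) \<longlonglongrightarrow> (\<integral>y. k' x0 y \<partial>M)"
    by (simp add: Y_def o_def)
  then show "((\<lambda>x. ((\<integral>y. k x y \<partial>M) - (\<integral>y. k x0 y \<partial>M)) / (x - x0)) \<circ> X) \<longlonglongrightarrow> (\<integral>y. k' x0 y \<partial>M)"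
    by (rule LIMSEQ_offset)
qed

text \<open>
  Functions of exponential growth in the mean. Both the weight and its primitive belong to this
  class, and every Gaussian moment kernel can be integrated against it.
\<close>

definition exp_tame :: "(real \<Rightarrow> real) \<Rightarrow> bool" where
  "exp_tame g \<longleftrightarrow> g \<in> borel_measurable borel \<and> (\<exists>c\<ge>0. integrable lborel (\<lambda>y. exp (- c * \<bar>y\<bar>) * g y))"

text \<open>
  Differentiating a Gaussian moment kernel gives such kernels again, so all derivatives in \<open>x\<close> and
  \<open>t\<close> that are needed below are obtained from one pair of rules.
\<close>

definition gauss :: "nat \<Rightarrow> real \<Rightarrow> real" where
  "gauss n z = z ^ n * exp (- z\<^sup>2)"

lemma measurable_gauss [measurable]: "gauss n \<in> borel_measurable borel"
  unfolding gauss_def[abs_def] by measurable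

lemma DERIV_gauss [derivative_intros]:
  assumes "(f has_real_derivative f') (at x within S)"
  shows "((\<lambda>x. gauss n (f x)) has_real_derivative
     (real n * gauss (n - 1) (f x) - 2 * gauss (n + 1) (f x)) * f') (at x within S)"
proof -
  have "(gauss n has_real_derivative (real n * gauss (n - 1) y - 2 * gauss (n + 1) y)) (at y)" for y
    unfolding gauss_def[abs_def]
    by (auto intro!: derivative_eq_intros simp: algebra_simps)
  from DERIV_chain2[OF this assms] show ?thesis .
qed

lemma gauss_exp_bound: "\<exists>B>0. \<forall>z. \<bar>gauss n z\<bar> \<le> B * exp (- \<kappa> * \<bar>z\<bar>)"
proof -
  have "\<bar>gauss n z\<bar> \<le> (fact n * exp ((\<bar>\<kappa>\<bar> + 1)\<^sup>2)) * exp (- \<kappa> * \<bar>z\<bar>)" for z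
  proof -
    have "\<bar>z\<bar> ^ n / fact n \<le> (\<Sum>k\<le>n. \<bar>z\<bar> ^ k /\<^sub>R fact k)"
      by (rule order_trans[OF _ member_le_sum[of n]]) (auto simp: divide_inverse mult.commute)
    also have "\<dots> \<le> (\<Sum>k. \<bar>z\<bar> ^ k /\<^sub>R fact k)"
      by (intro sum_le_suminf summable_exp_generic) auto
    also have "\<dots> = exp \<bar>z\<bar>" by (simp add: exp_def)
    finally have "\<bar>z\<bar> ^ n \<le> fact n * exp \<bar>z\<bar>" by (simp add: field_simps)
    then have "\<bar>gauss n z\<bar> \<le> fact n * exp \<bar>z\<bar> * exp (- z\<^sup>2)"
      by (simp add: gauss_def abs_mult power_abs)
    also have "\<dots> = fact n * exp (\<bar>z\<bar> - z\<^sup>2)" by (simp add: exp_diff exp_minus field_simps)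
    also have "\<bar>z\<bar> - z\<^sup>2 \<le> (\<bar>\<kappa>\<bar> + 1)\<^sup>2 - \<kappa> * \<bar>z\<bar>"
    proof -
      have "0 \<le> (\<bar>z\<bar> - (\<bar>\<kappa>\<bar> + 1) / 2)\<^sup>2" by simp
      also have "\<dots> = z\<^sup>2 - (\<bar>\<kappa>\<bar> + 1) * \<bar>z\<bar> + (\<bar>\<kappa>\<bar> + 1)\<^sup>2 / 4"
        by (simp add: power2_diff power_divide algebra_simps)
      finally have "(\<bar>\<kappa>\<bar> + 1) * \<bar>z\<bar> - z\<^sup>2 \<le> (\<bar>\<kappa>\<bar> + 1)\<^sup>2"
        using zero_le_power2[of "\<bar>\<kappa>\<bar> + 1"] by linarith
      moreover have "\<kappa> * \<bar>z\<bar> \<le> \<bar>\<kappa>\<bar> * \<bar>z\<bar>" by (intro mult_right_mono) auto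
      ultimately show ?thesis by (simp add: algebra_simps)
    qed
    then have "fact n * exp (\<bar>z\<bar> - z\<^sup>2) \<le> fact n * exp ((\<bar>\<kappa>\<bar> + 1)\<^sup>2 - \<kappa> * \<bar>z\<bar>)" by simp
    finally show ?thesis by (simp add: exp_diff exp_minus field_simps)
  qed
  then show ?thesis by (intro exI[of _ "fact n * exp ((\<bar>\<kappa>\<bar> + 1)\<^sup>2)"]) auto
qed

lemma gauss_dilate_bound:
  assumes c: "0 \<le> c"
  shows "\<exists>B>0. \<forall>x t y. \<bar>x\<bar> \<le> R \<longrightarrow> 0 < t \<longrightarrow> t \<le> t1 \<longrightarrow> \<bar>gauss n ((x - y) / t)\<bar> \<le> B * exp (- c * \<bar>y\<bar>)"
proof -
  obtain B where B: "0 < B" "\<And>z. \<bar>gauss n z\<bar> \<le> B * exp (- (c * t1) * \<bar>z\<bar>)"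
    using gauss_exp_bound by blast
  have "\<bar>gauss n ((x - y) / t)\<bar> \<le> (B * exp (c * R)) * exp (- c * \<bar>y\<bar>)"
    if x: "\<bar>x\<bar> \<le> R" "0 < t" "t \<le> t1" for x t y
  proof -
    have "c * (\<bar>y\<bar> - R) \<le> c * \<bar>x - y\<bar>" using x c by (intro mult_left_mono) auto
    also have "\<dots> = c * t * \<bar>(x - y) / t\<bar>" using x by (simp add: abs_divide)
    also have "\<dots> \<le> c * t1 * \<bar>(x - y) / t\<bar>" using x c by (intro mult_right_mono mult_left_mono) auto
    finally have "exp (- (c * t1) * \<bar>(x - y) / t\<bar>) \<le> exp (c * R - c * \<bar>y\<bar>)" by (simp add: algebra_simps)
    then have "B * exp (- (c * t1) * \<bar>(x - y) / t\<bar>) \<le> B * exp (c * R - c * \<bar>y\<bar>)" using B(1) by simp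
    also have "B * exp (c * R - c * \<bar>y\<bar>) = (B * exp (c * R)) * exp (- c * \<bar>y\<bar>)"
      by (simp add: exp_diff exp_minus field_simps)
    finally show ?thesis using B(2)[of "(x - y) / t"] by linarith
  qed
  then show ?thesis using B(1) by (intro exI[of _ "B * exp (c * R)"]) auto
qed

definition gaussconv :: "(real \<Rightarrow> real) \<Rightarrow> nat \<Rightarrow> real \<Rightarrow> real \<Rightarrow> real" where
  "gaussconv g n x t = (\<integral>y. gauss n ((x - y) / t) * g y \<partial>lborel)"

text \<open>
  One dominating function for all \<open>x\<close> in a bounded set and all \<open>t\<close> in \<open>(0,t1]\<close>: this is the
  hypothesis for differentiation under the integral sign and for joint continuity.
\<close>

lemma gaussconv_dominated:
  assumes g: "exp_tame g" and "0 < t1"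
  obtains D where "integrable lborel D" 
    "\<And>x t y. \<bar>x\<bar> \<le> R \<Longrightarrow> 0 < t \<Longrightarrow> t \<le> t1 \<Longrightarrow> \<bar>gauss n ((x - y) / t) * g y\<bar> \<le> D y"
proof -
  obtain c where c: "0 \<le> c" "integrable lborel (\<lambda>y. exp (- c * \<bar>y\<bar>) * g y)"
    using g by (auto simp: exp_tame_def)
  obtain B where B: "B > 0" "\<And>x t y. \<bar>x\<bar> \<le> R \<Longrightarrow> 0 < t \<Longrightarrow> t \<le> t1 \<Longrightarrow> \<bar>gauss n ((x - y) / t)\<bar> \<le> B * exp (- c * \<bar>y\<bar>)"
    using gauss_dilate_bound[OF c(1), of R t1 n] by blast
  show ?thesis
  proof
    show "integrable lborel (\<lambda>y. B * \<bar>exp (- c * \<bar>y\<bar>) * g y\<bar>)"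
      using c(2) by (intro integrable_mult_right integrable_abs)
    fix x t y assume "\<bar>x\<bar> \<le> R" "0 < t" "t \<le> t1"
    from mult_right_mono[OF B(2)[OF this], of "\<bar>g y\<bar>"]
    show "\<bar>gauss n ((x - y) / t) * g y\<bar> \<le> B * \<bar>exp (- c * \<bar>y\<bar>) * g y\<bar>"
      by (simp add: abs_mult mult_ac)
  qed
qed

lemma integrable_gaussconv:
  assumes g: "exp_tame g" and "0 < t"
  shows "integrable lborel (\<lambda>y. gauss n ((x - y) / t) * g y)"
proof -
  have [measurable]: "g \<in> borel_measurable borel" using g by (simp add: exp_tame_def)
  obtain D where D: "integrable lborel D" "\<And>y. \<bar>gauss n ((x - y) / t) * g y\<bar> \<le> D y"
    using gaussconv_dominated[OF g \<open>0 < t\<close>, of "\<bar>x\<bar>" n] assms(2) by (metis order_refl)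
  then show ?thesis
    by (intro Bochner_Integration.integrable_bound[OF D(1)]) (auto intro!: AE_I2 order_trans[OF D(2)])
qed

lemma DERIV_gaussconv_x:
  assumes g: "exp_tame g" and t: "0 < t"
  shows "((\<lambda>x. gaussconv g n x t) has_real_derivative
     (real n * gaussconv g (n - 1) x t - 2 * gaussconv g (n + 1) x t) / t) (at x)"
proof -
  have [measurable]: "g \<in> borel_measurable borel" using g by (simp add: exp_tame_def)
  obtain D1 where D1: "integrable lborel D1" "\<And>x' y. \<bar>x'\<bar> \<le> \<bar>x\<bar> + 1 \<Longrightarrow> \<bar>gauss (n - 1) ((x' - y) / t) * g y\<bar> \<le> D1 y"
    using gaussconv_dominated[OF g t, of "\<bar>x\<bar> + 1" "n - 1"] t by (metis order_refl)
  obtain D2 where D2: "integrable lborel D2" "\<And>x' y. \<bar>x'\<bar> \<le> \<bar>x\<bar> + 1 \<Longrightarrow> \<bar>gauss (n + 1) ((x' - y) / t) * g y\<bar> \<le> D2 y"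
    using gaussconv_dominated[OF g t, of "\<bar>x\<bar> + 1" "n + 1"] t by (metis order_refl)
  define k' where "k' x y = (real n * (gauss (n - 1) ((x - y) / t) * g y) - 2 * (gauss (n + 1) ((x - y) / t) * g y)) / t" for x y
  have "((\<lambda>x. gaussconv g n x t) has_real_derivative (\<integral>y. k' x y \<partial>lborel)) (at x)"
    unfolding gaussconv_def
  proof (rule has_real_derivative_integral[where S="ball x 1" and B="\<lambda>y. (real n * D1 y + 2 * D2 y) / t"])
    fix x' y assume x': "x' \<in> ball x 1"
    show "((\<lambda>x. gauss n ((x - y) / t) * g y) has_real_derivative k' x' y) (at x')"
      unfolding k'_def using t by (auto intro!: derivative_eq_intros simp: field_simps)
    have a: "\<bar>x'\<bar> \<le> \<bar>x\<bar> + 1" using x' by (auto simp: dist_real_def)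
    have "\<bar>k' x' y\<bar> = \<bar>real n * (gauss (n - 1) ((x' - y) / t) * g y) - 2 * (gauss (n + 1) ((x' - y) / t) * g y)\<bar> / t"
      unfolding k'_def using t by (simp add: abs_divide)
    also have "\<dots> \<le> (real n * D1 y + 2 * D2 y) / t"
    proof (rule divide_right_mono)
      have "\<bar>real n * (gauss (n - 1) ((x' - y) / t) * g y)\<bar> \<le> real n * D1 y"
        "\<bar>2 * (gauss (n + 1) ((x' - y) / t) * g y)\<bar> \<le> 2 * D2 y"
        using D1(2)[OF a, of y] D2(2)[OF a, of y] by (simp_all only: abs_mult[of "real n"] abs_mult[of 2])
           (auto intro: mult_left_mono)
      then show "\<bar>real n * (gauss (n - 1) ((x' - y) / t) * g y) - 2 * (gauss (n + 1) ((x' - y) / t) * g y)\<bar> \<le> real n * D1 y + 2 * D2 y"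
        by linarith
    qed (use t in simp)
    finally show "\<bar>k' x' y\<bar> \<le> (real n * D1 y + 2 * D2 y) / t" .
  next
    show "k' x \<in> borel_measurable lborel" unfolding k'_def by measurable
    show "integrable lborel (\<lambda>y. (real n * D1 y + 2 * D2 y) / t)"
      using D1(1) D2(1) by auto
  qed (use integrable_gaussconv[OF g t] in auto)
  also have "(\<integral>y. k' x y \<partial>lborel) = (real n * gaussconv g (n - 1) x t - 2 * gaussconv g (n + 1) x t) / t"
    unfolding k'_def gaussconv_def using integrable_gaussconv[OF g t] by simp
  finally show ?thesis .
qed

lemma DERIV_gaussconv_t:
  assumes g: "exp_tame g" and t: "0 < t"
  shows "((\<lambda>t. gaussconv g n x t) has_real_derivative
     - (real n * gaussconv g n x t - 2 * gaussconv g (n + 2) x t) / t) (at t)"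
proof -
  have [measurable]: "g \<in> borel_measurable borel" using g by (simp add: exp_tame_def)
  have t2: "0 < 2 * t" using t by simp
  obtain D1 where D1: "integrable lborel D1" "\<And>t' y. 0 < t' \<Longrightarrow> t' \<le> 2 * t \<Longrightarrow> \<bar>gauss n ((x - y) / t') * g y\<bar> \<le> D1 y"
    using gaussconv_dominated[OF g t2, of "\<bar>x\<bar>" n] by (metis order_refl)
  obtain D2 where D2: "integrable lborel D2" "\<And>t' y. 0 < t' \<Longrightarrow> t' \<le> 2 * t \<Longrightarrow> \<bar>gauss (n + 2) ((x - y) / t') * g y\<bar> \<le> D2 y"
    using gaussconv_dominated[OF g t2, of "\<bar>x\<bar>" "n + 2"] by (metis order_refl)
  define k' where "k' t y = - (real n * (gauss n ((x - y) / t) * g y) - 2 * (gauss (n + 2) ((x - y) / t) * g y)) / t" for t y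
  have gm: "real n * gauss (n - 1) z * z = real n * gauss n z" "gauss (n + 1) z * z = gauss (n + 2) z" for z
    by (cases n; simp add: gauss_def)+
  have "((\<lambda>t. gaussconv g n x t) has_real_derivative (\<integral>y. k' t y \<partial>lborel)) (at t)"
    unfolding gaussconv_def
  proof (rule has_real_derivative_integral[where S="{t/2<..<2*t}" and B="\<lambda>y. (real n * D1 y + 2 * D2 y) / (t / 2)"])
    fix t' y assume t': "t' \<in> {t/2<..<2*t}"
    have t'0: "0 < t'" using t t' by auto
    have "((\<lambda>t. gauss n ((x - y) / t) * g y) has_real_derivative
       (real n * gauss (n - 1) ((x - y) / t') - 2 * gauss (n + 1) ((x - y) / t')) * (- ((x - y) / t') / t') * g y) (at t')"
      using t'0 by (auto intro!: derivative_eq_intros simp: field_simps)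
    also have "(real n * gauss (n - 1) ((x - y) / t') - 2 * gauss (n + 1) ((x - y) / t')) * (- ((x - y) / t') / t') * g y
        = - (real n * gauss (n - 1) ((x - y) / t') * ((x - y) / t') - 2 * (gauss (n + 1) ((x - y) / t') * ((x - y) / t'))) / t' * g y"
      using t'0 by (simp add: field_simps)
    also have "\<dots> = k' t' y"
      unfolding gm k'_def using t'0 by (simp add: field_simps)
    finally show "((\<lambda>t. gauss n ((x - y) / t) * g y) has_real_derivative k' t' y) (at t')" .
    have a: "t' \<le> 2 * t" using t' by auto
    have "\<bar>k' t' y\<bar> = \<bar>real n * (gauss n ((x - y) / t') * g y) - 2 * (gauss (n + 2) ((x - y) / t') * g y)\<bar> / t'"
      unfolding k'_def using t'0 by (simp add: abs_divide)
    also have "\<dots> \<le> (real n * D1 y + 2 * D2 y) / (t / 2)"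
    proof (rule frac_le)
      have "\<bar>real n * (gauss n ((x - y) / t') * g y)\<bar> \<le> real n * D1 y"
        "\<bar>2 * (gauss (n + 2) ((x - y) / t') * g y)\<bar> \<le> 2 * D2 y"
        using D1(2)[OF t'0 a, of y] D2(2)[OF t'0 a, of y] by (simp_all only: abs_mult[of "real n"] abs_mult[of 2])
           (auto intro: mult_left_mono)
      then show "\<bar>real n * (gauss n ((x - y) / t') * g y) - 2 * (gauss (n + 2) ((x - y) / t') * g y)\<bar> \<le> real n * D1 y + 2 * D2 y"
        by linarith
      then show "0 \<le> real n * D1 y + 2 * D2 y" by linarith
    qed (use t t' in simp_all)
    finally show "\<bar>k' t' y\<bar> \<le> (real n * D1 y + 2 * D2 y) / (t / 2)" .
    show "integrable lborel (\<lambda>y. gauss n ((x - y) / t') * g y)"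
      by (rule integrable_gaussconv[OF g t'0])
  next
    show "k' t \<in> borel_measurable lborel" unfolding k'_def by measurable
    show "integrable lborel (\<lambda>y. (real n * D1 y + 2 * D2 y) / (t / 2))"
      using D1(1) D2(1) by auto
  qed (use t in auto)
  also have "(\<integral>y. k' t y \<partial>lborel) = - (real n * gaussconv g n x t - 2 * gaussconv g (n + 2) x t) / t"
    unfolding k'_def gaussconv_def using integrable_gaussconv[OF g t] by simp
  finally show ?thesis .
qed

lemma continuous_on_gaussconv:
  assumes g: "exp_tame g"
  shows "continuous_on {(x, t). 0 < t} (\<lambda>(x, t). gaussconv g n x t)"
proof (rule continuous_on_sequentiallyI)
  have [measurable]: "g \<in> borel_measurable borel" using g by (simp add: exp_tame_def)
  fix u :: "nat \<Rightarrow> real \<times> real" and a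
  assume u: "\<forall>i. u i \<in> {(x, t). 0 < t}" "a \<in> {(x, t). 0 < t}" "u \<longlonglongrightarrow> a"
  define x t where "x i = fst (u i)" and "t i = snd (u i)" for i
  obtain x0 t0 where a: "a = (x0, t0)" by (cases a)
  have tpos: "0 < t i" for i using u(1)[rule_format, of i] by (auto simp: t_def split: prod.splits)
  have t0: "0 < t0" using u(2) a by simp
  have lim: "x \<longlonglongrightarrow> x0" "t \<longlonglongrightarrow> t0"
    using tendsto_fst[OF u(3)] tendsto_snd[OF u(3)] by (auto simp: a x_def[abs_def] t_def[abs_def])
  obtain R where R: "\<And>i. \<bar>x i\<bar> \<le> R" 
    using convergent_imp_Bseq[OF convergentI[OF lim(1)]] by (auto simp: Bseq_def)
  obtain T where T: "0 < T" "\<And>i. \<bar>t i\<bar> \<le> T" 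
    using convergent_imp_Bseq[OF convergentI[OF lim(2)]] by (auto simp: Bseq_def)
  have T': "t i \<le> T" for i using T(2)[of i] by linarith
  obtain D where D: "integrable lborel D" 
    "\<And>x t y. \<bar>x\<bar> \<le> R \<Longrightarrow> 0 < t \<Longrightarrow> t \<le> T \<Longrightarrow> \<bar>gauss n ((x - y) / t) * g y\<bar> \<le> D y"
    using gaussconv_dominated[OF g T(1)] by blast
  have "(\<lambda>i. gaussconv g n (x i) (t i)) \<longlonglongrightarrow> gaussconv g n x0 t0"
    unfolding gaussconv_def
  proof (rule integral_dominated_convergence[where w=D])
    show "AE y in lborel. (\<lambda>i. gauss n ((x i - y) / t i) * g y) \<longlonglongrightarrow> gauss n ((x0 - y) / t0) * g y"
      unfolding gauss_def using t0 by (intro AE_I2 tendsto_intros lim) auto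
    show "AE y in lborel. norm (gauss n ((x i - y) / t i) * g y) \<le> D y" for i
      using D(2)[OF R tpos T', of i] by (intro AE_I2) auto
  qed (use D in auto)
  then show "(\<lambda>i. (\<lambda>(x, t). gaussconv g n x t) (u i)) \<longlonglongrightarrow> (\<lambda>(x, t). gaussconv g n x t) a"
    by (simp add: a x_def t_def split_beta)
qed

section \<open>The caloric extension\<close>

text \<open>
  \<open>heat g x t\<close> is \<open>(g * \<phi>\<^sub>t)(x)\<close>, and the three functions after it are its first three derivatives in
  \<open>x\<close>, written through the moments
  (\<open>\<phi>\<close> has second derivative \<open>(4x\<^sup>2 - 2)\<phi>\<close> and third derivative \<open>(12x - 8x\<^sup>3)\<phi>\<close>).
\<close>

definition heat :: "(real \<Rightarrow> real) \<Rightarrow> real \<Rightarrow> real \<Rightarrow> real" where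
  "heat g x t = gaussconv g 0 x t / (t * sqrt pi)"

definition heat_x :: "(real \<Rightarrow> real) \<Rightarrow> real \<Rightarrow> real \<Rightarrow> real" where
  "heat_x g x t = - 2 * gaussconv g 1 x t / (t\<^sup>2 * sqrt pi)"

definition heat_xx :: "(real \<Rightarrow> real) \<Rightarrow> real \<Rightarrow> real \<Rightarrow> real" where
  "heat_xx g x t = (4 * gaussconv g 2 x t - 2 * gaussconv g 0 x t) / (t ^ 3 * sqrt pi)"

definition heat_xxx :: "(real \<Rightarrow> real) \<Rightarrow> real \<Rightarrow> real \<Rightarrow> real" where
  "heat_xxx g x t = (12 * gaussconv g 1 x t - 8 * gaussconv g 3 x t) / (t ^ 4 * sqrt pi)"

context
  fixes g :: "real \<Rightarrow> real" and x t :: real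
  assumes g: "exp_tame g" and t: "0 < t"
begin

private lemma gaussconv_DERIVs:
  "((\<lambda>x. gaussconv g 0 x t) has_real_derivative - 2 * gaussconv g 1 x t / t) (at x)"
  "((\<lambda>x. gaussconv g 1 x t) has_real_derivative (gaussconv g 0 x t - 2 * gaussconv g 2 x t) / t) (at x)"
  "((\<lambda>x. gaussconv g (Suc 0) x t) has_real_derivative (gaussconv g 0 x t - 2 * gaussconv g 2 x t) / t) (at x)"
  "((\<lambda>x. gaussconv g 2 x t) has_real_derivative (2 * gaussconv g 1 x t - 2 * gaussconv g 3 x t) / t) (at x)"
  "((\<lambda>t. gaussconv g 0 x t) has_real_derivative 2 * gaussconv g 2 x t / t) (at t)"
  "((\<lambda>t. gaussconv g 1 x t) has_real_derivative - (gaussconv g 1 x t - 2 * gaussconv g 3 x t) / t) (at t)"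
  "((\<lambda>t. gaussconv g (Suc 0) x t) has_real_derivative - (gaussconv g 1 x t - 2 * gaussconv g 3 x t) / t) (at t)"
  using DERIV_gaussconv_x[OF g t, of 0 x] DERIV_gaussconv_x[OF g t, of 1 x] DERIV_gaussconv_x[OF g t, of 2 x]
    DERIV_gaussconv_t[OF g t, of 0 x] DERIV_gaussconv_t[OF g t, of 1 x]
  by (simp_all add: numeral_2_eq_2 numeral_3_eq_3)

lemma DERIV_heat_x: "((\<lambda>x. heat g x t) has_real_derivative heat_x g x t) (at x)"
proof -
  define q where "q = sqrt pi"
  have q: "q > 0" by (simp add: q_def)
  show ?thesis
    unfolding heat_def[abs_def] heat_x_def q_def[symmetric] using t q
    by (auto intro!: derivative_eq_intros gaussconv_DERIVs
        simp: field_simps power2_eq_square power3_eq_cube power4_eq_xxxx)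
qed

lemma DERIV_heat_xx: "((\<lambda>x. heat_x g x t) has_real_derivative heat_xx g x t) (at x)"
proof -
  define q where "q = sqrt pi"
  have q: "q > 0" by (simp add: q_def)
  show ?thesis
    unfolding heat_x_def[abs_def] heat_xx_def q_def[symmetric] using t q
    by (auto intro!: derivative_eq_intros gaussconv_DERIVs
        simp: field_simps power2_eq_square power3_eq_cube power4_eq_xxxx)
qed

lemma DERIV_heat_xxx: "((\<lambda>x. heat_xx g x t) has_real_derivative heat_xxx g x t) (at x)"
proof -
  define q where "q = sqrt pi"
  have q: "q > 0" by (simp add: q_def)
  show ?thesis
    unfolding heat_xx_def[abs_def] heat_xxx_def q_def[symmetric] using t q
    by (auto intro!: derivative_eq_intros gaussconv_DERIVs
        simp: field_simps power2_eq_square power3_eq_cube power4_eq_xxxx)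
qed

lemma DERIV_heat_t: "((\<lambda>t. heat g x t) has_real_derivative t / 2 * heat_xx g x t) (at t)"
proof -
  define q where "q = sqrt pi"
  have q: "q > 0" by (simp add: q_def)
  show ?thesis
    unfolding heat_def[abs_def] heat_xx_def q_def[symmetric] using t q
    by (auto intro!: derivative_eq_intros gaussconv_DERIVs
        simp: field_simps power2_eq_square power3_eq_cube power4_eq_xxxx)
qed

lemma DERIV_heat_x_t: "((\<lambda>t. heat_x g x t) has_real_derivative t / 2 * heat_xxx g x t) (at t)"
proof -
  define q where "q = sqrt pi"
  have q: "q > 0" by (simp add: q_def)
  show ?thesis
    unfolding heat_x_def[abs_def] heat_xxx_def q_def[symmetric] using t q
    by (auto intro!: derivative_eq_intros gaussconv_DERIVs
        simp: field_simps power2_eq_square power3_eq_cube power4_eq_xxxx)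
qed

end

lemma continuous_on_gaussconv' [continuous_intros]:
  assumes "exp_tame g" "continuous_on S p" "continuous_on S q" "\<And>z. z \<in> S \<Longrightarrow> 0 < q z"
  shows "continuous_on S (\<lambda>z. gaussconv g n (p z) (q z))"
proof -
  have "continuous_on S (\<lambda>z. (\<lambda>(x, t). gaussconv g n x t) (p z, q z))"
    using assms by (intro continuous_on_compose2[OF continuous_on_gaussconv[OF assms(1), of n]] continuous_intros) auto
  then show ?thesis by simp
qed

lemma continuous_on_heat [continuous_intros]:
  assumes "exp_tame g" "continuous_on S p" "continuous_on S q" "\<And>z. z \<in> S \<Longrightarrow> 0 < q z"
  shows "continuous_on S (\<lambda>z. heat g (p z) (q z))"
    and "continuous_on S (\<lambda>z. heat_x g (p z) (q z))"
    and "continuous_on S (\<lambda>z. heat_xx g (p z) (q z))"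
    and "continuous_on S (\<lambda>z. heat_xxx g (p z) (q z))"
  unfolding heat_def heat_x_def heat_xx_def heat_xxx_def
  by (intro continuous_intros assms; use assms(4) in force)+

lemma integrable_exp_neg_abs: "integrable lborel (\<lambda>y::real. exp (- \<bar>y\<bar>))"
proof (rule Bochner_Integration.integrable_bound)
  show "integrable lborel (\<lambda>y::real. 2 * inverse (1 + y\<^sup>2))"
    using integrable_inverse_1_plus_square by (simp add: set_integrable_def)
  have "exp (- \<bar>y\<bar>) \<le> 2 * inverse (1 + y\<^sup>2)" for y :: real
  proof -
    have "1 + y\<^sup>2 \<le> 2 * exp \<bar>y\<bar>"
      using exp_lower_Taylor_quadratic[of "\<bar>y\<bar>"] by (simp add: field_simps)
    then have "(1 + y\<^sup>2) * exp (- \<bar>y\<bar>) \<le> 2 * exp \<bar>y\<bar> * exp (- \<bar>y\<bar>)" by (intro mult_right_mono) auto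
    also have "2 * exp \<bar>y\<bar> * exp (- \<bar>y\<bar>) = 2" by (simp add: exp_minus)
    finally have "(1 + y\<^sup>2) * exp (- \<bar>y\<bar>) \<le> 2" .
    moreover have "0 < 1 + y\<^sup>2" by (simp add: add_pos_nonneg)
    ultimately show ?thesis by (simp add: field_simps)
  qed
  then show "AE y in lborel. norm (exp (- \<bar>y\<bar>)) \<le> norm (2 * inverse (1 + y\<^sup>2) :: real)"
    by (intro AE_I2) (simp add: abs_of_nonneg)
qed auto

lemma exp_tame_const: "exp_tame (\<lambda>y. c)"
  unfolding exp_tame_def
  by (auto intro!: exI[of _ 1] integrable_mult_left integrable_exp_neg_abs)

text \<open>
  The first claim is the Gaussian integral; the other two follow by differentiating it, which saves the
  evaluation of higher moments.
\<close>

lemma heat_const: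
  assumes "0 < t"
  shows "heat (\<lambda>y. c) x t = c" "heat_x (\<lambda>y. c) x t = 0" "heat_xx (\<lambda>y. c) x t = 0"
proof -
  have "has_bochner_integral lborel (\<lambda>x::real. exp (- x\<^sup>2)) (sqrt pi)"
    using has_bochner_integral_even_function[OF gaussian_moment_0] by simp
  then have I: "(LBINT z::real. exp (- z\<^sup>2)) = sqrt pi" by (rule has_bochner_integral_integral_eq)
  have h: "heat (\<lambda>y. c) x t = c" for x
  proof -
    have "(\<integral>y. gauss 0 ((x - y) / t) * c \<partial>lborel) = \<bar>t\<bar> *\<^sub>R (\<integral>z. gauss 0 ((x - (x + t * z)) / t) * c \<partial>lborel)"
      using assms by (subst lborel_integral_real_affine[where c=t and t=x]) auto
    also have "\<dots> = t * sqrt pi * c"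
      using assms I by (simp add: gauss_def)
    finally show ?thesis using assms unfolding heat_def gaussconv_def by (simp only:) simp
  qed
  then show "heat (\<lambda>y. c) x t = c" .
  have hx: "heat_x (\<lambda>y. c) x t = 0" for x
    using DERIV_heat_x[OF exp_tame_const[of c] assms, of x] unfolding h
    using DERIV_const DERIV_unique by blast
  then show "heat_x (\<lambda>y. c) x t = 0" .
  show "heat_xx (\<lambda>y. c) x t = 0"
    using DERIV_heat_xx[OF exp_tame_const[of c] assms, of x] unfolding hx
    using DERIV_const DERIV_unique by blast
qed

lemma exp_tame_uniform:
  assumes "exp_tame g" "exp_tame h"
  obtains c where "0 \<le> c" "integrable lborel (\<lambda>y. exp (- c * \<bar>y\<bar>) * g y)" "integrable lborel (\<lambda>y. exp (- c * \<bar>y\<bar>) * h y)"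
proof -
  have [measurable]: "g \<in> borel_measurable borel" "h \<in> borel_measurable borel" using assms by (auto simp: exp_tame_def)
  have up: "integrable lborel (\<lambda>y. exp (- c' * \<bar>y\<bar>) * k y)"
    if "c \<le> c'" "integrable lborel (\<lambda>y. exp (- c * \<bar>y\<bar>) * k y)" "k \<in> borel_measurable borel" for c c' and k :: "real \<Rightarrow> real"
    using that by (intro Bochner_Integration.integrable_bound[OF that(2)])
      (auto intro!: AE_I2 mult_right_mono simp: abs_mult)
  obtain c1 c2 where "0 \<le> c1" "integrable lborel (\<lambda>y. exp (- c1 * \<bar>y\<bar>) * g y)" 
    "0 \<le> c2" "integrable lborel (\<lambda>y. exp (- c2 * \<bar>y\<bar>) * h y)"
    using assms by (auto simp: exp_tame_def)
  then show ?thesis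
    using up[of c1 "max c1 c2" g] up[of c2 "max c1 c2" h] by (intro that[of "max c1 c2"]) auto
qed

lemma exp_tame_lincomb:
  assumes "exp_tame g" "exp_tame h"
  shows "exp_tame (\<lambda>y. a * g y + b * h y)"
proof -
  have [measurable]: "g \<in> borel_measurable borel" "h \<in> borel_measurable borel" using assms by (auto simp: exp_tame_def)
  obtain c where c: "0 \<le> c" "integrable lborel (\<lambda>y. exp (- c * \<bar>y\<bar>) * g y)" "integrable lborel (\<lambda>y. exp (- c * \<bar>y\<bar>) * h y)"
    using exp_tame_uniform[OF assms] .
  have "integrable lborel (\<lambda>y. a * (exp (- c * \<bar>y\<bar>) * g y) + b * (exp (- c * \<bar>y\<bar>) * h y))"
    using c by auto
  then show ?thesis unfolding exp_tame_def using c(1)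
    by (intro conjI exI[of _ c]) (auto simp: algebra_simps)
qed

lemma gaussconv_lincomb:
  assumes "exp_tame g" "exp_tame h" "0 < t"
  shows "gaussconv (\<lambda>y. a * g y + b * h y) n x t = a * gaussconv g n x t + b * gaussconv h n x t"
proof -
  have "gaussconv (\<lambda>y. a * g y + b * h y) n x t = 
      (\<integral>y. a * (gauss n ((x - y) / t) * g y) + b * (gauss n ((x - y) / t) * h y) \<partial>lborel)"
    unfolding gaussconv_def by (simp add: algebra_simps)
  also have "\<dots> = a * gaussconv g n x t + b * gaussconv h n x t"
    unfolding gaussconv_def using assms integrable_gaussconv by simp
  finally show ?thesis .
qed

lemma heat_lincomb:
  assumes "exp_tame g" "exp_tame h" "0 < t"
  shows "heat (\<lambda>y. a * g y + b * h y) x t = a * heat g x t + b * heat h x t"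
    "heat_x (\<lambda>y. a * g y + b * h y) x t = a * heat_x g x t + b * heat_x h x t"
    "heat_xx (\<lambda>y. a * g y + b * h y) x t = a * heat_xx g x t + b * heat_xx h x t"
  unfolding heat_def heat_x_def heat_xx_def gaussconv_lincomb[OF assms]
  by (simp_all add: algebra_simps add_divide_distrib diff_divide_distrib)

text \<open>
  On \<open>[-r,r]\<close> the primitive is at most \<open>exp(c r)\<close> times the exponentially weighted mass of \<open>\<omega>\<close>.
\<close>

lemma exp_tame_primitive:
  fixes \<omega> f :: "real \<Rightarrow> real"
  assumes w: "exp_tame \<omega>" "\<And>y. 0 \<le> \<omega> y"
    and f: "\<And>a b. a \<le> b \<Longrightarrow> f b - f a = (\<integral>y. indicator {a..b} y * \<omega> y \<partial>lborel)" "f 0 = 0"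
  shows "exp_tame f" 
proof -
  obtain c where c: "0 \<le> c" "integrable lborel (\<lambda>y. exp (- c * \<bar>y\<bar>) * \<omega> y)"
    using w by (auto simp: exp_tame_def)
  define K where "K = (\<integral>y. exp (- c * \<bar>y\<bar>) * \<omega> y \<partial>lborel)"
  have [measurable]: "\<omega> \<in> borel_measurable borel" using w by (simp add: exp_tame_def)
  have "mono f"
  proof (rule monoI)
    fix a b :: real assume "a \<le> b"
    then have "f b - f a = (\<integral>y. indicator {a..b} y * \<omega> y \<partial>lborel)" by (rule f(1))
    also have "0 \<le> \<dots>" using w(2) by (intro integral_nonneg_AE) auto
    finally show "f a \<le> f b" by simp
  qed
  then have [measurable]: "f \<in> borel_measurable borel" by (rule borel_measurable_mono)
  have piece: "\<bar>f b - f a\<bar> \<le> exp (c * r) * K" if ab: "a \<le> b" "-r \<le> a" "b \<le> r" for a b r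
  proof -
    have "f b - f a = (\<integral>y. indicator {a..b} y * \<omega> y \<partial>lborel)" by (rule f(1)[OF ab(1)])
    also have "\<dots> \<le> (\<integral>y. exp (c * r) * (exp (- c * \<bar>y\<bar>) * \<omega> y) \<partial>lborel)"
    proof (rule integral_mono_AE')
      show "AE y in lborel. indicator {a..b} y * \<omega> y \<le> exp (c * r) * (exp (- c * \<bar>y\<bar>) * \<omega> y)"
      proof (intro AE_I2)
        fix y
        have "c * \<bar>y\<bar> \<le> c * r" if "y \<in> {a..b}" using that ab c by (intro mult_left_mono) auto
        then have "1 * \<omega> y \<le> exp (c * r - c * \<bar>y\<bar>) * \<omega> y" if "y \<in> {a..b}"
          using that w(2) by (intro mult_right_mono) auto
        then show "indicator {a..b} y * \<omega> y \<le> exp (c * r) * (exp (- c * \<bar>y\<bar>) * \<omega> y)"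
          using w(2)[of y] by (auto simp: indicator_def exp_diff exp_minus field_simps)
      qed
    qed (use c w in auto)
    also have "\<dots> = exp (c * r) * K" using c by (simp add: K_def)
    finally show ?thesis using f(1)[OF ab(1)] w(2) by (simp add: integral_nonneg_AE abs_of_nonneg)
  qed
  have fb: "\<bar>f y\<bar> \<le> exp (c * \<bar>y\<bar>) * K" for y
    using piece[of 0 y "\<bar>y\<bar>"] piece[of y 0 "\<bar>y\<bar>"] f(2) by (cases "0 \<le> y") auto
  have "integrable lborel (\<lambda>y. exp (- (c + 1) * \<bar>y\<bar>) * f y)"
  proof (rule Bochner_Integration.integrable_bound)
    show "integrable lborel (\<lambda>y. K * exp (- \<bar>y\<bar>))"
      using integrable_exp_neg_abs by auto
    show "AE y in lborel. norm (exp (- (c + 1) * \<bar>y\<bar>) * f y) \<le> norm (K * exp (- \<bar>y\<bar>))"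
    proof (intro AE_I2)
      fix y
      have "norm (exp (- (c + 1) * \<bar>y\<bar>) * f y) = exp (- (c + 1) * \<bar>y\<bar>) * \<bar>f y\<bar>" by (simp add: abs_mult)
      also have "\<dots> \<le> exp (- (c + 1) * \<bar>y\<bar>) * (exp (c * \<bar>y\<bar>) * K)" by (intro mult_left_mono fb) auto
      also have "\<dots> = K * (exp (- (c + 1) * \<bar>y\<bar>) * exp (c * \<bar>y\<bar>))" by simp
      also have "\<dots> = K * exp (- \<bar>y\<bar>)" unfolding exp_add[symmetric] by (simp add: algebra_simps)
      finally show "norm (exp (- (c + 1) * \<bar>y\<bar>) * f y) \<le> norm (K * exp (- \<bar>y\<bar>))" by simp
    qed
  qed measurable
  then show ?thesis unfolding exp_tame_def using c(1)
    by (intro conjI exI[of _ "c + 1"]) auto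
qed

text \<open>
  Tonelli's theorem replaces an integration by parts, for which \<open>f\<close> is not differentiable
  enough: the increment of \<open>f * \<phi>\<^sub>t\<close> from \<open>a\<close> to \<open>b\<close> is an average of increments of \<open>f\<close>, that is, of
  integrals of \<open>\<omega>\<close> over translates of \<open>[a,b]\<close>.
\<close>

lemma heat_increment_primitive:
  fixes \<omega> f :: "real \<Rightarrow> real"
  assumes w: "exp_tame \<omega>" "\<And>y. 0 \<le> \<omega> y"
    and f: "\<And>a b. a \<le> b \<Longrightarrow> f b - f a = (\<integral>y. indicator {a..b} y * \<omega> y \<partial>lborel)" "f 0 = 0"
    and li: "\<And>a b. integrable lborel (\<lambda>y. indicator {a..b} y * \<omega> y)"
    and t: "0 < t" and ab: "a \<le> b"
  shows "heat f b t - heat f a t = integral {a..b} (\<lambda>x. heat \<omega> x t)"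
proof -
  have tf: "exp_tame f" by (rule exp_tame_primitive[OF w f])
  have [measurable]: "\<omega> \<in> borel_measurable borel" "f \<in> borel_measurable borel" 
    using w tf by (auto simp: exp_tame_def)
  have aff: "gaussconv f 0 x t = (\<integral>s. gauss 0 (s / t) * f (x - s) \<partial>lborel)"
    "integrable lborel (\<lambda>s. gauss 0 (s / t) * f (x - s))" for x
    using lborel_integral_real_affine[of "-1" "\<lambda>y. gauss 0 ((x - y) / t) * f y" x]
      lborel_integrable_real_affine[OF integrable_gaussconv[OF tf t, of 0 x], of "-1" x]
    by (simp_all add: gaussconv_def)
  have g0: "0 \<le> gauss 0 z" for z by (simp add: gauss_def)
  have cont: "continuous_on {a..b} (\<lambda>x. gaussconv \<omega> 0 x t)"
    using w t by (intro continuous_intros) auto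
  have diff: "gaussconv f 0 b t - gaussconv f 0 a t = (\<integral>s. gauss 0 (s / t) * (f (b - s) - f (a - s)) \<partial>lborel)"
    unfolding aff(1) using Bochner_Integration.integral_diff[OF aff(2)[of b] aff(2)[of a]] by (simp add: right_diff_distrib)
  have "integrable lborel (\<lambda>s. gauss 0 (s / t) * (f (b - s) - f (a - s)))"
    using Bochner_Integration.integrable_diff[OF aff(2)[of b] aff(2)[of a]] by (simp add: algebra_simps)
  moreover have fnn: "0 \<le> f (b - s) - f (a - s)" for s
    using f(1)[of "a - s" "b - s"] w(2) ab by (simp add: integral_nonneg_AE)
  ultimately have "ennreal (gaussconv f 0 b t - gaussconv f 0 a t) = (\<integral>\<^sup>+s. ennreal (gauss 0 (s / t) * (f (b - s) - f (a - s))) \<partial>lborel)"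
    using g0 by (simp add: nn_integral_eq_integral diff)
  also have "\<dots> = (\<integral>\<^sup>+s. ennreal (gauss 0 (s / t)) * (\<integral>\<^sup>+y. indicator {a..b} (s + y) * ennreal (\<omega> y) \<partial>lborel) \<partial>lborel)"
  proof (intro nn_integral_cong)
    fix s
    have "ennreal (f (b - s) - f (a - s)) = (\<integral>\<^sup>+y. ennreal (indicator {a - s..b - s} y * \<omega> y) \<partial>lborel)"
      using f(1)[of "a - s" "b - s"] ab w(2) li by (simp add: nn_integral_eq_integral)
    also have "\<dots> = (\<integral>\<^sup>+y. indicator {a..b} (s + y) * ennreal (\<omega> y) \<partial>lborel)"
      by (intro nn_integral_cong) (auto simp: indicator_def)
    finally show "ennreal (gauss 0 (s / t) * (f (b - s) - f (a - s)))
        = ennreal (gauss 0 (s / t)) * (\<integral>\<^sup>+y. indicator {a..b} (s + y) * ennreal (\<omega> y) \<partial>lborel)"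
      using g0 fnn by (simp add: ennreal_mult)
  qed
  also have "\<dots> = (\<integral>\<^sup>+s. \<integral>\<^sup>+y. ennreal (gauss 0 (s / t)) * (indicator {a..b} (s + y) * ennreal (\<omega> y)) \<partial>lborel \<partial>lborel)"
    by (intro nn_integral_cong nn_integral_cmult[symmetric]) measurable
  also have "\<dots> = (\<integral>\<^sup>+y. \<integral>\<^sup>+s. ennreal (gauss 0 (s / t)) * (indicator {a..b} (s + y) * ennreal (\<omega> y)) \<partial>lborel \<partial>lborel)"
    by (rule lborel_pair.Fubini') measurable
  also have "\<dots> = (\<integral>\<^sup>+y. \<integral>\<^sup>+x. ennreal (gauss 0 ((x - y) / t)) * (indicator {a..b} x * ennreal (\<omega> y)) \<partial>lborel \<partial>lborel)"
  proof (rule nn_integral_cong)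
    fix y
    have "(\<integral>\<^sup>+s. ennreal (gauss 0 (s / t)) * (indicator {a..b} (s + y) * ennreal (\<omega> y)) \<partial>lborel)
       = ennreal \<bar>1\<bar> * (\<integral>\<^sup>+x. ennreal (gauss 0 ((- y + 1 * x) / t)) * (indicator {a..b} ((- y + 1 * x) + y) * ennreal (\<omega> y)) \<partial>lborel)"
      by (subst nn_integral_real_affine[where c=1 and t="-y"]) auto
    then show "(\<integral>\<^sup>+s. ennreal (gauss 0 (s / t)) * (indicator {a..b} (s + y) * ennreal (\<omega> y)) \<partial>lborel)
       = (\<integral>\<^sup>+x. ennreal (gauss 0 ((x - y) / t)) * (indicator {a..b} x * ennreal (\<omega> y)) \<partial>lborel)"
      by simp
  qed
  also have "\<dots> = (\<integral>\<^sup>+x. \<integral>\<^sup>+y. ennreal (gauss 0 ((x - y) / t)) * (indicator {a..b} x * ennreal (\<omega> y)) \<partial>lborel \<partial>lborel)"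
    by (rule lborel_pair.Fubini'[symmetric]) measurable
  also have "\<dots> = (\<integral>\<^sup>+x. ennreal (indicator {a..b} x * gaussconv \<omega> 0 x t) \<partial>lborel)"
  proof (intro nn_integral_cong)
    fix x
    have "(\<integral>\<^sup>+y. ennreal (gauss 0 ((x - y) / t)) * (indicator {a..b} x * ennreal (\<omega> y)) \<partial>lborel)
      = (\<integral>\<^sup>+y. ennreal (indicator {a..b} x * (gauss 0 ((x - y) / t) * \<omega> y)) \<partial>lborel)"
      using g0 w(2) by (intro nn_integral_cong) (auto simp: indicator_def ennreal_mult)
    also have "\<dots> = ennreal (\<integral>y. indicator {a..b} x * (gauss 0 ((x - y) / t) * \<omega> y) \<partial>lborel)"
      using g0 w(2) integrable_gaussconv[OF w(1) t] by (intro nn_integral_eq_integral) auto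
    finally show "(\<integral>\<^sup>+y. ennreal (gauss 0 ((x - y) / t)) * (indicator {a..b} x * ennreal (\<omega> y)) \<partial>lborel)
       = ennreal (indicator {a..b} x * gaussconv \<omega> 0 x t)"
      by (simp add: gaussconv_def)
  qed
  also have "\<dots> = ennreal (integral {a..b} (\<lambda>x. gaussconv \<omega> 0 x t))"
  proof -
    have "set_integrable lborel {a..b} (\<lambda>x. gaussconv \<omega> 0 x t)"
      using borel_integrable_atLeastAtMost'[OF cont] .
    moreover have "0 \<le> gaussconv \<omega> 0 x t" for x
      unfolding gaussconv_def using g0 w(2) by (intro integral_nonneg_AE) auto
    ultimately show ?thesis
      using set_borel_integral_eq_integral(2)[of "{a..b}" "\<lambda>x. gaussconv \<omega> 0 x t"]
      by (subst nn_integral_eq_integral) (auto simp: set_integrable_def set_lebesgue_integral_def)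
  qed
  finally have eq: "ennreal (gaussconv f 0 b t - gaussconv f 0 a t) = ennreal (integral {a..b} (\<lambda>x. gaussconv \<omega> 0 x t))" .
  have "0 \<le> gaussconv f 0 b t - gaussconv f 0 a t"
    unfolding diff using g0 fnn by (intro integral_nonneg_AE) auto
  moreover have "0 \<le> integral {a..b} (\<lambda>x. gaussconv \<omega> 0 x t)"
  proof (intro Henstock_Kurzweil_Integration.integral_nonneg integrable_continuous_real cont)
    fix x show "0 \<le> gaussconv \<omega> 0 x t"
      using g0 w(2) unfolding gaussconv_def by (intro integral_nonneg_AE) auto
  qed
  ultimately have "gaussconv f 0 b t - gaussconv f 0 a t = integral {a..b} (\<lambda>x. gaussconv \<omega> 0 x t)"
    using eq by simp
  then show ?thesis
    using t by (simp add: heat_def flip: diff_divide_distrib)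
qed

lemma heat_x_primitive:
  fixes \<omega> f :: "real \<Rightarrow> real"
  assumes w: "exp_tame \<omega>" "\<And>y. 0 \<le> \<omega> y"
    and f: "\<And>a b. a \<le> b \<Longrightarrow> f b - f a = (\<integral>y. indicator {a..b} y * \<omega> y \<partial>lborel)" "f 0 = 0"
    and li: "\<And>a b. integrable lborel (\<lambda>y. indicator {a..b} y * \<omega> y)"
    and t: "0 < t"
  shows "heat_x f x t = heat \<omega> x t"
proof -
  have tf: "exp_tame f" by (rule exp_tame_primitive[OF w f])
  have cont: "continuous_on {x - 1..x + 1} (\<lambda>x. heat \<omega> x t)"
    using w t by (intro continuous_intros) auto
  have "((\<lambda>y. integral {x - 1..y} (\<lambda>x. heat \<omega> x t)) has_real_derivative heat \<omega> x t) (at x within {x - 1..x + 1})"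
    by (rule integral_has_real_derivative[OF cont]) auto
  then have "((\<lambda>y. integral {x - 1..y} (\<lambda>x. heat \<omega> x t)) has_real_derivative heat \<omega> x t) (at x)"
    by (simp add: at_within_Icc_at)
  moreover have "((\<lambda>y. heat f y t - heat f (x - 1) t) has_real_derivative heat_x f x t) (at x)"
    using DERIV_heat_x[OF tf t, of x] by (auto intro!: derivative_eq_intros)
  moreover have "((\<lambda>y. heat f y t - heat f (x - 1) t) has_real_derivative d) (at x)
     \<longleftrightarrow> ((\<lambda>y. integral {x - 1..y} (\<lambda>x. heat \<omega> x t)) has_real_derivative d) (at x)" for d
  proof (rule has_field_derivative_cong_ev)
    show "\<forall>\<^sub>F y in nhds x. y \<in> UNIV \<longrightarrow> heat f y t - heat f (x - 1) t = integral {x - 1..y} (\<lambda>x. heat \<omega> x t)"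
    proof (rule eventually_nhds_in_open[THEN eventually_mono])
      show "open {x - 1<..}" "x \<in> {x - 1<..}" by auto
      fix y assume "y \<in> {x - 1<..}"
      then show "y \<in> UNIV \<longrightarrow> heat f y t - heat f (x - 1) t = integral {x - 1..y} (\<lambda>x. heat \<omega> x t)"
        using heat_increment_primitive[OF w f li t, of "x - 1" y] by auto
    qed
  qed (use heat_increment_primitive[OF w f li t, of "x - 1" x] in auto)
  ultimately show ?thesis using DERIV_unique by blast
qed

section \<open>The caloric extension of a controlled weight\<close>

lemma nn_integral_Icc_eq_interval_mean:
  assumes h: "h \<in> borel_measurable borel" "locally_integrable h" "\<And>x. 0 \<le> h x" and T: "0 < T"
  shows "(\<integral>\<^sup>+y. indicator {c..c + T} y * ennreal (h y) \<partial>lborel) = ennreal (T * interval_mean c (c + T) h)"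
proof -
  have [measurable]: "h \<in> borel_measurable borel" by (rule h)
  have "integrable lebesgue (\<lambda>y. indicator {c..c + T} y * h y)"
    using h(2) by (auto simp: locally_integrable_def set_integrable_def)
  then have i: "integrable lborel (\<lambda>y. indicator {c..c + T} y * h y)"
    by (subst (asm) integrable_completion) auto
  have "(\<integral>\<^sup>+y. indicator {c..c + T} y * ennreal (h y) \<partial>lborel) = (\<integral>\<^sup>+y. ennreal (indicator {c..c + T} y * h y) \<partial>lborel)"
    by (intro nn_integral_cong) (auto simp: indicator_def)
  also have "\<dots> = ennreal (\<integral>y. indicator {c..c + T} y * h y \<partial>lborel)"
    using i h(3) by (intro nn_integral_eq_integral) auto
  also have "(\<integral>y. indicator {c..c + T} y * h y \<partial>lborel) = T * interval_mean c (c + T) h"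
    unfolding interval_mean_def set_lebesgue_integral_def using T
    by (subst integral_completion) auto
  finally show ?thesis .
qed

definition exp_abs_mass :: real where
  "exp_abs_mass = (LBINT s::real. exp (- \<bar>s\<bar>))"

lemma nn_integral_exp_neg_abs: "(\<integral>\<^sup>+s. ennreal (exp (- \<bar>s\<bar>)) \<partial>lborel) = ennreal exp_abs_mass"
  unfolding exp_abs_mass_def by (intro nn_integral_eq_integral integrable_exp_neg_abs) auto

lemma exp_abs_mass_nonneg: "0 \<le> exp_abs_mass"
  unfolding exp_abs_mass_def by (intro integral_nonneg_AE) auto

text \<open>
  Passage from interval means to integrals against a decaying kernel. The kernel at \<open>y\<close> is at most
  \<open>exp(lam + 1)\<close> times the kernel centred at \<open>a\<close> and evaluated at any \<open>c\<close> with \<open>y \<in> [c,c+T]\<close>. Averaging over these \<open>c\<close>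
  and exchanging the integrals leaves the means of \<open>h\<close>. They may grow like \<open>exp(lam |c-a|/T)\<close>, and
  the kernel decays faster by one unit in the exponent.
\<close>

lemma nn_integral_exp_weight_le:
  fixes h :: "real \<Rightarrow> real"
  assumes h [measurable]: "h \<in> borel_measurable borel" and T: "0 < T" and x: "a \<le> x" "x \<le> a + T" 
    and lam: "0 \<le> lam" and e: "0 \<le> \<epsilon>"
    and means: "\<And>c. (\<integral>\<^sup>+y. indicator {c..c + T} y * ennreal (h y) \<partial>lborel) \<le> ennreal (T * (\<epsilon> * exp (lam * (1 + \<bar>c - a\<bar> / T))))"
  shows "(\<integral>\<^sup>+y. ennreal (exp (- (lam + 1) * \<bar>(x - y) / T\<bar>)) * ennreal (h y) \<partial>lborel) \<le> ennreal (T * \<epsilon> * (exp (2 * lam + 1) * exp_abs_mass))"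
proof -
  let ?k = "\<lambda>y. ennreal (exp (- (lam + 1) * \<bar>(x - y) / T\<bar>))"
  let ?l = "\<lambda>c. ennreal (exp (lam + 1 - (lam + 1) * \<bar>c - a\<bar> / T))"
  have kl: "?k y \<le> ?l c" if "c \<le> y" "y \<le> c + T" for c y
  proof -
    have "\<bar>c - a\<bar> \<le> \<bar>x - y\<bar> + T" using that x by linarith
    then have "\<bar>c - a\<bar> / T \<le> (\<bar>x - y\<bar> + T) / T" using T by (intro divide_right_mono) auto
    also have "\<dots> = \<bar>(x - y) / T\<bar> + 1" using T by (simp add: add_divide_distrib abs_divide)
    finally have "(lam + 1) * (\<bar>c - a\<bar> / T) \<le> (lam + 1) * (\<bar>(x - y) / T\<bar> + 1)"
      using lam by (intro mult_left_mono) auto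
    then have "- (lam + 1) * \<bar>(x - y) / T\<bar> \<le> lam + 1 - (lam + 1) * \<bar>c - a\<bar> / T"
      unfolding times_divide_eq_right distrib_left mult_minus_left mult_1_right by linarith
    then show ?thesis by (intro ennreal_leI) simp
  qed
  have "ennreal T * (\<integral>\<^sup>+y. ?k y * ennreal (h y) \<partial>lborel) = (\<integral>\<^sup>+y. ennreal T * (?k y * ennreal (h y)) \<partial>lborel)"
    by (intro nn_integral_cmult[symmetric]) measurable
  also have "\<dots> = (\<integral>\<^sup>+y. \<integral>\<^sup>+c. indicator {c..c + T} y * (?k y * ennreal (h y)) \<partial>lborel \<partial>lborel)"
  proof (rule nn_integral_cong)
    fix y
    have "(\<integral>\<^sup>+c. indicator {c..c + T} y * (?k y * ennreal (h y)) \<partial>lborel)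
       = (\<integral>\<^sup>+c. indicator {y - T..y} c * (?k y * ennreal (h y)) \<partial>lborel)"
      by (intro nn_integral_cong) (auto simp: indicator_def)
    also have "\<dots> = ennreal T * (?k y * ennreal (h y))"
      using T by (subst nn_integral_multc) (auto simp: emeasure_lborel_Icc_eq)
    finally show "ennreal T * (?k y * ennreal (h y)) = (\<integral>\<^sup>+c. indicator {c..c + T} y * (?k y * ennreal (h y)) \<partial>lborel)" ..
  qed
  also have "\<dots> \<le> (\<integral>\<^sup>+y. \<integral>\<^sup>+c. indicator {c..c + T} y * (?l c * ennreal (h y)) \<partial>lborel \<partial>lborel)"
  proof (intro nn_integral_mono)
    fix y c
    show "indicator {c..c + T} y * (?k y * ennreal (h y)) \<le> indicator {c..c + T} y * (?l c * ennreal (h y))"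
    proof (cases "y \<in> {c..c + T}")
      case True
      then show ?thesis using mult_right_mono[OF kl[of c y], of "ennreal (h y)"] by simp
    qed simp
  qed
  also have "\<dots> = (\<integral>\<^sup>+y. \<integral>\<^sup>+c. indicator {0..T} (y - c) * (?l c * ennreal (h y)) \<partial>lborel \<partial>lborel)"
    by (intro nn_integral_cong) (auto simp: indicator_def)
  also have "\<dots> = (\<integral>\<^sup>+c. \<integral>\<^sup>+y. indicator {0..T} (y - c) * (?l c * ennreal (h y)) \<partial>lborel \<partial>lborel)"
    by (rule lborel_pair.Fubini') measurable
  also have "\<dots> = (\<integral>\<^sup>+c. \<integral>\<^sup>+y. ?l c * (indicator {c..c + T} y * ennreal (h y)) \<partial>lborel \<partial>lborel)"
    by (intro nn_integral_cong) (auto simp: indicator_def)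
  also have "\<dots> = (\<integral>\<^sup>+c. ?l c * (\<integral>\<^sup>+y. (indicator {c..c + T} y * ennreal (h y)) \<partial>lborel) \<partial>lborel)"
    by (intro nn_integral_cong nn_integral_cmult) measurable
  also have "\<dots> \<le> (\<integral>\<^sup>+c. ?l c * ennreal (T * (\<epsilon> * exp (lam * (1 + \<bar>c - a\<bar> / T)))) \<partial>lborel)"
    by (intro nn_integral_mono mult_left_mono means) auto
  also have "\<dots> = (\<integral>\<^sup>+c. ennreal (T * \<epsilon> * exp (2 * lam + 1)) * ennreal (exp (- \<bar>(c - a) / T\<bar>)) \<partial>lborel)"
  proof (rule nn_integral_cong)
    fix c
    have "exp (lam + 1 - (lam + 1) * \<bar>c - a\<bar> / T) * exp (lam * (1 + \<bar>c - a\<bar> / T)) = exp (2 * lam + 1) * exp (- \<bar>(c - a) / T\<bar>)"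
      using T unfolding exp_add[symmetric] by (simp add: abs_divide algebra_simps add_divide_distrib)
    then have "exp (lam + 1 - (lam + 1) * \<bar>c - a\<bar> / T) * (T * (\<epsilon> * exp (lam * (1 + \<bar>c - a\<bar> / T)))) 
       = (T * \<epsilon> * exp (2 * lam + 1)) * exp (- \<bar>(c - a) / T\<bar>)"
      by (simp add: mult_ac)
    then show "?l c * ennreal (T * (\<epsilon> * exp (lam * (1 + \<bar>c - a\<bar> / T)))) = ennreal (T * \<epsilon> * exp (2 * lam + 1)) * ennreal (exp (- \<bar>(c - a) / T\<bar>))"
      using T e by (subst (1 2) ennreal_mult[symmetric]) auto
  qed
  also have "\<dots> = ennreal (T * \<epsilon> * exp (2 * lam + 1)) * (\<integral>\<^sup>+c. ennreal (exp (- \<bar>(c - a) / T\<bar>)) \<partial>lborel)"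
    by (intro nn_integral_cmult) measurable
  also have "(\<integral>\<^sup>+c. ennreal (exp (- \<bar>(c - a) / T\<bar>)) \<partial>lborel) = ennreal T * ennreal exp_abs_mass"
    using T by (subst nn_integral_real_affine[where c=T and t=a]) (auto simp: nn_integral_exp_neg_abs)
  also have "ennreal (T * \<epsilon> * exp (2 * lam + 1)) * (ennreal T * ennreal exp_abs_mass) = 
      ennreal T * ennreal (T * \<epsilon> * (exp (2 * lam + 1) * exp_abs_mass))"
    using T e exp_abs_mass_nonneg by (simp flip: ennreal_mult add: mult_ac)
  finally show ?thesis
    using T by (subst (asm) ennreal_mult_le_mult_iff) auto
qed

lemma abs_gaussconv_le:
  assumes h: "exp_tame h" and T: "0 < T" and B: "\<And>z. \<bar>gauss n z\<bar> \<le> B * exp (- \<kappa> * \<bar>z\<bar>)" and C: "0 \<le> C"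
    and bd: "(\<integral>\<^sup>+y. ennreal (exp (- \<kappa> * \<bar>(x - y) / T\<bar>)) * ennreal \<bar>h y\<bar> \<partial>lborel) \<le> ennreal C"
  shows "\<bar>gaussconv h n x T\<bar> \<le> B * C"
proof -
  have [measurable]: "h \<in> borel_measurable borel" using h by (simp add: exp_tame_def)
  have B0: "0 \<le> B" using order_trans[OF abs_ge_zero B[of 0]] by simp
  have "ennreal (norm (gaussconv h n x T)) \<le> (\<integral>\<^sup>+y. ennreal (norm (gauss n ((x - y) / T) * h y)) \<partial>lborel)"
    unfolding gaussconv_def by (rule integral_norm_bound_ennreal[OF integrable_gaussconv[OF h T]])
  also have "\<dots> \<le> (\<integral>\<^sup>+y. ennreal B * (ennreal (exp (- \<kappa> * \<bar>(x - y) / T\<bar>)) * ennreal \<bar>h y\<bar>) \<partial>lborel)"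
  proof (rule nn_integral_mono)
    fix y
    have "norm (gauss n ((x - y) / T) * h y) \<le> B * exp (- \<kappa> * \<bar>(x - y) / T\<bar>) * \<bar>h y\<bar>"
      using mult_right_mono[OF B[of "(x - y) / T"], of "\<bar>h y\<bar>"] by (simp add: abs_mult)
    then show "ennreal (norm (gauss n ((x - y) / T) * h y)) \<le> ennreal B * (ennreal (exp (- \<kappa> * \<bar>(x - y) / T\<bar>)) * ennreal \<bar>h y\<bar>)"
      using B0 by (simp flip: ennreal_mult add: mult.assoc ennreal_leI)
  qed
  also have "\<dots> = ennreal B * (\<integral>\<^sup>+y. ennreal (exp (- \<kappa> * \<bar>(x - y) / T\<bar>)) * ennreal \<bar>h y\<bar> \<partial>lborel)"
    by (intro nn_integral_cmult) measurable
  also have "\<dots> \<le> ennreal B * ennreal C" by (intro mult_left_mono bd) auto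
  also have "\<dots> = ennreal (B * C)" using B0 C by (simp add: ennreal_mult)
  finally show ?thesis using B0 C by simp
qed

text \<open>
  Convexity of the exponential function makes all deviations linear in \<open>\<epsilon>\<close>, with constants that
  depend on the global bound \<open>E\<close> only.
\<close>

lemma exp_scaled_minus_one_le:
  assumes "0 \<le> \<epsilon>" "\<epsilon> \<le> E" "1 \<le> E" "0 \<le> (z::real)"
  shows "exp (\<epsilon> * z) - 1 \<le> \<epsilon> * exp (E * z)"
proof -
  define th where "th = \<epsilon> / E"
  have th: "0 \<le> th" "th \<le> 1" "th \<le> \<epsilon>" "\<epsilon> = th * E"
    using assms mult_left_mono[of 1 E \<epsilon>] by (auto simp: th_def field_simps)
  have "exp ((1 - th) *\<^sub>R 0 + th *\<^sub>R (E * z)) \<le> (1 - th) * exp 0 + th * exp (E * z)"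
    by (rule convex_onD[OF exp_convex]) (use th in auto)
  then have "exp (\<epsilon> * z) - 1 \<le> th * exp (E * z) - th" using th by (simp add: mult.assoc)
  also have "\<dots> \<le> \<epsilon> * exp (E * z)"
    using th mult_right_mono[of th \<epsilon> "exp (E * z)"] by simp
  finally show ?thesis .
qed

text \<open>
  \<open>\<alpha>\<close> is the logarithm of the weight. The constant \<open>E\<close> is the one valid at every scale; smaller
  constants are available at small scales.
\<close>

locale controlled_weight =
  fixes \<alpha> :: "real \<Rightarrow> real" and E :: real
  assumes measurable_alpha [measurable]: "\<alpha> \<in> borel_measurable borel"
    and la: "locally_integrable \<alpha>"
    and le: "locally_integrable (\<lambda>x. exp (\<alpha> x))"
    and E: "1 \<le> E"
    and ctr_E: "\<And>T. 0 < T \<Longrightarrow> controlled \<alpha> E T"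
begin

definition "K0 = exp (14 * E + 1) * exp_abs_mass"

lemma K0_nonneg: "0 \<le> K0"
  unfolding K0_def using exp_abs_mass_nonneg by simp

text \<open>
  The exponent \<open>7E + 1\<close> is forced by \<open>controlled_mean_abs_exp_diff\<close>: the means grow like
  \<open>exp(7E |c-a|/T)\<close>.
\<close>

lemma deviation_bounds:
  assumes e: "0 \<le> \<epsilon>" "\<epsilon> \<le> E" and ctr: "controlled \<alpha> \<epsilon> T" and T: "0 < T" and x: "a \<le> x" "x \<le> a + T"
  defines "m \<equiv> interval_mean a (a + T) \<alpha>"
  shows "(\<integral>\<^sup>+y. ennreal (exp (- (7 * E + 1) * \<bar>(x - y) / T\<bar>)) * ennreal \<bar>exp (\<alpha> y - m) - 1\<bar> \<partial>lborel) \<le> ennreal (T * \<epsilon> * K0)"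
    and "(\<integral>\<^sup>+y. ennreal (exp (- (7 * E + 1) * \<bar>(x - y) / T\<bar>)) * ennreal \<bar>\<alpha> y - m\<bar> \<partial>lborel) \<le> ennreal (T * \<epsilon> * K0)"
proof -
  have le': "locally_integrable (\<lambda>x. exp (\<alpha> x - m))"
    using locally_integrable_cmult[OF le, of "exp (- m)"] by (simp add: exp_diff exp_minus field_simps)
  note li = locally_integrable_abs locally_integrable_diff la le' locally_integrable_const
  have s: "0 \<le> 1 + \<bar>c - a\<bar> / T" for c using T by (simp add: add_nonneg_nonneg)
  have A: "interval_mean c (c + T) (\<lambda>y. \<bar>exp (\<alpha> y - m) - 1\<bar>) \<le> \<epsilon> * exp (7 * E * (1 + \<bar>c - a\<bar> / T))" for c
  proof -
    have "interval_mean c (c + T) (\<lambda>y. \<bar>exp (\<alpha> y - m) - 1\<bar>) \<le> exp (\<epsilon> * (7 * (1 + \<bar>c - a\<bar> / T))) - 1"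
      using controlled_mean_abs_exp_diff[OF la le ctr T, of c a] by (simp add: m_def mult_ac)
    also have "\<dots> \<le> \<epsilon> * exp (E * (7 * (1 + \<bar>c - a\<bar> / T)))"
      using e E s[of c] by (intro exp_scaled_minus_one_le mult_nonneg_nonneg) auto
    finally show ?thesis by (simp add: mult_ac)
  qed
  have B: "interval_mean c (c + T) (\<lambda>y. \<bar>\<alpha> y - m\<bar>) \<le> \<epsilon> * exp (7 * E * (1 + \<bar>c - a\<bar> / T))" for c
  proof -
    define S where "S = 1 + \<bar>c - a\<bar> / T"
    have "5 * S \<le> 7 * E * S" using E s[of c] by (intro mult_right_mono) (auto simp: S_def)
    then have "5 * S \<le> exp (7 * E * S)" using exp_ge_add_one_self[of "7 * E * S"] by linarith
    then have "\<epsilon> * (5 * S) \<le> \<epsilon> * exp (7 * E * S)" using e by (intro mult_left_mono) auto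
    then show ?thesis
      using controlled_mean_abs_diff[OF la ctr T, of c a] by (simp add: m_def S_def mult_ac)
  qed
  have K: "exp (2 * (7 * E) + 1) * exp_abs_mass = K0" by (simp add: K0_def)
  show "(\<integral>\<^sup>+y. ennreal (exp (- (7 * E + 1) * \<bar>(x - y) / T\<bar>)) * ennreal \<bar>exp (\<alpha> y - m) - 1\<bar> \<partial>lborel) \<le> ennreal (T * \<epsilon> * K0)"
    unfolding K[symmetric]
    by (rule nn_integral_exp_weight_le[OF _ T x _ e(1)], measurable)
       (use E T A in \<open>auto simp: nn_integral_Icc_eq_interval_mean li intro!: ennreal_leI mult_left_mono\<close>)
  show "(\<integral>\<^sup>+y. ennreal (exp (- (7 * E + 1) * \<bar>(x - y) / T\<bar>)) * ennreal \<bar>\<alpha> y - m\<bar> \<partial>lborel) \<le> ennreal (T * \<epsilon> * K0)"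
    unfolding K[symmetric]
    by (rule nn_integral_exp_weight_le[OF _ T x _ e(1)], measurable)
       (use E T B in \<open>auto simp: nn_integral_Icc_eq_interval_mean li intro!: ennreal_leI mult_left_mono\<close>)
qed

lemma exp_tame_deviation:
  shows "exp_tame (\<lambda>y. exp (\<alpha> y - m) - 1)" "exp_tame (\<lambda>y. \<alpha> y - m)"
    and exp_tame_alpha: "exp_tame \<alpha>" and exp_tame_exp_alpha: "exp_tame (\<lambda>y. exp (\<alpha> y))"
proof -
  define M where "M = interval_mean 0 1 \<alpha>"
  have tame: "exp_tame h" if h: "h \<in> borel_measurable borel" "(\<integral>\<^sup>+y. ennreal (exp (- (7 * E + 1) * \<bar>(0 - y) / 1\<bar>)) * ennreal \<bar>h y\<bar> \<partial>lborel) \<le> ennreal (1 * E * K0)"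
    for h :: "real \<Rightarrow> real"
  proof -
    have [measurable]: "h \<in> borel_measurable borel" by (rule h)
    have "(\<integral>\<^sup>+y. ennreal (norm (exp (- (7 * E + 1) * \<bar>y\<bar>) * h y)) \<partial>lborel) 
       = (\<integral>\<^sup>+y. ennreal (exp (- (7 * E + 1) * \<bar>(0 - y) / 1\<bar>)) * ennreal \<bar>h y\<bar> \<partial>lborel)"
      by (intro nn_integral_cong) (simp add: abs_mult ennreal_mult)
    also have "\<dots> < \<infinity>" using h(2) by (rule order.strict_trans1) simp
    finally have "integrable lborel (\<lambda>y. exp (- (7 * E + 1) * \<bar>y\<bar>) * h y)"
      by (intro integrableI_bounded) auto
    then show ?thesis unfolding exp_tame_def using E by (intro conjI exI[of _ "7 * E + 1"]) auto
  qed
  have t1: "exp_tame (\<lambda>y. exp (\<alpha> y - M) - 1)"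
    using deviation_bounds(1)[of E 1 0 0] ctr_E[of 1] E by (intro tame) (auto simp: M_def)
  have t2: "exp_tame (\<lambda>y. \<alpha> y - M)"
    using deviation_bounds(2)[of E 1 0 0] ctr_E[of 1] E by (intro tame) (auto simp: M_def)
  show t3: "exp_tame \<alpha>" using exp_tame_lincomb[OF t2 exp_tame_const[of 1], of 1 M] by simp
  have "(\<lambda>y. exp M * (exp (\<alpha> y - M) - 1) + exp M * 1) = (\<lambda>y. exp (\<alpha> y))"
    by (simp add: algebra_simps flip: exp_add)
  then show t4: "exp_tame (\<lambda>y. exp (\<alpha> y))"
    using exp_tame_lincomb[OF t1 exp_tame_const[of 1], of "exp M" "exp M"] by simp
  show "exp_tame (\<lambda>y. \<alpha> y - m)" using exp_tame_lincomb[OF t3 exp_tame_const[of 1], of 1 "- m"] by simp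
  show "exp_tame (\<lambda>y. exp (\<alpha> y - m) - 1)"
    using exp_tame_lincomb[OF t4 exp_tame_const[of 1], of "exp (- m)" "- 1"]
    by (simp add: exp_diff exp_minus field_simps)
qed

text \<open>
  Jensen's inequality for the probability density \<open>\<phi>\<^sub>t\<close>, proved by integrating the tangent line of the
  exponential function at \<open>(\<alpha> * \<phi>\<^sub>t)(x)\<close>.
\<close>

lemma heat_exp_ge:
  assumes "0 < t"
  shows "exp (heat \<alpha> x t) \<le> heat (\<lambda>y. exp (\<alpha> y)) x t"
proof -
  define c where "c = heat \<alpha> x t"
  have "gaussconv (\<lambda>y. exp c * \<alpha> y + (exp c * (1 - c)) * 1) 0 x t \<le> gaussconv (\<lambda>y. exp (\<alpha> y)) 0 x t"
    unfolding gaussconv_def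
  proof (rule integral_mono)
    show "integrable lborel (\<lambda>y. gauss 0 ((x - y) / t) * (exp c * \<alpha> y + (exp c * (1 - c)) * 1))"
      by (intro integrable_gaussconv exp_tame_lincomb exp_tame_alpha exp_tame_const assms)
    show "integrable lborel (\<lambda>y. gauss 0 ((x - y) / t) * exp (\<alpha> y))"
      by (intro integrable_gaussconv exp_tame_exp_alpha assms)
    fix y
    have "exp c * (1 + (\<alpha> y - c)) \<le> exp c * exp (\<alpha> y - c)"
      by (intro mult_left_mono exp_ge_add_one_self) auto
    then have "exp c * \<alpha> y + (exp c * (1 - c)) * 1 \<le> exp (\<alpha> y)"
      by (simp add: algebra_simps flip: exp_add)
    then show "gauss 0 ((x - y) / t) * (exp c * \<alpha> y + (exp c * (1 - c)) * 1) \<le> gauss 0 ((x - y) / t) * exp (\<alpha> y)"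
      by (intro mult_left_mono) (auto simp: gauss_def)
  qed
  then have "heat (\<lambda>y. exp c * \<alpha> y + (exp c * (1 - c)) * 1) x t \<le> heat (\<lambda>y. exp (\<alpha> y)) x t"
    using assms by (simp add: heat_def divide_right_mono)
  also have "heat (\<lambda>y. exp c * \<alpha> y + (exp c * (1 - c)) * 1) x t = exp c * c + exp c * (1 - c) * 1"
    unfolding heat_lincomb(1)[OF exp_tame_alpha exp_tame_const assms] heat_const(1)[OF assms] c_def ..
  finally show ?thesis by (simp add: c_def algebra_simps)
qed

text \<open>
  With \<open>I = [a,a+T]\<close>, the function \<open>exp(\<alpha> - \<alpha>\<^sub>I)\<close> is \<open>1 + d\<close> where \<open>d\<close> is of size \<open>\<epsilon>\<close> when integrated
  against Gaussian moments. Constants do not contribute to the derivatives of the extension, so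
  these are of size \<open>\<epsilon>\<close> as well. Jensen's inequality keeps the denominator away from zero even when
  \<open>\<epsilon>\<close> is not small.
\<close>

lemma heat_estimates:
  obtains K where "0 < K" 
    "\<And>\<epsilon> T a x. \<lbrakk>0 \<le> \<epsilon>; \<epsilon> \<le> E; controlled \<alpha> \<epsilon> T; 0 < T; a \<le> x; x \<le> a + T\<rbrakk> \<Longrightarrow>
       \<bar>ln (heat (\<lambda>y. exp (\<alpha> y)) x T) - interval_mean a (a + T) \<alpha>\<bar> \<le> \<epsilon> * K \<and>
       \<bar>T * heat_x (\<lambda>y. exp (\<alpha> y)) x T / heat (\<lambda>y. exp (\<alpha> y)) x T\<bar> \<le> \<epsilon> * K \<and>
       \<bar>T\<^sup>2 * heat_xx (\<lambda>y. exp (\<alpha> y)) x T / heat (\<lambda>y. exp (\<alpha> y)) x T\<bar> \<le> \<epsilon> * K"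
proof -
  obtain B0 B1 B2 where Bs: "0 < B0" "\<And>z. \<bar>gauss 0 z\<bar> \<le> B0 * exp (- (7 * E + 1) * \<bar>z\<bar>)"
    "0 < B1" "\<And>z. \<bar>gauss 1 z\<bar> \<le> B1 * exp (- (7 * E + 1) * \<bar>z\<bar>)"
    "0 < B2" "\<And>z. \<bar>gauss 2 z\<bar> \<le> B2 * exp (- (7 * E + 1) * \<bar>z\<bar>)"
    using gauss_exp_bound[of 0 "7 * E + 1"] gauss_exp_bound[of 1 "7 * E + 1"] gauss_exp_bound[of 2 "7 * E + 1"] by metis
  define B where "B = B0 + B1 + B2"
  have B: "0 < B" "\<bar>gauss 0 z\<bar> \<le> B * exp (- (7 * E + 1) * \<bar>z\<bar>)" "\<bar>gauss 1 z\<bar> \<le> B * exp (- (7 * E + 1) * \<bar>z\<bar>)"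
     "\<bar>gauss 2 z\<bar> \<le> B * exp (- (7 * E + 1) * \<bar>z\<bar>)" for z
  proof -
    have up: "b * exp (- (7 * E + 1) * \<bar>z\<bar>) \<le> B * exp (- (7 * E + 1) * \<bar>z\<bar>)" if "b \<in> {B0, B1, B2}" for b
      using that Bs(1,3,5) by (intro mult_right_mono) (auto simp: B_def)
    show "0 < B" using Bs(1,3,5) by (simp add: B_def)
    show "\<bar>gauss 0 z\<bar> \<le> B * exp (- (7 * E + 1) * \<bar>z\<bar>)" by (rule order_trans[OF Bs(2) up]) simp
    show "\<bar>gauss 1 z\<bar> \<le> B * exp (- (7 * E + 1) * \<bar>z\<bar>)" by (rule order_trans[OF Bs(4) up]) simp
    show "\<bar>gauss 2 z\<bar> \<le> B * exp (- (7 * E + 1) * \<bar>z\<bar>)" by (rule order_trans[OF Bs(6) up]) simp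
  qed
  define k where "k = B * K0 + 1"
  have k: "1 \<le> k" using B(1) K0_nonneg by (simp add: k_def)
  define K where "K = 6 * k * exp (E * k)"
  have "1 * 1 \<le> 6 * exp (E * k)" using E k by (intro mult_mono) auto
  then have kK: "k \<le> K" using k mult_left_mono[of 1 "6 * exp (E * k)" k] by (simp add: K_def mult_ac)
  have pi1: "1 \<le> sqrt pi" using pi_gt3 by simp
  show ?thesis
  proof (rule that)
    show "0 < K" using kK k by simp
  next
    fix \<epsilon> T a x assume e: "0 \<le> \<epsilon>" "\<epsilon> \<le> E" and ctr: "controlled \<alpha> \<epsilon> T" and T: "0 < T" and x: "a \<le> x" "x \<le> a + T"
    define m where "m = interval_mean a (a + T) \<alpha>"
    define d where "d y = exp (\<alpha> y - m) - 1" for y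
    have td: "exp_tame d" unfolding d_def by (rule exp_tame_deviation)
    let ?w = "\<lambda>y. exp (\<alpha> y)"
    have w: "?w = (\<lambda>y. exp m * d y + exp m * 1)"
      by (simp add: d_def algebra_simps flip: exp_add)
    have gd: "\<bar>gaussconv d n x T\<bar> \<le> T * (\<epsilon> * k)" if "n \<in> {0, 1, 2}" for n
    proof -
      have "\<bar>gaussconv d n x T\<bar> \<le> B * (T * \<epsilon> * K0)"
        unfolding d_def
        by (rule abs_gaussconv_le[OF exp_tame_deviation(1) T, where \<kappa>="7 * E + 1"])
           (use that B e T K0_nonneg deviation_bounds(1)[OF e ctr T x] in \<open>auto simp: m_def\<close>)
      also have "\<dots> \<le> T * (\<epsilon> * k)" using T e by (simp add: k_def algebra_simps)
      finally show ?thesis .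
    qed
    have ga: "\<bar>gaussconv (\<lambda>y. \<alpha> y - m) 0 x T\<bar> \<le> T * (\<epsilon> * k)"
    proof -
      have "\<bar>gaussconv (\<lambda>y. \<alpha> y - m) 0 x T\<bar> \<le> B * (T * \<epsilon> * K0)"
        by (rule abs_gaussconv_le[OF exp_tame_deviation(2) T, where \<kappa>="7 * E + 1"])
           (use B e T K0_nonneg deviation_bounds(2)[OF e ctr T x] in \<open>auto simp: m_def\<close>)
      also have "\<dots> \<le> T * (\<epsilon> * k)" using T e by (simp add: k_def algebra_simps)
      finally show ?thesis .
    qed
    have divb: "\<bar>z / (T * sqrt pi)\<bar> \<le> c" if "\<bar>z\<bar> \<le> T * c" for z c
    proof -
      have "0 \<le> c" using order_trans[OF abs_ge_zero that] T by (simp add: zero_le_mult_iff)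
      have "\<bar>z / (T * sqrt pi)\<bar> = \<bar>z\<bar> / (T * sqrt pi)" using T by (simp add: abs_divide abs_mult)
      also have "\<dots> \<le> T * c / (T * sqrt pi)" using that T by (intro divide_right_mono) auto
      also have "\<dots> = c / sqrt pi" using T by simp
      also have "\<dots> \<le> c / 1" using pi1 \<open>0 \<le> c\<close> by (intro divide_left_mono) auto
      finally show ?thesis by simp
    qed
    have h0: "\<bar>heat d x T\<bar> \<le> \<epsilon> * k" unfolding heat_def using gd[of 0] by (intro divb) simp
    have h1: "\<bar>T * heat_x d x T\<bar> \<le> 6 * (\<epsilon> * k)"
    proof -
      have "T * heat_x d x T = (- 2 * gaussconv d 1 x T) / (T * sqrt pi)"
        using T by (simp add: heat_x_def power2_eq_square)
      also have "\<bar>\<dots>\<bar> \<le> 2 * (\<epsilon> * k)" using gd[of 1] by (intro divb) (simp add: abs_mult)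
      finally show ?thesis using e k by (simp add: algebra_simps)
    qed
    have h2: "\<bar>T\<^sup>2 * heat_xx d x T\<bar> \<le> 6 * (\<epsilon> * k)"
    proof -
      have "T\<^sup>2 * heat_xx d x T = (4 * gaussconv d 2 x T - 2 * gaussconv d 0 x T) / (T * sqrt pi)"
        using T by (simp add: heat_xx_def power2_eq_square power3_eq_cube)
      also have "\<bar>\<dots>\<bar> \<le> 6 * (\<epsilon> * k)" using gd[of 0] gd[of 2] by (intro divb) auto
      finally show ?thesis .
    qed
    have hal: "\<bar>heat \<alpha> x T - m\<bar> \<le> \<epsilon> * k"
    proof -
      have "heat (\<lambda>y. 1 * \<alpha> y + (- m) * 1) x T = 1 * heat \<alpha> x T + (- m) * 1"
        unfolding heat_lincomb(1)[OF exp_tame_alpha exp_tame_const T] heat_const(1)[OF T] ..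
      then have "heat \<alpha> x T - m = gaussconv (\<lambda>y. \<alpha> y - m) 0 x T / (T * sqrt pi)"
        by (simp add: heat_def)
      also have "\<bar>\<dots>\<bar> \<le> \<epsilon> * k" by (intro divb ga)
      finally show ?thesis .
    qed
    have u: "heat ?w x T = exp m * (heat d x T + 1)"
      unfolding w heat_lincomb[OF td exp_tame_const T] heat_const[OF T] by (simp add: algebra_simps)
    have ux: "heat_x ?w x T = exp m * heat_x d x T" "heat_xx ?w x T = exp m * heat_xx d x T"
      unfolding w heat_lincomb[OF td exp_tame_const T] heat_const[OF T] by simp_all
    have lo: "exp (m - \<epsilon> * k) \<le> heat ?w x T"
      using hal by (intro order_trans[OF _ heat_exp_ge[OF T]]) auto
    then have upos: "0 < heat ?w x T" by (rule less_le_trans[OF exp_gt_zero])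
    have "m - \<epsilon> * k \<le> ln (heat ?w x T)" using lo upos by (simp add: ln_ge_iff)
    moreover have "ln (heat ?w x T) \<le> m + \<epsilon> * k"
    proof -
      have "heat ?w x T \<le> exp m * exp (\<epsilon> * k)"
        unfolding u using h0 exp_ge_add_one_self[of "\<epsilon> * k"] by (intro mult_left_mono exp_ge_zero) linarith
      then show ?thesis using upos by (subst ln_le_cancel_iff[symmetric, THEN iffD1, THEN order_trans]) (auto simp flip: exp_add)
    qed
    ultimately have ln: "\<bar>ln (heat ?w x T) - m\<bar> \<le> \<epsilon> * k" by linarith
    have rat: "\<bar>exp m * z / heat ?w x T\<bar> \<le> \<epsilon> * K" if "\<bar>z\<bar> \<le> 6 * (\<epsilon> * k)" for z
    proof -
      have "exp (m - E * k) \<le> exp (m - \<epsilon> * k)" using e k by (simp add: mult_right_mono)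
      then have lo': "exp (m - E * k) \<le> heat ?w x T" using lo by linarith
      have "\<bar>exp m * z / heat ?w x T\<bar> = exp m * \<bar>z\<bar> / heat ?w x T" using upos by (simp add: abs_mult abs_divide)
      also have "\<dots> \<le> exp m * (6 * (\<epsilon> * k)) / exp (m - E * k)"
        using that lo' e k by (intro frac_le mult_left_mono) auto
      also have "\<dots> = \<epsilon> * K" by (simp add: K_def exp_diff field_simps)
      finally show ?thesis .
    qed
    have "\<bar>T * heat_x ?w x T / heat ?w x T\<bar> \<le> \<epsilon> * K" "\<bar>T\<^sup>2 * heat_xx ?w x T / heat ?w x T\<bar> \<le> \<epsilon> * K"
      using rat[OF h1] rat[OF h2] by (simp_all add: ux mult_ac)
    moreover have "\<epsilon> * k \<le> \<epsilon> * K" using e kK by (intro mult_left_mono) auto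
    ultimately show "\<bar>ln (heat ?w x T) - interval_mean a (a + T) \<alpha>\<bar> \<le> \<epsilon> * K \<and>
       \<bar>T * heat_x ?w x T / heat ?w x T\<bar> \<le> \<epsilon> * K \<and> \<bar>T\<^sup>2 * heat_xx ?w x T / heat ?w x T\<bar> \<le> \<epsilon> * K"
      using ln unfolding m_def by linarith
  qed
qed

text \<open>
  For \<open>t \<le> T\<close> the average of \<open>\<alpha> * \<phi>\<^sub>t\<close> over \<open>[a,a+T]\<close> is a Gaussian average of the means of \<open>\<alpha>\<close> over the
  translates \<open>[a,a+T] - t z\<close>, which differ from the mean over \<open>[a,a+T]\<close> by a multiple of
  \<open>\<epsilon> (1 + |z|)\<close>. The bound does not deteriorate as \<open>t\<close> tends to zero.
\<close>

lemma mean_heat_alpha: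
  obtains K where "0 < K" 
    "\<And>\<epsilon> T a t. \<lbrakk>0 \<le> \<epsilon>; controlled \<alpha> \<epsilon> T; 0 < t; t \<le> T\<rbrakk> \<Longrightarrow>
       \<bar>integral {a..a + T} (\<lambda>x. heat \<alpha> x t) - T * interval_mean a (a + T) \<alpha>\<bar> \<le> T * (\<epsilon> * K)"
proof -
  obtain B where B: "0 < B" "\<And>z. \<bar>gauss 0 z\<bar> \<le> B * exp (- 2 * \<bar>z\<bar>)" using gauss_exp_bound[of 0 2] by metis
  define K where "K = 5 * B * exp_abs_mass + 1"
  have K: "0 < K" using B exp_abs_mass_nonneg by (simp add: K_def add_nonneg_pos)
  have pi1: "1 \<le> sqrt pi" using pi_gt3 by simp
  show ?thesis
  proof (rule that[OF K])
    fix \<epsilon> T a t assume e: "0 \<le> \<epsilon>" and ctr: "controlled \<alpha> \<epsilon> T" and t: "0 < t" "t \<le> T"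
    have T: "0 < T" using t by simp
    define m where "m = interval_mean a (a + T) \<alpha>"
    define b where "b y = \<alpha> y - m" for y
    have tb: "exp_tame b" unfolding b_def by (rule exp_tame_deviation)
    have [measurable]: "b \<in> borel_measurable borel" by (simp add: b_def[abs_def])
    have lb: "locally_integrable b" unfolding b_def by (intro locally_integrable_diff la locally_integrable_const)
    have g0: "0 \<le> gauss 0 z" for z by (simp add: gauss_def)
    have hb: "heat \<alpha> x t = heat b x t + m" for x
    proof -
      have "\<alpha> = (\<lambda>y. 1 * b y + m * 1)" by (simp add: b_def)
      then have "heat \<alpha> x t = heat (\<lambda>y. 1 * b y + m * 1) x t" by simp
      also have "\<dots> = heat b x t + m"
        unfolding heat_lincomb(1)[OF tb exp_tame_const t(1)] heat_const(1)[OF t(1)] by simp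
      finally show ?thesis .
    qed
    have cb: "continuous_on {a..a + T} (\<lambda>x. heat b x t)" using tb t by (intro continuous_intros) auto
    have pt: "ennreal \<bar>heat b x t\<bar> \<le> (\<integral>\<^sup>+z. ennreal (gauss 0 z) * ennreal \<bar>b (x - t * z)\<bar> \<partial>lborel)" for x
    proof -
      have "\<bar>heat b x t\<bar> \<le> \<bar>gaussconv b 0 x t\<bar> / t"
        unfolding heat_def using t pi1 by (simp add: abs_divide abs_mult frac_le)
      then have "ennreal \<bar>heat b x t\<bar> \<le> ennreal (1 / t) * ennreal \<bar>gaussconv b 0 x t\<bar>"
        using t by (simp flip: ennreal_mult add: ennreal_leI)
      also have "ennreal \<bar>gaussconv b 0 x t\<bar> \<le> (\<integral>\<^sup>+y. ennreal (norm (gauss 0 ((x - y) / t) * b y)) \<partial>lborel)"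
        unfolding gaussconv_def real_norm_def[symmetric] by (rule integral_norm_bound_ennreal[OF integrable_gaussconv[OF tb t(1)]])
      also have "\<dots> = ennreal t * (\<integral>\<^sup>+z. ennreal (gauss 0 z) * ennreal \<bar>b (x - t * z)\<bar> \<partial>lborel)"
        using t g0 by (subst nn_integral_real_affine[where c="-t" and t=x]) (auto simp: abs_mult ennreal_mult)
      also have "ennreal (1 / t) * (ennreal t * (\<integral>\<^sup>+z. ennreal (gauss 0 z) * ennreal \<bar>b (x - t * z)\<bar> \<partial>lborel))
          = (\<integral>\<^sup>+z. ennreal (gauss 0 z) * ennreal \<bar>b (x - t * z)\<bar> \<partial>lborel)"
        using t by (simp add: mult.assoc[symmetric] flip: ennreal_mult)
      finally show ?thesis by (simp add: mult_left_mono)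
    qed
    have "(\<integral>\<^sup>+x. indicator {a..a + T} x * ennreal \<bar>heat b x t\<bar> \<partial>lborel) 
      \<le> (\<integral>\<^sup>+x. indicator {a..a + T} x * (\<integral>\<^sup>+z. ennreal (gauss 0 z) * ennreal \<bar>b (x - t * z)\<bar> \<partial>lborel) \<partial>lborel)"
      by (intro nn_integral_mono mult_left_mono pt) auto
    also have "\<dots> = (\<integral>\<^sup>+x. \<integral>\<^sup>+z. indicator {a..a + T} x * (ennreal (gauss 0 z) * ennreal \<bar>b (x - t * z)\<bar>) \<partial>lborel \<partial>lborel)"
      by (intro nn_integral_cong nn_integral_cmult[symmetric]) measurable
    also have "\<dots> = (\<integral>\<^sup>+z. \<integral>\<^sup>+x. indicator {a..a + T} x * (ennreal (gauss 0 z) * ennreal \<bar>b (x - t * z)\<bar>) \<partial>lborel \<partial>lborel)"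
      by (rule lborel_pair.Fubini') measurable
    also have "\<dots> \<le> (\<integral>\<^sup>+z. ennreal (T * \<epsilon> * (5 * B)) * ennreal (exp (- \<bar>z\<bar>)) \<partial>lborel)"
    proof (rule nn_integral_mono)
      fix z :: real
      let ?c = "a - t * z"
      have "(\<integral>\<^sup>+x. indicator {a..a + T} x * (ennreal (gauss 0 z) * ennreal \<bar>b (x - t * z)\<bar>) \<partial>lborel)
         = (\<integral>\<^sup>+x. ennreal (gauss 0 z) * (indicator {a..a + T} x * ennreal \<bar>b (x - t * z)\<bar>) \<partial>lborel)"
        by (simp add: mult_ac)
      also have "\<dots> = ennreal (gauss 0 z) * (\<integral>\<^sup>+x. indicator {a..a + T} x * ennreal \<bar>b (x - t * z)\<bar> \<partial>lborel)"
        by (intro nn_integral_cmult) measurable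
      also have "(\<integral>\<^sup>+x. indicator {a..a + T} x * ennreal \<bar>b (x - t * z)\<bar> \<partial>lborel) 
        = (\<integral>\<^sup>+y. indicator {?c..?c + T} y * ennreal \<bar>b y\<bar> \<partial>lborel)"
        by (subst nn_integral_real_affine[where c=1 and t="t * z"]) (auto simp: indicator_def intro!: nn_integral_cong)
      also have "\<dots> = ennreal (T * interval_mean ?c (?c + T) (\<lambda>y. \<bar>b y\<bar>))"
        using T by (intro nn_integral_Icc_eq_interval_mean locally_integrable_abs lb) auto
      also have "\<dots> \<le> ennreal (T * (5 * \<epsilon> * exp \<bar>z\<bar>))"
      proof (intro ennreal_leI mult_left_mono)
        have "interval_mean ?c (?c + T) (\<lambda>y. \<bar>b y\<bar>) \<le> 5 * \<epsilon> * (1 + \<bar>?c - a\<bar> / T)"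
          using controlled_mean_abs_diff[OF la ctr T, of ?c a] by (simp add: b_def m_def)
        also have "\<dots> \<le> 5 * \<epsilon> * exp \<bar>z\<bar>"
        proof (intro mult_left_mono)
          have "\<bar>?c - a\<bar> / T = t / T * \<bar>z\<bar>" using t by (simp add: abs_mult)
          also have "\<dots> \<le> 1 * \<bar>z\<bar>" using t by (intro mult_right_mono) auto
          finally show "1 + \<bar>?c - a\<bar> / T \<le> exp \<bar>z\<bar>" using exp_ge_add_one_self[of "\<bar>z\<bar>"] by linarith
        qed (use e in auto)
        finally show "interval_mean ?c (?c + T) (\<lambda>y. \<bar>b y\<bar>) \<le> 5 * \<epsilon> * exp \<bar>z\<bar>" .
      qed (use T in auto)
      also have "ennreal (gauss 0 z) * ennreal (T * (5 * \<epsilon> * exp \<bar>z\<bar>)) = ennreal (gauss 0 z * (T * (5 * \<epsilon> * exp \<bar>z\<bar>)))"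
        using g0 e T by (simp add: ennreal_mult)
      also have "\<dots> \<le> ennreal ((B * exp (- 2 * \<bar>z\<bar>)) * (T * (5 * \<epsilon> * exp \<bar>z\<bar>)))"
        using B(2)[of z] e T by (intro ennreal_leI mult_right_mono) auto
      also have "(B * exp (- 2 * \<bar>z\<bar>)) * (T * (5 * \<epsilon> * exp \<bar>z\<bar>)) = (T * \<epsilon> * (5 * B)) * (exp (- 2 * \<bar>z\<bar>) * exp \<bar>z\<bar>)"
        by (simp add: mult_ac)
      also have "\<dots> = (T * \<epsilon> * (5 * B)) * exp (- \<bar>z\<bar>)" unfolding exp_add[symmetric] by simp
      also have "ennreal \<dots> = ennreal (T * \<epsilon> * (5 * B)) * ennreal (exp (- \<bar>z\<bar>))"
        using T e B by (simp add: ennreal_mult)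
      finally show "(\<integral>\<^sup>+x. indicator {a..a + T} x * (ennreal (gauss 0 z) * ennreal \<bar>b (x - t * z)\<bar>) \<partial>lborel)
        \<le> ennreal (T * \<epsilon> * (5 * B)) * ennreal (exp (- \<bar>z\<bar>))" by (simp add: mult_left_mono)
    qed
    also have "\<dots> = ennreal (T * \<epsilon> * (5 * B)) * ennreal exp_abs_mass"
      unfolding nn_integral_exp_neg_abs[symmetric] by (intro nn_integral_cmult) measurable
    also have "\<dots> = ennreal (T * \<epsilon> * (5 * B * exp_abs_mass))"
      using T e B exp_abs_mass_nonneg by (simp flip: ennreal_mult add: mult_ac)
    finally have 1: "(\<integral>\<^sup>+x. indicator {a..a + T} x * ennreal \<bar>heat b x t\<bar> \<partial>lborel) \<le> ennreal (T * \<epsilon> * (5 * B * exp_abs_mass))" .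
    have si: "set_integrable lborel {a..a + T} (\<lambda>x. heat b x t)" using borel_integrable_atLeastAtMost'[OF cb] .
    have "ennreal (norm (\<integral>x. indicator {a..a + T} x *\<^sub>R heat b x t \<partial>lborel)) \<le> (\<integral>\<^sup>+x. ennreal (norm (indicator {a..a + T} x *\<^sub>R heat b x t)) \<partial>lborel)"
      using si unfolding set_integrable_def by (rule integral_norm_bound_ennreal)
    also have "\<dots> = (\<integral>\<^sup>+x. indicator {a..a + T} x * ennreal \<bar>heat b x t\<bar> \<partial>lborel)"
      by (intro nn_integral_cong) (auto simp: indicator_def)
    also note 1
    also have "(\<integral>x. indicator {a..a + T} x *\<^sub>R heat b x t \<partial>lborel) = integral {a..a + T} (\<lambda>x. heat b x t)"
      using set_borel_integral_eq_integral(2)[OF si] by (simp add: set_lebesgue_integral_def)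
    finally have "\<bar>integral {a..a + T} (\<lambda>x. heat b x t)\<bar> \<le> T * \<epsilon> * (5 * B * exp_abs_mass)"
      using T e B exp_abs_mass_nonneg by (subst (asm) ennreal_le_iff) auto
    also have "\<dots> \<le> T * (\<epsilon> * K)" using T e by (simp add: K_def algebra_simps)
    finally have 2: "\<bar>integral {a..a + T} (\<lambda>x. heat b x t)\<bar> \<le> T * (\<epsilon> * K)" .
    have "integral {a..a + T} (\<lambda>x. heat \<alpha> x t) = integral {a..a + T} (\<lambda>x. heat b x t) + T * m"
      unfolding hb using cb T by (subst Henstock_Kurzweil_Integration.integral_add) (auto intro: integrable_continuous_real)
    with 2 show "\<bar>integral {a..a + T} (\<lambda>x. heat \<alpha> x t) - T * interval_mean a (a + T) \<alpha>\<bar> \<le> T * (\<epsilon> * K)"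
      by (simp add: m_def)
  qed
qed

end

section \<open>The energy estimate\<close>

lemma nn_integral_Icc_continuous:
  fixes g :: "real \<Rightarrow> real"
  assumes "continuous_on {a..b} g" "\<And>x. a \<le> x \<Longrightarrow> x \<le> b \<Longrightarrow> 0 \<le> g x"
  shows "(\<integral>\<^sup>+x. ennreal (g x) * indicator {a..b} x \<partial>lborel) = ennreal (integral {a..b} g)"
proof -
  have si: "set_integrable lborel {a..b} g" using borel_integrable_atLeastAtMost'[OF assms(1)] .
  have "(\<integral>\<^sup>+x. ennreal (g x) * indicator {a..b} x \<partial>lborel) = (\<integral>\<^sup>+x. ennreal (indicator {a..b} x *\<^sub>R g x) \<partial>lborel)"
    by (intro nn_integral_cong) (auto simp: indicator_def)
  also have "\<dots> = ennreal (\<integral>x. indicator {a..b} x *\<^sub>R g x \<partial>lborel)"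
    using si assms(2) by (intro nn_integral_eq_integral) (auto simp: set_integrable_def indicator_def)
  also have "(\<integral>x. indicator {a..b} x *\<^sub>R g x \<partial>lborel) = integral {a..b} g"
    using set_borel_integral_eq_integral(2)[OF si] by (simp add: set_lebesgue_integral_def)
  finally show ?thesis .
qed

text \<open>
  A positive solution of \<open>u\<^sub>t = (t/2) u\<^sub>x\<^sub>x\<close> together with its derivatives in \<open>x\<close>.
\<close>

locale positive_caloric =
  fixes u ux uxx uxxx :: "real \<Rightarrow> real \<Rightarrow> real"
  assumes pos: "0 < t \<Longrightarrow> 0 < u x t"
    and Du_x: "0 < t \<Longrightarrow> ((\<lambda>x. u x t) has_real_derivative ux x t) (at x)"
    and Dux_x: "0 < t \<Longrightarrow> ((\<lambda>x. ux x t) has_real_derivative uxx x t) (at x)"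
    and Duxx_x: "0 < t \<Longrightarrow> ((\<lambda>x. uxx x t) has_real_derivative uxxx x t) (at x)"
    and Du_t: "0 < t \<Longrightarrow> ((\<lambda>t. u x t) has_real_derivative t / 2 * uxx x t) (at t)"
    and Dux_t: "0 < t \<Longrightarrow> ((\<lambda>t. ux x t) has_real_derivative t / 2 * uxxx x t) (at t)"
    and cont_u: "continuous_on {z. 0 < snd z} (\<lambda>z. u (fst z) (snd z))"
      "continuous_on {z. 0 < snd z} (\<lambda>z. ux (fst z) (snd z))"
      "continuous_on {z. 0 < snd z} (\<lambda>z. uxx (fst z) (snd z))"
      "continuous_on {z. 0 < snd z} (\<lambda>z. uxxx (fst z) (snd z))"
begin

definition "p x t = ux x t / u x t"
definition "q x t = uxx x t / u x t"
definition "r x t = uxxx x t / u x t"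

text \<open>
  The term \<open>A ln u\<close> produces \<open>p\<^sup>2\<close> under the operator \<open>\<partial>\<^sub>t - (t/2)\<partial>\<^sub>x\<^sup>2\<close>, and the term \<open>(t p)\<^sup>2/4\<close>, subtracted,
  produces \<open>q\<^sup>2\<close>. The definitions after the first are the derivatives of \<open>log_energy\<close>, where the
  heat equation is used to express them through \<open>p\<close>, \<open>q\<close> and \<open>r\<close>.
\<close>

definition log_energy where "log_energy A x t = A * ln (u x t) - (t * p x t)\<^sup>2 / 4"
definition log_energy_t where "log_energy_t A x t = A * (t / 2) * q x t - t * (p x t)\<^sup>2 / 2 - t ^ 3 / 4 * p x t * (r x t - p x t * q x t)"
definition log_energy_x where "log_energy_x A x t = A * p x t - t\<^sup>2 / 2 * p x t * (q x t - (p x t)\<^sup>2)"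
definition log_energy_xx where "log_energy_xx A x t = A * (q x t - (p x t)\<^sup>2)
   - t\<^sup>2 / 2 * ((q x t - (p x t)\<^sup>2)\<^sup>2 + p x t * (r x t - 3 * p x t * q x t + 2 * (p x t) ^ 3))"

lemma cont_uxt [continuous_intros]:
  assumes "continuous_on S f" "continuous_on S g" "\<And>z. z \<in> S \<Longrightarrow> 0 < g z"
  shows "continuous_on S (\<lambda>z. u (f z) (g z))" "continuous_on S (\<lambda>z. ux (f z) (g z))"
    "continuous_on S (\<lambda>z. uxx (f z) (g z))" "continuous_on S (\<lambda>z. uxxx (f z) (g z))"
proof -
  have c: "continuous_on S (\<lambda>z. (f z, g z))" "(\<lambda>z. (f z, g z)) ` S \<subseteq> {z. 0 < snd z}"
    using assms by (auto intro!: continuous_intros)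
  show "continuous_on S (\<lambda>z. u (f z) (g z))" "continuous_on S (\<lambda>z. ux (f z) (g z))"
    "continuous_on S (\<lambda>z. uxx (f z) (g z))" "continuous_on S (\<lambda>z. uxxx (f z) (g z))"
    using continuous_on_compose2[OF cont_u(1) c] continuous_on_compose2[OF cont_u(2) c]
      continuous_on_compose2[OF cont_u(3) c] continuous_on_compose2[OF cont_u(4) c] by simp_all
qed

lemma cont_pqr [continuous_intros]:
  assumes "continuous_on S f" "continuous_on S g" "\<And>z. z \<in> S \<Longrightarrow> 0 < g z"
  shows "continuous_on S (\<lambda>z. p (f z) (g z))" "continuous_on S (\<lambda>z. q (f z) (g z))"
    "continuous_on S (\<lambda>z. r (f z) (g z))"
  unfolding p_def q_def r_def using assms pos
  by (auto intro!: continuous_intros) (metis less_irrefl)+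

lemma cont_log_energy [continuous_intros]:
  assumes "continuous_on S f" "continuous_on S g" "\<And>z. z \<in> S \<Longrightarrow> 0 < g z"
  shows "continuous_on S (\<lambda>z. log_energy A (f z) (g z))" "continuous_on S (\<lambda>z. log_energy_t A (f z) (g z))"
    "continuous_on S (\<lambda>z. log_energy_x A (f z) (g z))" "continuous_on S (\<lambda>z. log_energy_xx A (f z) (g z))"
  unfolding log_energy_def log_energy_t_def log_energy_x_def log_energy_xx_def using assms pos
  by (auto intro!: continuous_intros) (metis less_irrefl)+

lemma DERIV_p:
  assumes "0 < t"
  shows "((\<lambda>x. p x t) has_real_derivative q x t - (p x t)\<^sup>2) (at x)"
    and "((\<lambda>t. p x t) has_real_derivative t / 2 * (r x t - p x t * q x t)) (at t)"
    and "((\<lambda>x. q x t) has_real_derivative r x t - q x t * p x t) (at x)"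
  using pos[OF assms, of x] unfolding p_def[abs_def] q_def[abs_def] r_def
  by (auto intro!: derivative_eq_intros Du_x Dux_x Duxx_x Du_t Dux_t assms simp: field_simps power2_eq_square)

lemma DERIV_log_energy_t:
  assumes "0 < t"
  shows "((\<lambda>t. log_energy A x t) has_real_derivative log_energy_t A x t) (at t)"
proof -
  have "((\<lambda>t. ln (u x t)) has_real_derivative t / 2 * q x t) (at t)"
    using pos[OF assms, of x] unfolding q_def
    by (auto intro!: derivative_eq_intros Du_t assms)
  moreover have "((\<lambda>t. (t * p x t)\<^sup>2 / 4) has_real_derivative
      t * p x t * (p x t + t * (t / 2 * (r x t - p x t * q x t))) / 2) (at t)"
    by (auto intro!: derivative_eq_intros DERIV_p(2) assms)
  ultimately have "((\<lambda>t. log_energy A x t) has_real_derivative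
      A * (t / 2 * q x t) - t * p x t * (p x t + t * (t / 2 * (r x t - p x t * q x t))) / 2) (at t)"
    unfolding log_energy_def[abs_def] by (intro DERIV_diff DERIV_cmult)
  then show ?thesis
    by (rule DERIV_cong) (simp add: log_energy_t_def field_simps power2_eq_square power3_eq_cube)
qed

lemma DERIV_log_energy_x:
  assumes "0 < t"
  shows "((\<lambda>x. log_energy_x A x t) has_real_derivative log_energy_xx A x t) (at x)"
  unfolding log_energy_x_def[abs_def] log_energy_xx_def
  by (auto intro!: derivative_eq_intros DERIV_p(1,3) assms simp: field_simps power2_eq_square power3_eq_cube)

text \<open>
  The third derivatives cancel.
\<close>

lemma caloric_defect:
  "log_energy_t A x t - t / 2 * log_energy_xx A x t = t / 2 * (A - 1) * (p x t)\<^sup>2 + t ^ 3 / 4 * ((q x t)\<^sup>2 - 4 * (p x t)\<^sup>2 * q x t + 3 * (p x t) ^ 4)"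
  unfolding log_energy_t_def log_energy_xx_def
  by (simp add: field_simps power2_eq_square power3_eq_cube power4_eq_xxxx)

text \<open>
  The cross term \<open>p\<^sup>2 q\<close> is absorbed by completing a square, at the price of a multiple of
  \<open>t\<^sup>3 p\<^sup>4 \<le> M\<^sup>2 t p\<^sup>2\<close>; the coefficient \<open>A\<close> is large enough to pay for it. The left-hand side is the bound for
  \<open>|\<mu>|\<^sup>2/t\<close>.
\<close>

lemma caloric_defect_ge:
  assumes "0 < t" "\<bar>t * p x t\<bar> \<le> M"
  defines "A \<equiv> 13 / 4 + 5 / 2 * M\<^sup>2"
  shows "t ^ 3 * (q x t)\<^sup>2 / 4 + 9 / 4 * t * (p x t)\<^sup>2 \<le> 2 * (log_energy_t A x t - t / 2 * log_energy_xx A x t)"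
proof -
  define P Q where "P = p x t" and "Q = q x t"
  have "(t * P)\<^sup>2 \<le> M\<^sup>2" using assms(2) by (intro abs_le_square_iff[THEN iffD1]) (simp add: P_def)
  then have "t * P\<^sup>2 * (t * P)\<^sup>2 \<le> t * P\<^sup>2 * M\<^sup>2" using assms(1) by (intro mult_left_mono) auto
  then have 1: "t ^ 3 * P ^ 4 \<le> t * P\<^sup>2 * M\<^sup>2" by (simp add: power2_eq_square power3_eq_cube power4_eq_xxxx mult_ac)
  have "0 \<le> t ^ 3 * (Q - 4 * P\<^sup>2)\<^sup>2 / 4" using assms(1) by simp
  then have 2: "t ^ 3 * Q\<^sup>2 / 4 - 5 / 2 * (t ^ 3 * P ^ 4) \<le> t ^ 3 / 2 * (Q\<^sup>2 - 4 * P\<^sup>2 * Q + 3 * P ^ 4)"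
    by (simp add: field_simps power2_eq_square power3_eq_cube power4_eq_xxxx)
  have "2 * (log_energy_t A x t - t / 2 * log_energy_xx A x t) = t * (9 / 4 + 5 / 2 * M\<^sup>2) * P\<^sup>2 + t ^ 3 / 2 * (Q\<^sup>2 - 4 * P\<^sup>2 * Q + 3 * P ^ 4)"
    unfolding caloric_defect A_def P_def[symmetric] Q_def[symmetric] by (simp add: field_simps)
  also have "\<dots> \<ge> 9 / 4 * t * P\<^sup>2 + 5 / 2 * (t * P\<^sup>2 * M\<^sup>2) + (t ^ 3 * Q\<^sup>2 / 4 - 5 / 2 * (t ^ 3 * P ^ 4))"
    using 2 by (simp add: algebra_simps)
  finally show ?thesis using 1 unfolding P_def[symmetric] Q_def[symmetric] by linarith
qed

text \<open>
  The integral in \<open>x\<close> of the second derivative is evaluated exactly, so that no cut-off function is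
  needed on the lateral sides.
\<close>

lemma energy_identity:
  assumes s: "0 < s" "s \<le> T" and ab: "a \<le> b"
  shows "integral {s..T} (\<lambda>t. integral {a..b} (\<lambda>x. log_energy_t A x t - t / 2 * log_energy_xx A x t)) =
     integral {a..b} (\<lambda>x. log_energy A x T) - integral {a..b} (\<lambda>x. log_energy A x s) - integral {s..T} (\<lambda>t. t / 2 * (log_energy_x A b t - log_energy_x A a t))"
proof -
  have cGt: "continuous_on {s..T} (\<lambda>t. integral {a..b} (\<lambda>x. log_energy_t A x t))"
  proof -
    have "continuous_on ({s..T} \<times> cbox a b) (\<lambda>(t, x). log_energy_t A x t)"
      unfolding split_beta using s by (intro continuous_intros) auto
    from integral_continuous_on_param[OF this] show ?thesis by simp
  qed
  have cGx: "continuous_on {s..T} (\<lambda>t. t / 2 * (log_energy_x A b t - log_energy_x A a t))"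
    using s by (intro continuous_intros) auto
  have slice: "integral {a..b} (\<lambda>x. log_energy_t A x t - t / 2 * log_energy_xx A x t) = 
      integral {a..b} (\<lambda>x. log_energy_t A x t) - t / 2 * (log_energy_x A b t - log_energy_x A a t)" if t: "t \<in> {s..T}" for t
  proof -
    have t0: "0 < t" using t s by simp
    have "((\<lambda>x. log_energy_xx A x t) has_integral (log_energy_x A b t - log_energy_x A a t)) {a..b}"
      using ab DERIV_log_energy_x[OF t0] 
      by (intro fundamental_theorem_of_calculus) 
        (auto simp: has_real_derivative_iff_has_vector_derivative[symmetric] intro: has_field_derivative_at_within)
    from has_integral_mult_right[OF this, of "t / 2"]
    have "((\<lambda>x. t / 2 * log_energy_xx A x t) has_integral (t / 2 * (log_energy_x A b t - log_energy_x A a t))) {a..b}" .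
    moreover have "((\<lambda>x. log_energy_t A x t) has_integral integral {a..b} (\<lambda>x. log_energy_t A x t)) {a..b}"
      using t0 by (intro integrable_integral integrable_continuous_real continuous_intros) auto
    ultimately show ?thesis by (intro integral_unique has_integral_diff)
  qed
  have "((\<lambda>t. integral {a..b} (\<lambda>x. log_energy_t A x t)) has_integral 
      (integral {a..b} (\<lambda>x. log_energy A x T) - integral {a..b} (\<lambda>x. log_energy A x s))) {s..T}"
  proof (rule fundamental_theorem_of_calculus[OF s(2)])
    fix t assume t: "t \<in> {s..T}"
    have "((\<lambda>t. integral (cbox a b) (\<lambda>x. log_energy A x t)) has_vector_derivative integral (cbox a b) (\<lambda>x. log_energy_t A x t)) (at t within {s..T})"
    proof (rule leibniz_rule_vector_derivative)
      show "((\<lambda>t. log_energy A x t) has_vector_derivative log_energy_t A x t') (at t' within {s..T})" if "t' \<in> {s..T}" for x t'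
        using DERIV_log_energy_t[of t' A x] that s
        by (auto simp: has_real_derivative_iff_has_vector_derivative[symmetric] intro: has_field_derivative_at_within)
      show "(\<lambda>x. log_energy A x t') integrable_on cbox a b" if "t' \<in> {s..T}" for t'
        using that s by (intro integrable_continuous continuous_intros) auto
      show "continuous_on ({s..T} \<times> cbox a b) (\<lambda>(t, x). log_energy_t A x t)"
        unfolding split_beta using s by (intro continuous_intros) auto
    qed (use t in auto)
    then show "((\<lambda>t. integral {a..b} (\<lambda>x. log_energy A x t)) has_vector_derivative integral {a..b} (\<lambda>x. log_energy_t A x t)) (at t within {s..T})"
      by simp
  qed
  moreover have "((\<lambda>t. t / 2 * (log_energy_x A b t - log_energy_x A a t)) has_integral integral {s..T} (\<lambda>t. t / 2 * (log_energy_x A b t - log_energy_x A a t))) {s..T}"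
    by (intro integrable_integral integrable_continuous_real cGx)
  ultimately have "((\<lambda>t. integral {a..b} (\<lambda>x. log_energy_t A x t) - t / 2 * (log_energy_x A b t - log_energy_x A a t)) has_integral
     (integral {a..b} (\<lambda>x. log_energy A x T) - integral {a..b} (\<lambda>x. log_energy A x s) - integral {s..T} (\<lambda>t. t / 2 * (log_energy_x A b t - log_energy_x A a t)))) {s..T}"
    by (intro has_integral_diff)
  then show ?thesis
    using slice by (subst Henstock_Kurzweil_Integration.integral_cong[OF slice]) (auto intro: integral_unique)
qed

text \<open>
  In \<open>energy_identity\<close> the common value \<open>m\<close> of \<open>ln u\<close> cancels between top and bottom, and what remains
  is linear in \<open>\<eta>\<close>. On the lateral sides the derivative of \<open>log_energy\<close> is at most a multiple of \<open>\<eta>/t\<close>; the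
  weight \<open>t/2\<close> makes this integrable down to \<open>t = 0\<close>.
\<close>

lemma energy_estimate:
  assumes s: "0 < s" "s < T" and ab: "b = a + T"
    and eta: "0 \<le> \<eta>" "\<eta> \<le> M"
    and bp: "\<And>x t. a \<le> x \<Longrightarrow> x \<le> b \<Longrightarrow> 0 < t \<Longrightarrow> t \<le> T \<Longrightarrow> \<bar>t * p x t\<bar> \<le> \<eta>"
    and bq: "\<And>x t. a \<le> x \<Longrightarrow> x \<le> b \<Longrightarrow> 0 < t \<Longrightarrow> t \<le> T \<Longrightarrow> \<bar>t\<^sup>2 * q x t\<bar> \<le> \<eta>"
    and top: "\<And>x. a \<le> x \<Longrightarrow> x \<le> b \<Longrightarrow> ln (u x T) \<le> m + \<eta>"
    and bottom: "T * (m - \<eta>) \<le> integral {a..b} (\<lambda>x. ln (u x s))"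
  defines "A \<equiv> 13 / 4 + 5 / 2 * M\<^sup>2"
  shows "integral {s..T} (\<lambda>t. integral {a..b} (\<lambda>x. 2 * (log_energy_t A x t - t / 2 * log_energy_xx A x t))) \<le> T * (\<eta> * (6 * A + 2 * M + M\<^sup>2))"
proof -
  have T: "0 < T" "a \<le> b" using s ab by auto
  have A0: "0 \<le> A" by (simp add: A_def)
  have HT: "integral {a..b} (\<lambda>x. log_energy A x T) \<le> T * (A * (m + \<eta>))"
  proof -
    have "integral {a..b} (\<lambda>x. log_energy A x T) \<le> integral {a..b} (\<lambda>x. A * (m + \<eta>))"
    proof (rule integral_le)
      show "(\<lambda>x. log_energy A x T) integrable_on {a..b}"
        using T by (intro integrable_continuous_real continuous_intros) auto
      fix x assume "x \<in> {a..b}"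
      then have "A * ln (u x T) \<le> A * (m + \<eta>)" using top A0 by (intro mult_left_mono) auto
      then show "log_energy A x T \<le> A * (m + \<eta>)" unfolding log_energy_def by (smt (verit) zero_le_power2 divide_nonneg_pos)
    qed auto
    then show ?thesis using T ab by (simp add: mult_ac)
  qed
  have Hs: "T * (A * (m - \<eta>)) - T * (\<eta>\<^sup>2 / 4) \<le> integral {a..b} (\<lambda>x. log_energy A x s)"
  proof -
    have i: "(\<lambda>x. ln (u x s)) integrable_on {a..b}"
      using s pos[OF s(1)] by (intro integrable_continuous_real continuous_intros) (auto simp: less_imp_neq[symmetric])
    have "A * (T * (m - \<eta>)) \<le> A * integral {a..b} (\<lambda>x. ln (u x s))" using bottom A0 by (intro mult_left_mono) auto
    then have "T * (A * (m - \<eta>)) - T * (\<eta>\<^sup>2 / 4) \<le> A * integral {a..b} (\<lambda>x. ln (u x s)) - T * (\<eta>\<^sup>2 / 4)"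
      by (simp add: mult_ac)
    also have "\<dots> = integral {a..b} (\<lambda>x. A * ln (u x s) - \<eta>\<^sup>2 / 4)"
      using i T ab by (subst Henstock_Kurzweil_Integration.integral_diff) (auto intro!: integrable_on_mult_right)
    also have "\<dots> \<le> integral {a..b} (\<lambda>x. log_energy A x s)"
    proof (rule integral_le)
      show "(\<lambda>x. A * ln (u x s) - \<eta>\<^sup>2 / 4) integrable_on {a..b}"
        using i by (intro Henstock_Kurzweil_Integration.integrable_diff integrable_on_mult_right) auto
      show "(\<lambda>x. log_energy A x s) integrable_on {a..b}"
        using s by (intro integrable_continuous_real continuous_intros) auto
      fix x assume "x \<in> {a..b}"
      then have "(s * p x s)\<^sup>2 \<le> \<eta>\<^sup>2" using bp[of x s] s eta by (intro abs_le_square_iff[THEN iffD1]) auto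
      then show "A * ln (u x s) - \<eta>\<^sup>2 / 4 \<le> log_energy A x s" unfolding log_energy_def by simp
    qed
    finally show ?thesis .
  qed
  \<comment> \<open>A bound for \<open>t\<close> times the derivative of \<open>log_energy\<close> on the lateral sides.\<close>
  define c where "c = A * \<eta> + \<eta> * (\<eta> + \<eta>\<^sup>2) / 2"
  have Gx_bound: "\<bar>t * log_energy_x A x t\<bar> \<le> c" if "a \<le> x" "x \<le> b" "s \<le> t" "t \<le> T" for x t
  proof -
    have t0: "0 < t" using that s by simp
    let ?v = "t * p x t" and ?w = "t\<^sup>2 * q x t"
    have v: "\<bar>?v\<bar> \<le> \<eta>" and w: "\<bar>?w\<bar> \<le> \<eta>" using bp[of x t] bq[of x t] that t0 by auto
    have v2: "\<bar>?v\<^sup>2\<bar> \<le> \<eta>\<^sup>2" using v by (simp add: abs_le_square_iff[symmetric])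
    have eq: "t * log_energy_x A x t = A * ?v - ?v * (?w - ?v\<^sup>2) / 2"
      unfolding log_energy_x_def by (simp add: field_simps power2_eq_square)
    have "\<bar>A * ?v\<bar> \<le> A * \<eta>" unfolding abs_mult[of A] using v A0 by (intro mult_mono) auto
    moreover have "\<bar>?v * (?w - ?v\<^sup>2)\<bar> \<le> \<eta> * (\<eta> + \<eta>\<^sup>2)"
    proof -
      have "\<bar>?w - ?v\<^sup>2\<bar> \<le> \<eta> + \<eta>\<^sup>2" using w v2 by linarith
      then show ?thesis unfolding abs_mult[of ?v] using v eta by (intro mult_mono) auto
    qed
    ultimately show ?thesis unfolding eq c_def by linarith
  qed
  have side: "- integral {s..T} (\<lambda>t. t / 2 * (log_energy_x A b t - log_energy_x A a t)) \<le> T * c"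
  proof -
    have "integral {s..T} (\<lambda>t. - (t / 2 * (log_energy_x A b t - log_energy_x A a t))) \<le> integral {s..T} (\<lambda>t. c)"
    proof (rule integral_le)
      show "(\<lambda>t. - (t / 2 * (log_energy_x A b t - log_energy_x A a t))) integrable_on {s..T}"
        using s by (intro integrable_continuous_real continuous_intros) auto
      fix t assume "t \<in> {s..T}"
      then have "\<bar>t * log_energy_x A a t\<bar> \<le> c" "\<bar>t * log_energy_x A b t\<bar> \<le> c" using T by (auto intro!: Gx_bound)
      then have "\<bar>t * log_energy_x A a t - t * log_energy_x A b t\<bar> \<le> 2 * c" by linarith
      then show "- (t / 2 * (log_energy_x A b t - log_energy_x A a t)) \<le> c" by (simp add: algebra_simps abs_le_iff)
    qed auto
    also have "\<dots> = (T - s) * c" using s by simp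
    also have "\<dots> \<le> T * c" using s A0 eta by (intro mult_right_mono) (auto simp: c_def)
    finally show ?thesis by simp
  qed
  have "integral {s..T} (\<lambda>t. integral {a..b} (\<lambda>x. 2 * (log_energy_t A x t - t / 2 * log_energy_xx A x t))) 
      = 2 * integral {s..T} (\<lambda>t. integral {a..b} (\<lambda>x. log_energy_t A x t - t / 2 * log_energy_xx A x t))"
    by (simp only: Henstock_Kurzweil_Integration.integral_mult_right)
  also have "\<dots> \<le> 2 * (T * (A * (m + \<eta>)) - (T * (A * (m - \<eta>)) - T * (\<eta>\<^sup>2 / 4)) + T * c)"
    using HT Hs side s T by (subst energy_identity) auto
  also have "\<dots> = T * (\<eta> * (6 * A + 3 / 2 * \<eta> + \<eta>\<^sup>2))"
    by (simp add: c_def field_simps power2_eq_square)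
  also have "\<dots> \<le> T * (\<eta> * (6 * A + 2 * M + M\<^sup>2))"
  proof -
    have "\<eta>\<^sup>2 \<le> M\<^sup>2" using eta by (intro power_mono) auto
    then have "6 * A + 3 / 2 * \<eta> + \<eta>\<^sup>2 \<le> 6 * A + 2 * M + M\<^sup>2" using eta by linarith
    then show ?thesis using T eta by (intro mult_left_mono) auto
  qed
  finally show ?thesis .
qed

text \<open>
  The energy estimate is uniform in the height \<open>s\<close> of the bottom, and \<open>s\<close> tends to zero by monotone
  convergence.
\<close>

lemma carleson_box_estimate:
  assumes T: "0 < T" and ab: "b = a + T"
    and eta: "0 \<le> \<eta>" "\<eta> \<le> M"
    and bp: "\<And>x t. a \<le> x \<Longrightarrow> x \<le> b \<Longrightarrow> 0 < t \<Longrightarrow> t \<le> T \<Longrightarrow> \<bar>t * p x t\<bar> \<le> \<eta>"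
    and bq: "\<And>x t. a \<le> x \<Longrightarrow> x \<le> b \<Longrightarrow> 0 < t \<Longrightarrow> t \<le> T \<Longrightarrow> \<bar>t\<^sup>2 * q x t\<bar> \<le> \<eta>"
    and top: "\<And>x. a \<le> x \<Longrightarrow> x \<le> b \<Longrightarrow> ln (u x T) \<le> m + \<eta>"
    and bottom: "\<And>s. 0 < s \<Longrightarrow> s < T \<Longrightarrow> T * (m - \<eta>) \<le> integral {a..b} (\<lambda>x. ln (u x s))"
    and k: "\<And>x t. 0 < t \<Longrightarrow> k x t \<le> t ^ 3 * (q x t)\<^sup>2 / 4 + 9 / 4 * t * (p x t)\<^sup>2"
  defines "A \<equiv> 13 / 4 + 5 / 2 * M\<^sup>2"
  shows "(\<integral>\<^sup>+t\<in>{0<..<T}. (\<integral>\<^sup>+x\<in>{a..b}. ennreal (k x t) \<partial>lborel) \<partial>lborel) \<le> ennreal (T * (\<eta> * (6 * A + 2 * M + M\<^sup>2)))"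
proof -
  define D where "D x t = 2 * (log_energy_t A x t - t / 2 * log_energy_xx A x t)" for x t
  define g where "g t = integral {a..b} (\<lambda>x. D x t)" for t
  have Dge: "t ^ 3 * (q x t)\<^sup>2 / 4 + 9 / 4 * t * (p x t)\<^sup>2 \<le> D x t" if "a \<le> x" "x \<le> b" "0 < t" "t \<le> T" for x t
    unfolding D_def A_def using bp[OF that] eta by (intro caloric_defect_ge that) auto
  have D0: "0 \<le> D x t" if "a \<le> x" "x \<le> b" "0 < t" "t \<le> T" for x t
    using that by (intro order_trans[OF _ Dge[OF that]]) auto
  have cD: "continuous_on {a..b} (\<lambda>x. D x t)" if "0 < t" for t
    unfolding D_def using that by (intro continuous_intros) auto
  have inner: "(\<integral>\<^sup>+x\<in>{a..b}. ennreal (k x t) \<partial>lborel) \<le> ennreal (g t)" if t: "0 < t" "t \<le> T" for t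
  proof -
    have "(\<integral>\<^sup>+x\<in>{a..b}. ennreal (k x t) \<partial>lborel) \<le> (\<integral>\<^sup>+x\<in>{a..b}. ennreal (D x t) \<partial>lborel)"
    proof (rule nn_integral_mono)
      fix x
      show "ennreal (k x t) * indicator {a..b} x \<le> ennreal (D x t) * indicator {a..b} x"
        using order_trans[OF k Dge, of t x] t by (auto simp: indicator_def intro!: ennreal_leI)
    qed
    also have "\<dots> = ennreal (g t)"
      unfolding g_def using t by (intro nn_integral_Icc_continuous cD D0) auto
    finally show ?thesis .
  qed
  have g0: "0 \<le> g t" if "0 < t" "t \<le> T" for t
    unfolding g_def using that by (intro Henstock_Kurzweil_Integration.integral_nonneg integrable_continuous_real cD D0) auto
  have cg: "continuous_on {s..T} g" if "0 < s" for s
  proof -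
    have "continuous_on ({s..T} \<times> cbox a b) (\<lambda>(t, x). D x t)"
      unfolding split_beta D_def using that by (intro continuous_intros) auto
    from integral_continuous_on_param[OF this] show ?thesis by (simp add: g_def[abs_def])
  qed
  \<comment> \<open>The boxes over \<open>[\<sigma> n, T]\<close> increase to the full box.\<close>
  define \<sigma> where "\<sigma> n = T / (real n + 2)" for n
  have sig: "0 < \<sigma> n" "\<sigma> n < T" for n using T by (auto simp: \<sigma>_def field_simps add_pos_nonneg)
  define h where "h n t = ennreal (g t) * indicator {\<sigma> n..T} t" for n t
  have hm: "h n \<in> borel_measurable lborel" for n
  proof -
    have "(\<lambda>t. indicator {\<sigma> n..T} t *\<^sub>R g t) \<in> borel_measurable borel"
      by (intro borel_measurable_continuous_on_indicator cg sig) auto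
    then have "(\<lambda>t. ennreal (indicator {\<sigma> n..T} t *\<^sub>R g t)) \<in> borel_measurable borel" by measurable
    moreover have "(\<lambda>t. ennreal (indicator {\<sigma> n..T} t *\<^sub>R g t)) = h n"
      by (auto simp: h_def indicator_def)
    ultimately show ?thesis by simp
  qed
  have "incseq h"
  proof (rule incseq_SucI, rule le_funI)
    fix n t
    have "\<sigma> (Suc n) \<le> \<sigma> n" unfolding \<sigma>_def using T by (intro divide_left_mono) auto
    then show "h n t \<le> h (Suc n) t" by (auto simp: h_def indicator_def)
  qed
  have hle: "(\<integral>\<^sup>+t. h n t \<partial>lborel) \<le> ennreal (T * (\<eta> * (6 * A + 2 * M + M\<^sup>2)))" for n
  proof -
    have "(\<integral>\<^sup>+t. h n t \<partial>lborel) = ennreal (integral {\<sigma> n..T} g)"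
      unfolding h_def using sig[of n] by (intro nn_integral_Icc_continuous cg g0) auto
    also have "\<dots> \<le> ennreal (T * (\<eta> * (6 * A + 2 * M + M\<^sup>2)))"
      unfolding g_def D_def A_def
      by (intro ennreal_leI energy_estimate[where m=m] sig ab eta bp bq top bottom)
    finally show ?thesis .
  qed
  have "(\<integral>\<^sup>+t\<in>{0<..<T}. (\<integral>\<^sup>+x\<in>{a..b}. ennreal (k x t) \<partial>lborel) \<partial>lborel) \<le> (\<integral>\<^sup>+t. (SUP n. h n t) \<partial>lborel)"
  proof (rule nn_integral_mono)
    fix t
    show "(\<integral>\<^sup>+x\<in>{a..b}. ennreal (k x t) \<partial>lborel) * indicator {0<..<T} t \<le> (SUP n. h n t)"
    proof (cases "0 < t \<and> t < T")
      case True
      obtain n where "T / t < real n" using reals_Archimedean2 by blast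
      then have "\<sigma> n \<le> t" using True T by (simp add: \<sigma>_def field_simps)
      then have "h n t = ennreal (g t)" using True by (simp add: h_def)
      then have "ennreal (g t) \<le> (SUP n. h n t)" by (metis SUP_upper UNIV_I)
      then show ?thesis using inner[of t] True by auto
    qed (auto simp: indicator_def)
  qed
  also have "\<dots> = (SUP n. \<integral>\<^sup>+t. h n t \<partial>lborel)"
    using \<open>incseq h\<close> hm by (intro nn_integral_monotone_convergence_SUP) auto
  also have "\<dots> \<le> ennreal (T * (\<eta> * (6 * A + 2 * M + M\<^sup>2)))"
    by (intro SUP_least hle)
  finally show ?thesis .
qed

end

section \<open>The complex dilatation\<close>

sublocale controlled_weight \<subseteq> positive_caloric "heat (\<lambda>y. exp (\<alpha> y))" "heat_x (\<lambda>y. exp (\<alpha> y))"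
  "heat_xx (\<lambda>y. exp (\<alpha> y))" "heat_xxx (\<lambda>y. exp (\<alpha> y))"
proof unfold_locales
  fix x t :: real assume t: "0 < t"
  show "0 < heat (\<lambda>y. exp (\<alpha> y)) x t"
    by (rule less_le_trans[OF exp_gt_zero heat_exp_ge[OF t]])
qed (intro DERIV_heat_x DERIV_heat_xx DERIV_heat_xxx DERIV_heat_t DERIV_heat_x_t exp_tame_exp_alpha
      continuous_on_heat continuous_on_fst continuous_on_snd continuous_on_id; simp; fail)+

lemma measurable_phi [measurable]: "phi \<in> borel_measurable borel"
  unfolding phi_def[abs_def] by measurable

lemma measurable_psi [measurable]: "psi \<in> borel_measurable borel"
  unfolding psi_def[abs_def] by measurable

lemma convolution_eq_lborel:
  assumes [measurable]: "f \<in> borel_measurable borel" "k \<in> borel_measurable borel"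
  shows "Defs.convolution f (dilate k t) x = (\<integral>y. f y * dilate k t (x - y) \<partial>lborel)"
  unfolding Defs.convolution_def dilate_def by (rule integral_completion) measurable

lemma convolution_phi_eq_heat:
  assumes [measurable]: "f \<in> borel_measurable borel" and t: "0 < t"
  shows "Defs.convolution f (dilate phi t) x = heat f x t"
proof -
  have "Defs.convolution f (dilate phi t) x = (\<integral>y. gauss 0 ((x - y) / t) * f y / (t * sqrt pi) \<partial>lborel)"
    unfolding convolution_eq_lborel[OF assms(1) measurable_phi]
    by (intro Bochner_Integration.integral_cong) (simp_all add: dilate_def phi_def gauss_def mult_ac)
  then show ?thesis by (simp add: heat_def gaussconv_def)
qed

lemma convolution_psi_eq_heat_x:
  assumes [measurable]: "f \<in> borel_measurable borel" and t: "0 < t"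
  shows "Defs.convolution f (dilate psi t) x = t * heat_x f x t"
proof -
  have "Defs.convolution f (dilate psi t) x = (\<integral>y. - 2 * (gauss 1 ((x - y) / t) * f y) / (t * sqrt pi) \<partial>lborel)"
    unfolding convolution_eq_lborel[OF assms(1) measurable_psi] using t
    by (intro Bochner_Integration.integral_cong) (simp_all add: dilate_def psi_def phi_def gauss_def field_simps)
  also have "\<dots> = - 2 * gaussconv f 1 x t / (t * sqrt pi)"
    unfolding gaussconv_def integral_divide_zero integral_mult_right_zero ..
  finally show ?thesis using t by (simp add: heat_x_def power2_eq_square)
qed

context controlled_weight
begin

abbreviation "\<omega> \<equiv> \<lambda>y. exp (\<alpha> y)"

lemma integrable_Icc_exp: "integrable lborel (\<lambda>y. indicator {a..b} y * \<omega> y)"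
proof -
  have "integrable lebesgue (\<lambda>y. indicator {a..b} y * \<omega> y)"
    using le by (auto simp: locally_integrable_def set_integrable_def)
  then show ?thesis by (subst (asm) integrable_completion) auto
qed

text \<open>
  The identity \<open>V = t U\<^sub>x = t u\<close> holds because \<open>\<psi>\<^sub>t\<close> is \<open>t\<close> times the derivative of \<open>\<phi>\<^sub>t\<close>. Differentiating
  \<open>U\<^sub>x = u\<close> once more gives \<open>U\<^sub>t = (t/2) U\<^sub>x\<^sub>x = (t/2) u\<^sub>x\<close>.
\<close>

lemma dilatation_formula:
  assumes f: "\<And>a b. a \<le> b \<Longrightarrow> f b - f a = (\<integral>y. indicator {a..b} y * \<omega> y \<partial>lborel)" "f 0 = 0"
    and t: "0 < t"
  shows "complex_dilatation (heat_extension f) (Complex x t) =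
     Complex (- (t\<^sup>2 * heat_xx \<omega> x t / 2)) (3 / 2 * t * heat_x \<omega> x t) /
     Complex (2 * heat \<omega> x t + t\<^sup>2 * heat_xx \<omega> x t / 2) (t / 2 * heat_x \<omega> x t)"
proof -
  note prim = exp_tame_exp_alpha exp_ge_zero f integrable_Icc_exp
  have tf: "exp_tame f" by (rule exp_tame_primitive[OF exp_tame_exp_alpha exp_ge_zero f])
  then have mf: "f \<in> borel_measurable borel" by (simp add: exp_tame_def)
  have hx: "heat_x f x t = heat \<omega> x t" if "0 < t" for x t
    using that by (intro heat_x_primitive[OF prim])
  have hxx: "heat_xx f x t = heat_x \<omega> x t" if "0 < t" for x t
    using DERIV_heat_xx[OF tf that, of x] DERIV_heat_x[OF exp_tame_exp_alpha that, of x]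
    unfolding hx[OF that] by (rule DERIV_unique)
  let ?F = "heat_extension f"
  have F: "?F (Complex x t) = Complex (heat f x t) (t * heat \<omega> x t)" if "0 < t" for x t
    using that by (simp add: heat_extension_def convolution_phi_eq_heat[OF mf] convolution_psi_eq_heat_x[OF mf] hx)
  have px: "partial_x ?F (Complex x t) = Complex (heat \<omega> x t) (t * heat_x \<omega> x t)"
  proof -
    have "((\<lambda>x. Complex (heat f x t) (t * heat \<omega> x t)) has_vector_derivative Complex (heat \<omega> x t) (t * heat_x \<omega> x t)) (at x)"
      using DERIV_heat_x[OF tf t, of x] DERIV_cmult[OF DERIV_heat_x[OF exp_tame_exp_alpha t, of x], of t]
      by (simp add: has_vector_derivative_complex_iff hx[OF t] has_real_derivative_iff_has_vector_derivative)
    then show ?thesis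
      unfolding partial_x_def using F[OF t] by (simp add: vector_derivative_at)
  qed
  have pt: "partial_t ?F (Complex x t) = Complex (t / 2 * heat_x \<omega> x t) (heat \<omega> x t + t * (t / 2 * heat_xx \<omega> x t))"
  proof -
    have "((\<lambda>t. t * heat \<omega> x t) has_real_derivative heat \<omega> x t + t * (t / 2 * heat_xx \<omega> x t)) (at t)"
      by (auto intro!: derivative_eq_intros DERIV_heat_t exp_tame_exp_alpha t)
    then have "((\<lambda>t. Complex (heat f x t) (t * heat \<omega> x t)) has_vector_derivative 
        Complex (t / 2 * heat_x \<omega> x t) (heat \<omega> x t + t * (t / 2 * heat_xx \<omega> x t))) (at t)"
      using DERIV_heat_t[OF tf t, of x]
      by (simp add: has_vector_derivative_complex_iff hxx[OF t] has_real_derivative_iff_has_vector_derivative)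
    then have "((\<lambda>t. ?F (Complex x t)) has_vector_derivative 
        Complex (t / 2 * heat_x \<omega> x t) (heat \<omega> x t + t * (t / 2 * heat_xx \<omega> x t))) (at t)"
      by (rule has_vector_derivative_transform_within_open[where S="{0<..}"]) (use t F in auto)
    then show ?thesis
      unfolding partial_t_def by (simp add: vector_derivative_at)
  qed
  have "wirtinger_dbar ?F (Complex x t) = Complex (- (t\<^sup>2 * heat_xx \<omega> x t / 2)) (3 / 2 * t * heat_x \<omega> x t) / 2"
    unfolding wirtinger_dbar_def px pt by (simp add: complex_eq_iff power2_eq_square)
  moreover have "wirtinger_d ?F (Complex x t) = Complex (2 * heat \<omega> x t + t\<^sup>2 * heat_xx \<omega> x t / 2) (t / 2 * heat_x \<omega> x t) / 2"
    unfolding wirtinger_d_def px pt by (simp add: complex_eq_iff power2_eq_square)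
  moreover have "(v / 2) / (w / 2) = v / w" for v w :: complex by simp
  ultimately show ?thesis by (simp only: complex_dilatation_def)
qed

text \<open>
  The combination is the convolution of \<open>\<omega>\<close> with the dilate of the positive kernel \<open>2x\<^sup>2\<phi>\<close>.
  Therefore the real part of the denominator in the dilatation is at least \<open>u\<close>.
\<close>

lemma heat_plus_heat_xx_nonneg:
  assumes "0 < t"
  shows "0 \<le> heat \<omega> x t + t\<^sup>2 * heat_xx \<omega> x t / 2"
proof -
  have "heat \<omega> x t + t\<^sup>2 * heat_xx \<omega> x t / 2 = 2 * gaussconv \<omega> 2 x t / (t * sqrt pi)"
    using assms by (simp add: heat_def heat_xx_def field_simps power2_eq_square power3_eq_cube)
  moreover have "0 \<le> gaussconv \<omega> 2 x t"
    unfolding gaussconv_def gauss_def by (intro integral_nonneg_AE) auto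
  ultimately show ?thesis using assms by simp
qed

lemma dilatation_bound:
  assumes f: "\<And>a b. a \<le> b \<Longrightarrow> f b - f a = (\<integral>y. indicator {a..b} y * \<omega> y \<partial>lborel)" "f 0 = 0"
    and t: "0 < t"
  shows "1 / t * (cmod (complex_dilatation (heat_extension f) (Complex x t)))\<^sup>2
    \<le> t ^ 3 * (q x t)\<^sup>2 / 4 + 9 / 4 * t * (p x t)\<^sup>2"
proof -
  let ?u = "heat \<omega> x t" and ?n = "Complex (- (t\<^sup>2 * heat_xx \<omega> x t / 2)) (3 / 2 * t * heat_x \<omega> x t)"
  let ?d = "Complex (2 * heat \<omega> x t + t\<^sup>2 * heat_xx \<omega> x t / 2) (t / 2 * heat_x \<omega> x t)"
  have u: "0 < ?u" by (rule pos[OF t])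
  have "?u \<le> Re ?d" using heat_plus_heat_xx_nonneg[OF t, of x] by simp
  also have "\<dots> \<le> cmod ?d" by (rule complex_Re_le_cmod)
  finally have "cmod (?n / ?d) \<le> cmod ?n / ?u" using u by (simp add: norm_divide frac_le)
  then have "(cmod (?n / ?d))\<^sup>2 \<le> (cmod ?n / ?u)\<^sup>2" by (intro power_mono) auto
  also have "\<dots> = (t\<^sup>2 * q x t / 2)\<^sup>2 + (3 / 2 * t * p x t)\<^sup>2"
    unfolding power_divide cmod_power2 p_def q_def using u by (simp add: field_simps power2_eq_square)
  finally have "1 / t * (cmod (?n / ?d))\<^sup>2 \<le> 1 / t * ((t\<^sup>2 * q x t / 2)\<^sup>2 + (3 / 2 * t * p x t)\<^sup>2)"
    using t by (intro mult_left_mono) auto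
  also have "\<dots> = t ^ 3 * (q x t)\<^sup>2 / 4 + 9 / 4 * t * (p x t)\<^sup>2"
    using t by (simp add: field_simps power2_eq_square power3_eq_cube)
  also have "?n / ?d = complex_dilatation (heat_extension f) (Complex x t)"
    by (rule dilatation_formula[OF f t, symmetric])
  finally show ?thesis .
qed

lemma density_dilatation:
  assumes f: "\<And>a b. a \<le> b \<Longrightarrow> f b - f a = (\<integral>y. indicator {a..b} y * \<omega> y \<partial>lborel)" "f 0 = 0"
  shows "density_on_half_plane (\<lambda>x t. 1 / t * (cmod (complex_dilatation (heat_extension f) (Complex x t)))\<^sup>2)"
proof -
  let ?S = "{z :: real \<times> real. 0 < snd z}"
  let ?k = "\<lambda>z. 1 / snd z * (cmod (Complex (- ((snd z)\<^sup>2 * heat_xx \<omega> (fst z) (snd z) / 2)) (3 / 2 * snd z * heat_x \<omega> (fst z) (snd z)) /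
     Complex (2 * heat \<omega> (fst z) (snd z) + (snd z)\<^sup>2 * heat_xx \<omega> (fst z) (snd z) / 2) (snd z / 2 * heat_x \<omega> (fst z) (snd z))))\<^sup>2"
  have "continuous_on ?S ?k"
  proof (intro continuous_intros ballI cont_uxt)
    fix z :: "real \<times> real" assume "z \<in> ?S"
    then have z: "0 < snd z" by simp
    show "Complex (2 * heat \<omega> (fst z) (snd z) + (snd z)\<^sup>2 * heat_xx \<omega> (fst z) (snd z) / 2) (snd z / 2 * heat_x \<omega> (fst z) (snd z)) \<noteq> 0"
      using pos[OF z, of "fst z"] heat_plus_heat_xx_nonneg[OF z, of "fst z"] by (auto simp: complex_eq_iff)
  qed (auto intro: exp_tame_exp_alpha)
  moreover have "?S \<in> sets lebesgue"
  proof -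
    have "open ?S" by (intro open_Collect_less continuous_intros)
    then show ?thesis by auto
  qed
  ultimately have "?k \<in> borel_measurable (lebesgue_on ?S)"
    by (rule continuous_imp_measurable_on_sets_lebesgue)
  also have "?k \<in> borel_measurable (lebesgue_on ?S) \<longleftrightarrow>
    (\<lambda>(x, t). 1 / t * (cmod (complex_dilatation (heat_extension f) (Complex x t)))\<^sup>2) \<in> borel_measurable (lebesgue_on ?S)"
    by (intro measurable_cong) (auto simp: dilatation_formula[OF f])
  finally show ?thesis
    unfolding density_on_half_plane_def by (auto simp: split_beta' case_prod_unfold)
qed

text \<open>
  With \<open>\<epsilon> = E\<close> this applies to every interval, and with small \<open>\<epsilon>\<close> to every sufficiently short one.
\<close>

lemma carleson_ratio_dilatation:
  assumes f: "\<And>a b. a \<le> b \<Longrightarrow> f b - f a = (\<integral>y. indicator {a..b} y * \<omega> y \<partial>lborel)" "f 0 = 0"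
  obtains C where "0 < C"
    "\<And>\<epsilon> a b. 0 \<le> \<epsilon> \<Longrightarrow> \<epsilon> \<le> E \<Longrightarrow> a < b \<Longrightarrow> (\<And>t. 0 < t \<Longrightarrow> t \<le> b - a \<Longrightarrow> controlled \<alpha> \<epsilon> t) \<Longrightarrow>
      carleson_ratio (\<lambda>x t. 1 / t * (cmod (complex_dilatation (heat_extension f) (Complex x t)))\<^sup>2) a b \<le> ennreal (\<epsilon> * C)"
proof -
  obtain K1 where K1: "0 < K1" 
    "\<And>\<epsilon> T a x. \<lbrakk>0 \<le> \<epsilon>; \<epsilon> \<le> E; controlled \<alpha> \<epsilon> T; 0 < T; a \<le> x; x \<le> a + T\<rbrakk> \<Longrightarrow>
       \<bar>ln (heat \<omega> x T) - interval_mean a (a + T) \<alpha>\<bar> \<le> \<epsilon> * K1 \<and>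
       \<bar>T * heat_x \<omega> x T / heat \<omega> x T\<bar> \<le> \<epsilon> * K1 \<and> \<bar>T\<^sup>2 * heat_xx \<omega> x T / heat \<omega> x T\<bar> \<le> \<epsilon> * K1"
    using heat_estimates by blast
  obtain K2 where K2: "0 < K2" 
    "\<And>\<epsilon> T a t. \<lbrakk>0 \<le> \<epsilon>; controlled \<alpha> \<epsilon> T; 0 < t; t \<le> T\<rbrakk> \<Longrightarrow>
       \<bar>integral {a..a + T} (\<lambda>x. heat \<alpha> x t) - T * interval_mean a (a + T) \<alpha>\<bar> \<le> T * (\<epsilon> * K2)"
    using mean_heat_alpha by blast
  define K where "K = K1 + K2"
  have K: "0 < K" "K1 \<le> K" "K2 \<le> K" using K1(1) K2(1) by (auto simp: K_def)
  define M where "M = E * K"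
  define C where "C = K * (6 * (13 / 4 + 5 / 2 * M\<^sup>2) + 2 * M + M\<^sup>2)"
  have M: "0 < M" using E K by (simp add: M_def)
  have C: "0 < C" unfolding C_def using K M by (intro mult_pos_pos add_pos_pos) auto
  show ?thesis
  proof (rule that[OF C])
    fix \<epsilon> a b :: real
    assume e: "0 \<le> \<epsilon>" "\<epsilon> \<le> E" and ab: "a < b" and ctr: "\<And>t. 0 < t \<Longrightarrow> t \<le> b - a \<Longrightarrow> controlled \<alpha> \<epsilon> t"
    define T where "T = b - a"
    have T: "0 < T" "b = a + T" using ab by (auto simp: T_def)
    define m where "m = interval_mean a (a + T) \<alpha>"
    define \<eta> where "\<eta> = \<epsilon> * K"
    have eK: "\<epsilon> * K1 \<le> \<eta>" "\<epsilon> * K2 \<le> \<eta>" using mult_left_mono[OF K(2) e(1)] mult_left_mono[OF K(3) e(1)] by (simp_all add: \<eta>_def)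
    let ?k = "\<lambda>x t. 1 / t * (cmod (complex_dilatation (heat_extension f) (Complex x t)))\<^sup>2"
    have ctrT: "controlled \<alpha> \<epsilon> T" using ctr[of T] T(1) by (simp add: T_def)
    have box: "(\<integral>\<^sup>+t\<in>{0<..<T}. (\<integral>\<^sup>+x\<in>{a..b}. ennreal (?k x t) \<partial>lborel) \<partial>lborel)
       \<le> ennreal (T * (\<eta> * (6 * (13 / 4 + 5 / 2 * M\<^sup>2) + 2 * M + M\<^sup>2)))"
    proof (rule carleson_box_estimate[where m=m])
      show "0 < T" "b = a + T" by (fact T)+
      show "0 \<le> \<eta>" "\<eta> \<le> M" using e K by (auto simp: \<eta>_def M_def mult_right_mono)
      fix x t :: real
      show "?k x t \<le> t ^ 3 * (q x t)\<^sup>2 / 4 + 9 / 4 * t * (p x t)\<^sup>2" if "0 < t"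
        by (rule dilatation_bound[OF f that])
      show "\<bar>t * p x t\<bar> \<le> \<eta>" "\<bar>t\<^sup>2 * q x t\<bar> \<le> \<eta>" if "0 < t" "t \<le> T"
        using K1(2)[OF e ctr, of t x x] that eK(1) by (auto simp: p_def q_def T_def)
      show "ln (heat \<omega> x T) \<le> m + \<eta>" if "a \<le> x" "x \<le> b"
        using K1(2)[OF e ctrT T(1), of a x] that T(2) eK(1) unfolding m_def by linarith
    next
      fix s assume s: "0 < s" "s < T"
      have "T * (m - \<eta>) \<le> T * (m - \<epsilon> * K2)" using eK(2) T by (intro mult_left_mono) auto
      also have "\<dots> \<le> integral {a..b} (\<lambda>x. heat \<alpha> x s)"
        using K2(2)[OF e(1) ctrT s(1), of a] s unfolding m_def T(2) by (simp add: algebra_simps abs_le_iff)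
      also have "\<dots> \<le> integral {a..b} (\<lambda>x. ln (heat \<omega> x s))"
      proof (rule integral_le)
        show "(\<lambda>x. heat \<alpha> x s) integrable_on {a..b}"
          using s exp_tame_alpha by (intro integrable_continuous_real continuous_intros) auto
        show "(\<lambda>x. ln (heat \<omega> x s)) integrable_on {a..b}"
          using s pos[OF s(1)] by (intro integrable_continuous_real continuous_intros) (auto simp: less_imp_neq[symmetric])
        show "heat \<alpha> x s \<le> ln (heat \<omega> x s)" for x
          using heat_exp_ge[OF s(1), of x] pos[OF s(1), of x] by (simp add: ln_ge_iff)
      qed
      finally show "T * (m - \<eta>) \<le> integral {a..b} (\<lambda>x. ln (heat \<omega> x s))" .
    qed
    have "carleson_ratio ?k a b \<le> ennreal (T * (\<epsilon> * C)) / ennreal T"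
      unfolding carleson_ratio_def nn_integral_completion T_def[symmetric]
      using box by (intro divide_right_mono_ennreal) (simp add: \<eta>_def C_def mult_ac)
    also have "\<dots> = ennreal (\<epsilon> * C)" using T(1) e C by (simp add: divide_ennreal)
    finally show "carleson_ratio ?k a b \<le> ennreal (\<epsilon> * C)" .
  qed
qed

end

section \<open>Reduction to Borel weights and the theorem\<close>

lemma locally_integrable_measurable:
  assumes "locally_integrable h"
  shows "h \<in> borel_measurable lebesgue"
proof (rule borel_measurable_LIMSEQ_real)
  show "(\<lambda>x. indicator {- real n..real n} x * h x) \<in> borel_measurable lebesgue" for n
    using assms by (auto simp: locally_integrable_def set_integrable_def)
  fix x
  obtain N where N: "\<bar>x\<bar> \<le> real N" using real_arch_simple by blast
  have "\<forall>\<^sub>F n in sequentially. indicator {- real n..real n} x * h x = h x"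
    using eventually_ge_at_top[of N]
  proof eventually_elim
    case (elim n)
    then have "real N \<le> real n" by simp
    then show ?case using N by (auto simp: indicator_def)
  qed
  then show "(\<lambda>n. indicator {- real n..real n} x * h x) \<longlonglongrightarrow> h x" by (rule tendsto_eventually)
qed

text \<open>
  Tonelli's theorem for the product of two Borel measures is used above, so the weight is
  replaced by a Borel function that is positive everywhere; neither the means nor the primitive notice it.
\<close>

lemma locally_integrable_cong_AE:
  assumes h: "locally_integrable h" and g: "g \<in> borel_measurable borel" and ae: "AE x in lebesgue. h x = g x"
  shows "locally_integrable g" "(LINT x:{a..b}|lebesgue. h x) = (LINT x:{a..b}|lebesgue. g x)"
    "interval_mean a b h = interval_mean a b g"
proof -
  have g': "g \<in> borel_measurable lebesgue" using g by (simp add: measurable_completion)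
  have h': "h \<in> borel_measurable lebesgue" by (rule locally_integrable_measurable[OF h])
  show I: "(LINT x:{a..b}|lebesgue. h x) = (LINT x:{a..b}|lebesgue. g x)"
    unfolding set_lebesgue_integral_def
  proof (rule integral_cong_AE)
    show "(\<lambda>x. indicator {a..b} x *\<^sub>R h x) \<in> borel_measurable lebesgue"
      "(\<lambda>x. indicator {a..b} x *\<^sub>R g x) \<in> borel_measurable lebesgue"
      using h' g' by (auto intro!: borel_measurable_scaleR borel_measurable_indicator simp del: real_scaleR_def)
    show "AE x in lebesgue. indicator {a..b} x *\<^sub>R h x = indicator {a..b} x *\<^sub>R g x"
      using ae by eventually_elim simp
  qed
  show "interval_mean a b h = interval_mean a b g" unfolding interval_mean_def by (simp add: I)
  show "locally_integrable g" unfolding locally_integrable_def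
  proof (intro allI)
    fix a b
    have "integrable lebesgue (\<lambda>x. indicator {a..b} x *\<^sub>R h x)"
      using h by (simp add: locally_integrable_def set_integrable_def)
    then show "set_integrable lebesgue {a..b} g"
      unfolding set_integrable_def
    proof (rule integrable_cong_AE_imp)
      show "(\<lambda>x. indicator {a..b} x *\<^sub>R g x) \<in> borel_measurable lebesgue"
        using g' by (intro borel_measurable_scaleR borel_measurable_indicator) auto
      show "AE x in lebesgue. indicator {a..b} x *\<^sub>R h x = indicator {a..b} x *\<^sub>R g x"
        using ae by eventually_elim simp
    qed
  qed
qed

lemma mean_oscillation_cong_AE:
  assumes h: "locally_integrable h" and g: "g \<in> borel_measurable borel" and ae: "AE x in lebesgue. h x = g x"
  shows "mean_oscillation a b h = mean_oscillation a b g"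
  unfolding mean_oscillation_def locally_integrable_cong_AE(3)[OF h g ae]
  by (rule locally_integrable_cong_AE(3))
     (use g ae in \<open>auto intro!: locally_integrable_abs locally_integrable_diff h\<close>)

lemma primitive_increment:
  assumes w: "locally_integrable \<omega>" and f: "\<And>x. f x = (LINT y=0..ereal x|lebesgue. \<omega> y)" and ab: "a \<le> b"
  shows "f b - f a = (LINT y:{a..b}|lebesgue. \<omega> y)" "f 0 = 0"
proof -
  have int: "\<omega> integrable_on {c..d}" for c d by (rule locally_integrable_integrable_on[OF w])
  have oi: "(LINT y:{c<..<d}|lebesgue. \<omega> y) = integral {c..d} \<omega>" for c d :: real
  proof -
    have "set_integrable lebesgue {c..d} \<omega>" using w by (simp add: locally_integrable_def)
    then have "set_integrable lebesgue {c<..<d} \<omega>" by (rule set_integrable_subset) auto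
    then show ?thesis by (simp add: set_lebesgue_integral_eq_integral integral_open_interval_real)
  qed
  have fx: "f x = (if 0 \<le> x then integral {0..x} \<omega> else - integral {x..0} \<omega>)" for x
  proof -
    have "einterval 0 (ereal x) = {0<..<x}" "einterval (ereal x) 0 = {x<..<0}"
      by (auto simp: einterval_def zero_ereal_def)
    then show ?thesis unfolding f interval_lebesgue_integral_def by (simp add: oi)
  qed
  show "f 0 = 0" by (simp add: fx)
  have "f b - f a = integral {a..b} \<omega>"
    using ab Henstock_Kurzweil_Integration.integral_combine[of 0 a b \<omega>] Henstock_Kurzweil_Integration.integral_combine[of a 0 b \<omega>]
      Henstock_Kurzweil_Integration.integral_combine[of a b 0 \<omega>] int
    by (auto simp: fx)
  then show "f b - f a = (LINT y:{a..b}|lebesgue. \<omega> y)"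
    using w by (simp add: locally_integrable_def set_lebesgue_integral_eq_integral)
qed

theorem theorem4p1:
  fixes \<omega> f :: "real \<Rightarrow> real" and F :: "complex \<Rightarrow> complex"
  assumes "A_infinity_weight \<omega>"
    and "VMO (\<lambda>x. ln (\<omega> x))"
    and "\<And>x. f x = (LINT y=0..ereal x|lebesgue. \<omega> y)"
    and "F = heat_extension f"
  shows "vanishing_carleson_measure
    (\<lambda>x t. 1 / t * (cmod (complex_dilatation F (Complex x t)))\<^sup>2)"
proof -
  have lw: "locally_integrable \<omega>" and wpos: "AE x in lebesgue. 0 < \<omega> x" and lln: "locally_integrable (\<lambda>x. ln (\<omega> x))"
    using assms(1) by (auto simp: A_infinity_weight_def)
  obtain C where C: "\<And>a b. a < b \<Longrightarrow> interval_mean a b \<omega> \<le> C * exp (interval_mean a b (\<lambda>x. ln (\<omega> x)))"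
    using assms(1) by (auto simp: A_infinity_weight_def)
  obtain \<alpha> where \<alpha> [measurable]: "\<alpha> \<in> borel_measurable borel" and "AE x in lborel. ln (\<omega> x) = \<alpha> x"
    using completion_ex_borel_measurable_real[OF locally_integrable_measurable[OF lln]] by auto
  then have ae1: "AE x in lebesgue. ln (\<omega> x) = \<alpha> x" by (intro AE_completion)
  have ae2: "AE x in lebesgue. \<omega> x = exp (\<alpha> x)"
    using ae1 wpos by eventually_elim (metis exp_ln)
  have mexp: "(\<lambda>x. exp (\<alpha> x)) \<in> borel_measurable borel" by measurable
  note cong1 = locally_integrable_cong_AE[OF lln \<alpha> ae1] and cong2 = locally_integrable_cong_AE[OF lw mexp ae2]
  have C': "interval_mean a b (\<lambda>x. exp (\<alpha> x)) \<le> C * exp (interval_mean a b \<alpha>)" if "a < b" for a b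
    using C[OF that] by (simp add: cong1(3) cong2(3))
  have vmo: "VMO \<alpha>"
    using assms(2) cong1(1) unfolding VMO_def BMO_def mean_oscillation_cong_AE[OF lln \<alpha> ae1] by simp
  then have "BMO \<alpha>" by (simp add: VMO_def)
  then obtain E where E: "1 \<le> E" "\<And>T. 0 < T \<Longrightarrow> controlled \<alpha> E T"
    using controlled_globally[OF _ C'] by blast
  interpret controlled_weight \<alpha> E
    by unfold_locales (use \<alpha> cong1(1) cong2(1) E in auto)
  have f: "f b - f a = (\<integral>y. indicator {a..b} y * exp (\<alpha> y) \<partial>lborel)" if "a \<le> b" for a b
  proof -
    have "f b - f a = (LINT y:{a..b}|lebesgue. exp (\<alpha> y))"
      using primitive_increment(1)[OF lw assms(3) that] cong2(2) by simp
    then show ?thesis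
      unfolding set_lebesgue_integral_def by (subst (asm) integral_completion) auto
  qed
  have f0: "f 0 = 0" using primitive_increment(2)[OF lw assms(3) order_refl] .
  obtain K where K: "0 < K" "\<And>\<epsilon> a b. 0 \<le> \<epsilon> \<Longrightarrow> \<epsilon> \<le> E \<Longrightarrow> a < b \<Longrightarrow> (\<And>t. 0 < t \<Longrightarrow> t \<le> b - a \<Longrightarrow> controlled \<alpha> \<epsilon> t) \<Longrightarrow>
      carleson_ratio (\<lambda>x t. 1 / t * (cmod (complex_dilatation (heat_extension f) (Complex x t)))\<^sup>2) a b \<le> ennreal (\<epsilon> * K)"
  proof (rule carleson_ratio_dilatation[where f=f, OF _ f0], erule f, goal_cases)
    case (1 C)
    show ?case by (rule 1(1)[OF 1(2,3)])
  qed
  let ?k = "\<lambda>x t. 1 / t * (cmod (complex_dilatation (heat_extension f) (Complex x t)))\<^sup>2"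
  show ?thesis
    unfolding assms(4) vanishing_carleson_measure_def carleson_measure_def
  proof (intro conjI allI impI)
    show "density_on_half_plane ?k" by (rule density_dilatation[OF f f0])
    have "(SUP (a, b)\<in>{(a, b). a < b}. carleson_ratio ?k a b) \<le> ennreal (E * K)"
    proof (rule SUP_least, clarify)
      fix a b :: real assume "a < b"
      then show "carleson_ratio ?k a b \<le> ennreal (E * K)"
        using E ctr_E by (intro K(2)) auto
    qed
    also have "\<dots> < \<infinity>" by simp
    finally show "(SUP (a, b)\<in>{(a, b). a < b}. carleson_ratio ?k a b) < \<infinity>" .
  next
    fix \<epsilon> :: real assume e: "0 < \<epsilon>"
    define \<eta> where "\<eta> = min E (\<epsilon> / (2 * K))"
    have eta: "0 < \<eta>" "\<eta> \<le> E" using E e K by (auto simp: \<eta>_def)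
    have "\<eta> * K \<le> \<epsilon> / (2 * K) * K" using K by (intro mult_right_mono) (auto simp: \<eta>_def)
    also have "\<dots> < \<epsilon>" using K e by simp
    finally have etaK: "\<eta> * K < \<epsilon>" .
    obtain \<delta> where d: "0 < \<delta>" "\<And>T. 0 < T \<Longrightarrow> T < \<delta> \<Longrightarrow> controlled \<alpha> \<eta> T"
      using controlled_at_small_scales[OF vmo cong2(1) C' eta(1)] by blast
    have "carleson_ratio ?k a b < ennreal \<epsilon>" if "a < b \<and> b - a < \<delta>" for a b
    proof -
      have "carleson_ratio ?k a b \<le> ennreal (\<eta> * K)"
        using that eta d(2) by (intro K(2)) auto
      also have "\<dots> < ennreal \<epsilon>" using etaK e by (simp add: ennreal_lessI)
      finally show ?thesis .
    qed
    then show "\<exists>\<delta>>0. \<forall>a b. a < b \<and> b - a < \<delta> \<longrightarrow> carleson_ratio ?k a b < ennreal \<epsilon>"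
      using d(1) by blast
  qed
qed

end
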